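(* Let $\kappa\le0$ and $\mathfrak{q}\in(0,\mathfrak{q}_\kappa^* )$. Then the infimum $$\mathcal{E}_\kappa(\mathfrak{q})=\inf\{E_\kappa(u): u\in\mathcal{N}\mathcal{X}(\mathbb{R}),\ p(u)=\mathfrak{q}\}$$ is attained at the dark soliton $u_{\mathfrak{c}_\kappa(\mathfrak{q}),\kappa}$, i.e. $\mathcal{E}_\kappa(\mathfrak{q})=E_\kappa(u_{\mathfrak{c}_\kappa(\mathfrak{q}),\kappa})$, and this is the only minimizer, up to invariances. Moreover, $\mathcal{E}_\kappa(\mathfrak{q})=E_\kappa(u_{0,\kappa})$ for all $\mathfrak{q}>\mathfrak{q}_\kappa^*$, and in this case the infimum is not attained.
   Context: Spaces: $\mathcal{X}(\mathbb{R})=\{v\in H^1_{\mathrm{loc}}(\mathbb{R};\mathbb{C}): 1-|v|^2\in L^2(\mathbb{R}),\ v'\in L^2(\mathbb{R})\}$ and $\mathcal{N}\mathcal{X}(\mathbb{R})=\{v\in\mathcal{X}(\mathbb{R}):\inf_{\mathbb{R}}|v|>0\}$. "Up to invariances" means up to $u\mapsto e^{i\phi}u(\cdot-x_0)$, $\phi,x_0\in\mathbb{R}$. Energy: $E_\kappa(u)=\frac12\int_{\mathbb{R}}|u'|^2+\frac14\int_{\mathbb{R}}(1-|u|^2)^2-\frac\kappa4\int_{\mathbb{R}}\big((|u|^2)'\big)^2$. Momentum, for $u\in\mathcal{N}\mathcal{X}(\mathbb{R})$: $p(u)=\frac12\int_{\mathbb{R}}\langle iu',u\rangle\big(1-\frac1{|u|^2}\big)$,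 where $\langle z_1,z_2\rangle=\operatorname{Re}(z_1\overline{z_2})$. Dark solitons for $\kappa\le0$, $0\le c<\sqrt2$: the function $G_{c,\kappa}:(0,1-c^2/2]\to[0,\infty)$, $$G_{c,\kappa}(y)=-2\sqrt{-\kappa}\operatorname{artanh}\Big(\sqrt{-\kappa}\sqrt{\tfrac{2-c^2-2y}{1-2\kappa+2\kappa y}}\Big)+2\sqrt{\tfrac{1-2\kappa}{2-c^2}}\operatorname{artanh}\Big(\sqrt{\tfrac{(1-2\kappa)(2-c^2-2y)}{(2-c^2)(1-2\kappa+2\kappa y)}}\Big),$$ is a decreasing bijection; $\mathcal{G}_{c,\kappa}$ is its inverse extended to $\mathbb{R}$ as an even function. For $c>0$, $u_{c,\kappa}=\sqrt{1-\mathcal{G}_{c,\kappa}}\,e^{i\theta_{c,\kappa}}$ with $\theta_{c,\kappa}(x)=\frac c2\int_0^x\frac{\mathcal{G}_{c,\kappa}(y)}{1-\mathcal{G}_{c,\kappa}(y)}dy$. For $c=0$ (black soliton), $u_{0,\kappa}(x)=\pm\sqrt{1-\mathcal{G}_{0,\kappa}(x)}$ for $\pm x\ge0$. Critical momentum: $\mathfrak{q}_\kappa^*=\sup\{\mathfrak{q}>0:\ \forall v\in\mathcal{X}(\mathbb{R}),\ E_\kappa(v)\le\mathcal{E}_\kappa(\mathfrak{q})\Rightarrow\inf_{\mathbb{R}}|v|>0\}$. Critical speed: $c_\kappa^*=\max\{c\in[0,\sqrt2): E_\kappa(u_{c,\kappa})=E_\kappa(u_{0,\kappa})\}$. The function $c\mapsto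 p(u_{c,\kappa})$ extends to a continuous, strictly decreasing bijection from $[c_\kappa^*,\sqrt2]$ onto $[0,\mathfrak{q}_\kappa^*]$; $\mathfrak{c}_\kappa:[0,\mathfrak{q}_\kappa^*]\to[c_\kappa^*,\sqrt2]$ denotes its inverse, so for $\mathfrak{q}\in(0,\mathfrak{q}_\kappa^* )$, $\mathfrak{c}_\kappa(\mathfrak{q})$ is the unique $c\in(c_\kappa^*,\sqrt2)$ with $p(u_{c,\kappa})=\mathfrak{q}$. *)

theory Defs
  imports "HOL-Analysis.Analysis"
begin

(* Weak derivatives on the line, tested against compactly supported C^1 functions (the
   convention of Brezis' book for Sobolev spaces in dimension one). *)

definition test_function :: "(real \<Rightarrow> real) \<Rightarrow> bool" where
  "test_function \<phi> \<longleftrightarrow> \<phi> C1_differentiable_on UNIV \<and> compact (closure {x. \<phi> x \<noteq> 0})"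

definition locally_integrable ::
    "(real \<Rightarrow> 'a::{banach, second_countable_topology}) \<Rightarrow> bool" where
  "locally_integrable f \<longleftrightarrow> (\<forall>a b. set_integrable lborel {a..b} f)"

definition has_weak_deriv ::
    "(real \<Rightarrow> 'a::{banach, second_countable_topology}) \<Rightarrow> (real \<Rightarrow> 'a) \<Rightarrow> bool" where
  "has_weak_deriv v w \<longleftrightarrow>
     locally_integrable v \<and> locally_integrable w \<and>
     (\<forall>\<phi>. test_function \<phi> \<longrightarrow>
        (LINT x|lborel. deriv \<phi> x *\<^sub>R v x) = - (LINT x|lborel. \<phi> x *\<^sub>R w x))"

(* A weak derivative is unique only almost everywhere; weak_deriv v is one representative.
   It is used below only inside integrals and integrability conditions. *)
definition weak_deriv ::
    "(real \<Rightarrow> 'a::{banach, second_countable_topology}) \<Rightarrow> real \<Rightarrow> 'a" where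
  "weak_deriv v = (SOME w. has_weak_deriv v w)"

definition L2 :: "(real \<Rightarrow> 'a::{banach, second_countable_topology}) set" where
  "L2 = {f. f \<in> borel_measurable lborel \<and> integrable lborel (\<lambda>x. (norm (f x))\<^sup>2)}"

definition L2_loc :: "(real \<Rightarrow> 'a::{banach, second_countable_topology}) set" where
  "L2_loc = {f. f \<in> borel_measurable lborel \<and>
                (\<forall>a b. set_integrable lborel {a..b} (\<lambda>x. (norm (f x))\<^sup>2))}"

(* Every class in H^1_loc of the line has exactly one continuous representative; the elements
   of H1_loc are these representatives, so pointwise values and infima make sense. *)
definition H1_loc :: "(real \<Rightarrow> complex) set" where
  "H1_loc = {v. continuous_on UNIV v \<and> v \<in> L2_loc \<and>
                (\<exists>w. has_weak_deriv v w) \<and> weak_deriv v \<in> L2_loc}"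

definition X_space :: "(real \<Rightarrow> complex) set" where
  "X_space = {v \<in> H1_loc. (\<lambda>x. 1 - (norm (v x))\<^sup>2) \<in> L2 \<and> weak_deriv v \<in> L2}"

definition NX_space :: "(real \<Rightarrow> complex) set" where
  "NX_space = {v \<in> X_space. (INF x. norm (v x)) > 0}"

definition energy :: "real \<Rightarrow> (real \<Rightarrow> complex) \<Rightarrow> real" where
  "energy \<kappa> u =
     1 / 2 * (LINT x|lborel. (norm (weak_deriv u x))\<^sup>2)
     + 1 / 4 * (LINT x|lborel. (1 - (norm (u x))\<^sup>2)\<^sup>2)
     - \<kappa> / 4 * (LINT x|lborel. (weak_deriv (\<lambda>y. (norm (u y))\<^sup>2) x)\<^sup>2)"

(* The real inner product on complex numbers is Re (z * cnj w). *)
definition momentum :: "(real \<Rightarrow> complex) \<Rightarrow> real" where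
  "momentum u =
     1 / 2 * (LINT x|lborel. ((\<i> * weak_deriv u x) \<bullet> u x) * (1 - 1 / (norm (u x))\<^sup>2))"

definition min_energy :: "real \<Rightarrow> real \<Rightarrow> real" where
  "min_energy \<kappa> q = (INF u \<in> {u \<in> NX_space. momentum u = q}. energy \<kappa> u)"

definition is_minimizer :: "real \<Rightarrow> real \<Rightarrow> (real \<Rightarrow> complex) \<Rightarrow> bool" where
  "is_minimizer \<kappa> q u \<longleftrightarrow> u \<in> NX_space \<and> momentum u = q \<and> energy \<kappa> u = min_energy \<kappa> q"

definition G_fun :: "real \<Rightarrow> real \<Rightarrow> real \<Rightarrow> real" where
  "G_fun c \<kappa> y =
     - 2 * sqrt (- \<kappa>) *
         artanh (sqrt (- \<kappa>) * sqrt ((2 - c\<^sup>2 - 2 * y) / (1 - 2 * \<kappa> + 2 * \<kappa> * y)))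
     + 2 * sqrt ((1 - 2 * \<kappa>) / (2 - c\<^sup>2)) *
         artanh (sqrt (((1 - 2 * \<kappa>) * (2 - c\<^sup>2 - 2 * y)) /
                       ((2 - c\<^sup>2) * (1 - 2 * \<kappa> + 2 * \<kappa> * y))))"

definition eta :: "real \<Rightarrow> real \<Rightarrow> real \<Rightarrow> real" where
  "eta c \<kappa> x = the_inv_into {0<..1 - c\<^sup>2 / 2} (G_fun c \<kappa>) \<bar>x\<bar>"

(* The interval integral is oriented, as needed for negative x. *)
definition theta :: "real \<Rightarrow> real \<Rightarrow> real \<Rightarrow> real" where
  "theta c \<kappa> x = c / 2 * (LBINT y=ereal 0..ereal x. eta c \<kappa> y / (1 - eta c \<kappa> y))"

definition dark_soliton :: "real \<Rightarrow> real \<Rightarrow> real \<Rightarrow> complex" where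
  "dark_soliton c \<kappa> x =
     (if c = 0
      then complex_of_real ((if 0 \<le> x then 1 else - 1) * sqrt (1 - eta 0 \<kappa> x))
      else complex_of_real (sqrt (1 - eta c \<kappa> x)) * exp (\<i> * complex_of_real (theta c \<kappa> x)))"

definition critical_momentum :: "real \<Rightarrow> real" where
  "critical_momentum \<kappa> =
     Sup {q. q > 0 \<and> (\<forall>v \<in> X_space. energy \<kappa> v \<le> min_energy \<kappa> q \<longrightarrow> (INF x. norm (v x)) > 0)}"

definition critical_speed :: "real \<Rightarrow> real" where
  "critical_speed \<kappa> =
     (GREATEST c. 0 \<le> c \<and> c < sqrt 2 \<and>
        energy \<kappa> (dark_soliton c \<kappa>) = energy \<kappa> (dark_soliton 0 \<kappa>))"

(* Inverse of the momentum as a function of the speed, for 0 < q < critical_momentum. *)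
definition speed :: "real \<Rightarrow> real \<Rightarrow> real" where
  "speed \<kappa> q =
     (THE c. critical_speed \<kappa> < c \<and> c < sqrt 2 \<and> momentum (dark_soliton c \<kappa>) = q)"

definition equal_up_to_invariances :: "(real \<Rightarrow> complex) \<Rightarrow> (real \<Rightarrow> complex) \<Rightarrow> bool" where
  "equal_up_to_invariances u v \<longleftrightarrow>
     (\<exists>\<phi> x0 :: real. \<forall>x. u x = exp (\<i> * complex_of_real \<phi>) * v (x - x0))"

end

theory Submission
  imports Defs
begin

text \<open>
  Write \<open>\<eta> = 1 - \<bar>u\<bar>\<^sup>2\<close>. If \<open>\<eta>\<close> has the positive maximum \<open>1 - c\<^sup>2 / 2\<close>, completing the square in the phase
  derivative and the Modica trick \<open>A \<eta>'\<^sup>2 + B \<eta>\<^sup>2 \<ge> 2 sqrt (A B) \<bar>\<eta> \<eta>'\<bar>\<close> on both sides of the maximum bound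
  \<open>E(u) - c p(u)\<close> from below by its value \<open>F(c)\<close> at the soliton of speed \<open>c\<close>; if \<open>\<eta> \<le> 0\<close>, this holds
  with \<open>c = sqrt 2\<close> and \<open>F(c) = 0\<close>. Hence the minimal energy at momentum \<open>q\<close> is at least the minimum of
  \<open>c q + F(c)\<close> over \<open>0 \<le> c \<le> sqrt 2\<close>. Since \<open>F' = - P\<close>, with \<open>P(c)\<close> the momentum of the soliton, an interior
  minimum is attained at a speed with \<open>P(c) = q\<close>, that is, at a soliton. If instead the minimum is \<open>F(0)\<close>,
  the energy of the black soliton, it is approached, but not attained, by solitons of small speed
  with a plateau inserted at their peak. Uniqueness of the speed holds because \<open>P\<close> increases up to
  some speed and decreases afterwards, and equality in the Modica trick forces the profile equation.
\<close>

subsection \<open>Primitives of locally integrable functions\<close>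

text \<open>The speed in the lower bound is read off \<open>u\<close>, not off \<open>q\<close>:
  with 1 - c^2/2 as the maximum of eta, the weight \<open>B\<close> vanishes exactly at the peak,
  and the integrated Modica inequality yields the action of a soliton of that same speed. No
  compactness of minimizing sequences enters. Functions with a zero have no momentum; for them E >=
  F(c) holds for every c in (0, sqrt 2), and c -> 0 gives E >= F(0). The black soliton vanishes and
  has exactly this energy, so the critical momentum is the supremum of the q > 0 for which some c q
  + F(c) lies below F(0). Equality in the Modica step alone does not single out the soliton: a
  plateau at the peak also gives equality. It is excluded because it carries more momentum than
  P(c). Closed formulas come from w = sqrt(2 - c^2 - 2 eta), continued with a sign across the peak:
  there the profile equation becomes smooth, and energy and momentum densities have elementary
  primitives in w. Weak derivatives are replaced by the integrated relation
  \<open>primitive\<close>, equivalent for continuous functions, for which product and chain rules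
  follow from local estimates.\<close>

definition primitive ::
    "(real \<Rightarrow> 'a::{banach, second_countable_topology}) \<Rightarrow> (real \<Rightarrow> 'a) \<Rightarrow> bool" where
  "primitive v w \<longleftrightarrow> locally_integrable w \<and>
     (\<forall>a b. a \<le> b \<longrightarrow> v b - v a = (LINT x:{a..b}|lborel. w x))"

lemma primitiveD:
  assumes "primitive v w"
  shows "locally_integrable w" "a \<le> b \<Longrightarrow> v b - v a = (LINT x:{a..b}|lborel. w x)"
  using assms unfolding primitive_def by auto

lemma locally_integrableD: "locally_integrable f \<Longrightarrow> set_integrable lborel {a..b} f"
  unfolding locally_integrable_def by auto

lemma locally_integrable_add:
  "locally_integrable f \<Longrightarrow> locally_integrable g \<Longrightarrow> locally_integrable (\<lambda>x. f x + g x)"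
  unfolding locally_integrable_def by (auto intro: set_integral_add)

lemma locally_integrable_diff:
  "locally_integrable f \<Longrightarrow> locally_integrable g \<Longrightarrow> locally_integrable (\<lambda>x. f x - g x)"
  unfolding locally_integrable_def by (auto intro: set_integral_diff)

lemma locally_integrable_norm:
  "locally_integrable f \<Longrightarrow> locally_integrable (\<lambda>x. norm (f x))"
  unfolding locally_integrable_def by (auto intro: set_integrable_norm)

lemma locally_integrable_bounded_linear:
  "bounded_linear T \<Longrightarrow> locally_integrable f \<Longrightarrow> locally_integrable (\<lambda>x. T (f x))"
  unfolding locally_integrable_def set_integrable_def
  using integrable_bounded_linear[of T lborel]
  by (metis (no_types, lifting) Bochner_Integration.integrable_cong linear_simps(5))

lemma locally_integrable_continuous:
  fixes f :: "real \<Rightarrow> 'a::{banach, second_countable_topology}"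
  shows "continuous_on UNIV f \<Longrightarrow> locally_integrable f"
  unfolding locally_integrable_def
  by (meson borel_integrable_atLeastAtMost' continuous_on_subset subset_UNIV)

lemma integrable_imp_locally_integrable: "integrable lborel f \<Longrightarrow> locally_integrable f"
  unfolding locally_integrable_def set_integrable_def by (auto intro!: integrable_mult_indicator)

lemma locally_integrable_measurable:
  assumes "locally_integrable f"
  shows "f \<in> borel_measurable lborel"
proof (rule borel_measurable_LIMSEQ_metric)
  show "(\<lambda>x. indicator {-real n..real n} x *\<^sub>R f x) \<in> borel_measurable lborel" for n
    using locally_integrableD[OF assms, of "-real n" "real n"] unfolding set_integrable_def by auto
  show "(\<lambda>n. indicator {-real n..real n} x *\<^sub>R f x) \<longlonglongrightarrow> f x" for x
  proof (rule tendsto_eventually)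
    obtain N :: nat where N: "\<bar>x\<bar> \<le> real N" using real_arch_simple by blast
    show "\<forall>\<^sub>F n in sequentially. indicator {-real n..real n} x *\<^sub>R f x = f x"
      using eventually_ge_at_top[of N] by eventually_elim (use N in \<open>auto simp: indicator_def\<close>)
  qed
qed

lemma set_integral_Icc_split:
  fixes f :: "real \<Rightarrow> 'a::{banach, second_countable_topology}"
  assumes "locally_integrable f" "a \<le> b" "b \<le> c"
  shows "(LINT x:{a..c}|lborel. f x) = (LINT x:{a..b}|lborel. f x) + (LINT x:{b..c}|lborel. f x)"
proof -
  have e: "{a..c} = {a..b} \<union> {b..c}" using assms by auto
  have "AE x in lborel. \<not> (x \<in> {a..b} \<and> x \<in> {b..c})"
    using AE_lborel_singleton[of b] by eventually_elim auto
  then show ?thesis unfolding e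
    by (intro set_integral_Un_AE) (use assms(1) in \<open>auto simp: locally_integrable_def\<close>)
qed

text \<open>The error on short intervals is measured by \<open>e\<close> times the integral of
  \<open>g\<close>, which is additive over adjacent intervals. Bisection therefore carries the local
  bound to every interval, and then \<open>e\<close> tends to 0. This is the common engine of the
  product rule and the chain rule.\<close>

lemma primitiveI_local:
  assumes w: "locally_integrable w" and g: "locally_integrable g"
    and loc: "\<And>e x. e > (0::real) \<Longrightarrow> \<exists>d>0. \<forall>y z. y \<le> x \<and> x \<le> z \<and> z - y < d \<longrightarrow>
        norm (v z - v y - (LINT t:{y..z}|lborel. w t)) \<le> e * (LINT t:{y..z}|lborel. g t)"
  shows "primitive v w"
  unfolding primitive_def
proof (intro conjI w allI impI)
  fix a b :: real assume ab: "a \<le> b"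
  let ?I = "LINT t:{a..b}|lborel. g t"
  have *: "norm (v b - v a - (LINT t:{a..b}|lborel. w t)) \<le> e * ?I" if e: "e > 0" for e
    using ab
  proof (induct rule: Bolzano)
    case (trans a b c)
    have "v c - v a - (LINT t:{a..c}|lborel. w t) =
       (v b - v a - (LINT t:{a..b}|lborel. w t)) + (v c - v b - (LINT t:{b..c}|lborel. w t))"
      using set_integral_Icc_split[OF w trans(3,4)] by (simp add: algebra_simps)
    also have "norm \<dots> \<le> e * (LINT t:{a..b}|lborel. g t) + e * (LINT t:{b..c}|lborel. g t)"
      using norm_triangle_mono[OF trans(1,2)] .
    finally show ?case using set_integral_Icc_split[OF g trans(3,4)] by (simp add: algebra_simps)
  next
    case (local x)
    show ?case using loc[OF e, of x] .
  qed
  have I0: "?I \<ge> 0" using *[of 1] norm_ge_zero order_trans by (metis mult_1 zero_less_one)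
  have "norm (v b - v a - (LINT t:{a..b}|lborel. w t)) \<le> 0"
  proof (rule field_le_epsilon)
    fix e :: real assume e: "e > 0"
    have "norm (v b - v a - (LINT t:{a..b}|lborel. w t)) \<le> (e / (?I + 1)) * ?I"
      by (rule *) (use e I0 in auto)
    also have "\<dots> \<le> e" using e I0 by (simp add: field_simps)
    finally show "norm (v b - v a - (LINT t:{a..b}|lborel. w t)) \<le> 0 + e" by simp
  qed
  then show "v b - v a = (LINT t:{a..b}|lborel. w t)" by simp
qed

lemma norm_set_integral_le:
  fixes f :: "real \<Rightarrow> 'a::{banach, second_countable_topology}"
  assumes "locally_integrable f" "locally_integrable g" "\<And>t. t \<in> {a..b} \<Longrightarrow> norm (f t) \<le> g t"
  shows "norm (LINT t:{a..b}|lborel. f t) \<le> (LINT t:{a..b}|lborel. g t)"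
proof -
  have "norm (LINT t:{a..b}|lborel. f t) \<le> (LINT t:{a..b}|lborel. norm (f t))"
    unfolding set_lebesgue_integral_def
    by (rule order_trans[OF integral_norm_bound]) (auto simp: indicator_def)
  also have "\<dots> \<le> (LINT t:{a..b}|lborel. g t)"
    by (rule set_integral_mono)
       (use assms locally_integrable_norm[OF assms(1)] in \<open>auto simp: locally_integrable_def\<close>)
  finally show ?thesis .
qed

text \<open>Increments of \<open>v\<close> are dominated by increments of the indefinite integral of
  \<open>norm (w t)\<close>, and indefinite integrals are continuous.\<close>

lemma primitive_continuous:
  assumes "primitive v w"
  shows "continuous_on UNIV v"
proof -
  note w = primitiveD[OF assms]
  have sc: "isCont v x" for x
  proof -
    let ?n = "\<lambda>t. norm (w t)"
    have n: "locally_integrable ?n" using locally_integrable_norm[OF w(1)] .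
    let ?K = "{x-1..x+1}"
    define N where "N y = integral {x-1..y} ?n" for y
    have Ny: "N y = (LINT t:{x-1..y}|lborel. ?n t)" for y
      unfolding N_def using set_borel_integral_eq_integral(2)[OF locally_integrableD[OF n]] by auto
    have "continuous_on ?K N" unfolding N_def
      by (rule indefinite_integral_continuous_1)
         (use set_borel_integral_eq_integral(1)[OF locally_integrableD[OF n]] in auto)
    then have cN: "isCont N x"
      by (rule continuous_on_interior) auto
    have le: "norm (v y - v z) \<le> \<bar>N y - N z\<bar>" if "y \<ge> x - 1" "z \<ge> x - 1" "y \<ge> z" for y z
    proof -
      have "norm (v y - v z) \<le> (LINT t:{z..y}|lborel. ?n t)"
        using w(2)[OF that(3)] norm_set_integral_le[OF w(1) n, of z y] by auto
      also have "\<dots> = N y - N z" unfolding Ny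
        using set_integral_Icc_split[OF n that(2,3)] by simp
      finally show ?thesis by simp
    qed
    have le2: "norm (v y - v x) \<le> \<bar>N y - N x\<bar>" if "y \<ge> x - 1" for y
      using le[of y x] le[of x y] that by (cases "y \<ge> x") (auto simp: norm_minus_commute abs_minus_commute)
    have "((\<lambda>y. v y - v x) \<longlongrightarrow> 0) (at x)"
    proof (rule Lim_null_comparison)
      show "\<forall>\<^sub>F y in at x. norm (v y - v x) \<le> \<bar>N y - N x\<bar>"
        using eventually_at_in_open'[OF open_greaterThan, of x "x-1", simplified] by eventually_elim (use le2 in auto)
      have "((\<lambda>y. N y - N x) \<longlongrightarrow> 0) (at x)" using cN isCont_def LIM_zero by blast
      then show "((\<lambda>y. \<bar>N y - N x\<bar>) \<longlongrightarrow> 0) (at x)" by (rule tendsto_rabs_zero)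
    qed
    then show ?thesis unfolding isCont_def using LIM_zero_cancel by blast
  qed
  then show ?thesis by (simp add: continuous_at_imp_continuous_on)
qed

lemma locally_integrable_bilinear:
  fixes f :: "real \<Rightarrow> 'a::{banach, second_countable_topology}"
    and g :: "real \<Rightarrow> 'b::{banach, second_countable_topology}"
    and prod :: "'a \<Rightarrow> 'b \<Rightarrow> 'c::{banach, second_countable_topology}"
  assumes p: "bounded_bilinear prod" and f: "continuous_on UNIV f" and g: "locally_integrable g"
  shows "locally_integrable (\<lambda>x. prod (f x) (g x))"
  unfolding locally_integrable_def
proof (intro allI)
  fix a b :: real
  obtain K where K: "K > 0" "\<And>x y. norm (prod x y) \<le> norm x * norm y * K"
    using bounded_bilinear.pos_bounded[OF p] by blast
  have "compact (f ` {a..b})"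
    by (intro compact_continuous_image continuous_on_subset[OF f]) auto
  then obtain B where B: "B > 0" "\<And>x. x \<in> {a..b} \<Longrightarrow> norm (f x) \<le> B"
    using compact_imp_bounded bounded_pos by (metis imageI)
  have [measurable]: "f \<in> borel_measurable borel" using f by (rule borel_measurable_continuous_onI)
  have [measurable]: "g \<in> borel_measurable borel" using locally_integrable_measurable[OF g] by simp
  have m: "(\<lambda>x. prod (f x) (g x)) \<in> borel_measurable lborel"
    using borel_measurable_continuous_Pair[of f borel g prod]
      bounded_bilinear.continuous_on[OF p continuous_on_fst[OF continuous_on_id] continuous_on_snd[OF continuous_on_id]]
    by auto
  show "set_integrable lborel {a..b} (\<lambda>x. prod (f x) (g x))"
  proof (rule set_integrable_bound)
    show "set_integrable lborel {a..b} (\<lambda>x. (B * K) *\<^sub>R norm (g x))"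
      using locally_integrableD[OF locally_integrable_norm[OF g]] by (intro set_integrable_scaleR_right)
    show "set_borel_measurable lborel {a..b} (\<lambda>x. prod (f x) (g x))"
      unfolding set_borel_measurable_def using m by auto
    show "AE x in lborel. x \<in> {a..b} \<longrightarrow> norm (prod (f x) (g x)) \<le> norm ((B * K) *\<^sub>R norm (g x))"
    proof (intro AE_I2 impI)
      fix x assume "x \<in> {a..b}"
      then have "norm (f x) * norm (g x) * K \<le> B * norm (g x) * K"
        using B K by (intro mult_right_mono) auto
      then show "norm (prod (f x) (g x)) \<le> norm ((B * K) *\<^sub>R norm (g x))"
        using order_trans[OF K(2)[of "f x" "g x"]] B K by (auto simp: abs_mult algebra_simps)
    qed
  qed
qed

lemma set_integral_linear:
  assumes "bounded_linear T" "locally_integrable f"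
  shows "(LINT t:{a..b}|lborel. T (f t)) = T (LINT t:{a..b}|lborel. f t)"
  using integral_bounded_linear[OF assms(1) locally_integrableD[OF assms(2), of a b, unfolded set_integrable_def]]
  unfolding set_lebesgue_integral_def by (simp add: linear_simps[OF assms(1)])

text \<open>On a short interval \<open>g\<close> is frozen at the right end and \<open>f\<close> at
  the left end. With frozen factors the increment of the product is exactly the integral; continuity
  of \<open>f\<close> and \<open>g\<close> makes the cost of unfreezing small relative to the
  integral of \<open>norm (f' t) + norm (g' t)\<close>.\<close>

lemma primitive_bilinear:
  fixes f :: "real \<Rightarrow> 'a::{banach, second_countable_topology}"
    and g :: "real \<Rightarrow> 'b::{banach, second_countable_topology}"
    and prod :: "'a \<Rightarrow> 'b \<Rightarrow> 'c::{banach, second_countable_topology}"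
  assumes p: "bounded_bilinear prod" and f: "primitive f f'" and g: "primitive g g'"
  shows "primitive (\<lambda>x. prod (f x) (g x)) (\<lambda>x. prod (f' x) (g x) + prod (f x) (g' x))"
proof (rule primitiveI_local)
  note pf = primitiveD[OF f] and pg = primitiveD[OF g]
  note cf = primitive_continuous[OF f] and cg = primitive_continuous[OF g]
  have p': "bounded_bilinear (\<lambda>y x. prod x y)" using p by (rule bounded_bilinear.flip)
  note l1 = locally_integrable_bilinear[OF p' cg pf(1)] and l2 = locally_integrable_bilinear[OF p cf pg(1)]
  show l: "locally_integrable (\<lambda>x. prod (f' x) (g x) + prod (f x) (g' x))"
    by (rule locally_integrable_add[OF l1 l2])
  note n = locally_integrable_add[OF locally_integrable_norm[OF pf(1)] locally_integrable_norm[OF pg(1)]]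
  show "locally_integrable (\<lambda>x. norm (f' x) + norm (g' x))" by (rule n)
  fix e x :: real assume e: "e > 0"
  obtain K where K: "K > 0" "\<And>x y. norm (prod x y) \<le> norm x * norm y * K"
    using bounded_bilinear.pos_bounded[OF p] by blast
  \<comment> \<open>Comparison through \<open>x\<close> bounds oscillations on the interval by
    \<open>2 * e'\<close>, and \<open>2 * e' * K = e\<close>.\<close>
  define e' where "e' = e / (2 * K)"
  have e': "e' > 0" using e K by (auto simp: e'_def)
  have "isCont f x" "isCont g x" using cf cg by (auto simp: continuous_on_eq_continuous_at)
  then obtain d1 d2 where d1: "d1 > 0" "\<And>t. dist t x < d1 \<Longrightarrow> dist (f t) (f x) < e'"
    and d2: "d2 > 0" "\<And>t. dist t x < d2 \<Longrightarrow> dist (g t) (g x) < e'"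
    using e' unfolding continuous_at_eps_delta by metis
  show "\<exists>d>0. \<forall>y z. y \<le> x \<and> x \<le> z \<and> z - y < d \<longrightarrow>
      norm (prod (f z) (g z) - prod (f y) (g y) - (LINT t:{y..z}|lborel. prod (f' t) (g t) + prod (f t) (g' t)))
        \<le> e * (LINT t:{y..z}|lborel. norm (f' t) + norm (g' t))"
  proof (intro exI[of _ "min d1 d2"] conjI allI impI)
    show "min d1 d2 > 0" using d1 d2 by auto
    fix y z assume yz: "y \<le> x \<and> x \<le> z \<and> z - y < min d1 d2"
    have lz: "bounded_linear (\<lambda>v. prod v (g z))" and ly: "bounded_linear (\<lambda>v. prod (f y) v)"
      using p by (auto intro: bounded_bilinear.bounded_linear_left bounded_bilinear.bounded_linear_right)
    have i1: "locally_integrable (\<lambda>t. prod (f' t) (g z))" "locally_integrable (\<lambda>t. prod (f y) (g' t))"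
      using locally_integrable_bounded_linear[OF lz pf(1)] locally_integrable_bounded_linear[OF ly pg(1)] .
    have "prod (f z) (g z) - prod (f y) (g y) = prod (f z - f y) (g z) + prod (f y) (g z - g y)"
      using p by (simp add: bounded_bilinear.diff_left bounded_bilinear.diff_right)
    also have "\<dots> = (LINT t:{y..z}|lborel. prod (f' t) (g z) + prod (f y) (g' t))"
      using pf(2)[of y z] pg(2)[of y z] yz set_integral_linear[OF lz pf(1), of y z] set_integral_linear[OF ly pg(1), of y z]
        set_integral_add(2)[OF locally_integrableD[OF i1(1)] locally_integrableD[OF i1(2)]] by simp
    finally have "prod (f z) (g z) - prod (f y) (g y) - (LINT t:{y..z}|lborel. prod (f' t) (g t) + prod (f t) (g' t))
       = (LINT t:{y..z}|lborel. (prod (f' t) (g z) + prod (f y) (g' t)) - (prod (f' t) (g t) + prod (f t) (g' t)))"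
      using set_integral_diff(2)[OF locally_integrableD[OF locally_integrable_add[OF i1]] locally_integrableD[OF l]] by simp
    also have "norm \<dots> \<le> (LINT t:{y..z}|lborel. e * (norm (f' t) + norm (g' t)))"
    proof (rule norm_set_integral_le)
      show "locally_integrable (\<lambda>t. (prod (f' t) (g z) + prod (f y) (g' t)) - (prod (f' t) (g t) + prod (f t) (g' t)))"
        by (intro locally_integrable_diff locally_integrable_add i1 l1 l2)
      show "locally_integrable (\<lambda>t. e * (norm (f' t) + norm (g' t)))"
        using n unfolding locally_integrable_def by auto
      fix t assume t: "t \<in> {y..z}"
      have "dist t x < min d1 d2" "dist z x < min d1 d2" "dist y x < min d1 d2" using t yz by (auto simp: dist_real_def)
      then have "dist (g t) (g x) < e'" "dist (g z) (g x) < e'" "dist (f t) (f x) < e'" "dist (f y) (f x) < e'"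
        using d1 d2 by auto
      then have a: "norm (g z - g t) \<le> 2 * e'" "norm (f y - f t) \<le> 2 * e'"
        using dist_triangle2[of "g z" "g t" "g x"] dist_triangle2[of "f y" "f t" "f x"] by (auto simp: dist_norm)
      have "(prod (f' t) (g z) + prod (f y) (g' t)) - (prod (f' t) (g t) + prod (f t) (g' t))
         = prod (f' t) (g z - g t) + prod (f y - f t) (g' t)"
        using p by (simp add: bounded_bilinear.diff_left bounded_bilinear.diff_right)
      also have "norm \<dots> \<le> norm (f' t) * norm (g z - g t) * K + norm (f y - f t) * norm (g' t) * K"
        by (intro norm_triangle_mono K)
      also have "\<dots> \<le> norm (f' t) * (2 * e') * K + (2 * e') * norm (g' t) * K"
        using a K by (intro add_mono mult_right_mono mult_left_mono) auto
      also have "\<dots> = e * (norm (f' t) + norm (g' t))" using K by (simp add: e'_def field_simps)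
      finally show "norm ((prod (f' t) (g z) + prod (f y) (g' t)) - (prod (f' t) (g t) + prod (f t) (g' t)))
         \<le> e * (norm (f' t) + norm (g' t))" .
    qed
    finally show "norm (prod (f z) (g z) - prod (f y) (g y) - (LINT t:{y..z}|lborel. prod (f' t) (g t) + prod (f t) (g' t)))
        \<le> e * (LINT t:{y..z}|lborel. norm (f' t) + norm (g' t))" by simp
  qed
qed

lemma locally_integrable_mult_continuous:
  fixes f g :: "real \<Rightarrow> real"
  assumes "continuous_on UNIV f" "locally_integrable g"
  shows "locally_integrable (\<lambda>x. f x * g x)"
  by (rule locally_integrable_bilinear[OF bounded_bilinear_mult assms])

text \<open>The mean value theorem writes the increment of \<open>\<Phi> (h x)\<close> as
  \<open>\<phi> \<xi>\<close> times the increment of \<open>h\<close>, and near \<open>x\<close> the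
  number \<open>\<phi> \<xi>\<close> is close to \<open>\<phi> (h t)\<close> for all
  \<open>t\<close> of the interval at once.\<close>

lemma primitive_chain:
  fixes h h' \<phi> \<Phi> :: "real \<Rightarrow> real"
  assumes h: "primitive h h'" and \<Phi>: "\<And>x. DERIV \<Phi> x :> \<phi> x" and \<phi>: "continuous_on UNIV \<phi>"
  shows "primitive (\<lambda>x. \<Phi> (h x)) (\<lambda>x. \<phi> (h x) * h' x)"
proof (rule primitiveI_local)
  note ph = primitiveD[OF h] and ch = primitive_continuous[OF h]
  have c: "continuous_on UNIV (\<lambda>x. \<phi> (h x))" using continuous_on_compose2[OF \<phi> ch] by simp
  show l: "locally_integrable (\<lambda>x. \<phi> (h x) * h' x)"
    by (rule locally_integrable_mult_continuous[OF c ph(1)])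
  show n: "locally_integrable (\<lambda>x. norm (h' x))" by (rule locally_integrable_norm[OF ph(1)])
  fix e x :: real assume e: "e > 0"
  have "isCont \<phi> (h x)" "isCont h x" using \<phi> ch by (auto simp: continuous_on_eq_continuous_at)
  then obtain r where r: "r > 0" "\<And>s. dist s (h x) < r \<Longrightarrow> dist (\<phi> s) (\<phi> (h x)) < e/2"
    using e unfolding continuous_at_eps_delta by (metis half_gt_zero)
  from \<open>isCont h x\<close> r(1) obtain d where d: "d > 0" "\<And>t. dist t x < d \<Longrightarrow> dist (h t) (h x) < r"
    unfolding continuous_at_eps_delta by metis
  show "\<exists>d>0. \<forall>y z. y \<le> x \<and> x \<le> z \<and> z - y < d \<longrightarrow>
      norm (\<Phi> (h z) - \<Phi> (h y) - (LINT t:{y..z}|lborel. \<phi> (h t) * h' t))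
        \<le> e * (LINT t:{y..z}|lborel. norm (h' t))"
  proof (intro exI[of _ d] conjI allI impI)
    show "d > 0" by fact
    fix y z assume yz: "y \<le> x \<and> x \<le> z \<and> z - y < d"
    have hb: "\<bar>h t - h x\<bar> < r" if "t \<in> {y..z}" for t
      using d(2)[of t] that yz by (auto simp: dist_real_def)
    have "\<exists>\<xi>. \<bar>\<xi> - h x\<bar> < r \<and> \<Phi> (h z) - \<Phi> (h y) = \<phi> \<xi> * (h z - h y)"
    proof (cases "h y" "h z" rule: linorder_cases)
      case less
      from MVT2[OF less \<Phi>] obtain \<xi> where "h y < \<xi>" "\<xi> < h z" "\<Phi> (h z) - \<Phi> (h y) = (h z - h y) * \<phi> \<xi>" by blast
      then show ?thesis using hb[of y] hb[of z] yz by (intro exI[of _ \<xi>]) (auto simp: algebra_simps)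
    next
      case equal then show ?thesis using r by (intro exI[of _ "h x"]) auto
    next
      case greater
      from MVT2[OF greater \<Phi>] obtain \<xi> where "h z < \<xi>" "\<xi> < h y" "\<Phi> (h y) - \<Phi> (h z) = (h y - h z) * \<phi> \<xi>" by blast
      then show ?thesis using hb[of y] hb[of z] yz by (intro exI[of _ \<xi>]) (auto simp: algebra_simps)
    qed
    then obtain \<xi> where \<xi>: "\<bar>\<xi> - h x\<bar> < r" "\<Phi> (h z) - \<Phi> (h y) = \<phi> \<xi> * (h z - h y)" by blast
    have c\<xi>: "locally_integrable (\<lambda>t. \<phi> \<xi> * h' t)" using ph(1) unfolding locally_integrable_def by auto
    have "\<Phi> (h z) - \<Phi> (h y) - (LINT t:{y..z}|lborel. \<phi> (h t) * h' t) = (LINT t:{y..z}|lborel. \<phi> \<xi> * h' t - \<phi> (h t) * h' t)"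
      using \<xi>(2) ph(2)[of y z] yz set_integral_diff(2)[OF locally_integrableD[OF c\<xi>] locally_integrableD[OF l]] by simp
    also have "norm \<dots> \<le> (LINT t:{y..z}|lborel. e * norm (h' t))"
    proof (rule norm_set_integral_le)
      show "locally_integrable (\<lambda>t. \<phi> \<xi> * h' t - \<phi> (h t) * h' t)" by (intro locally_integrable_diff c\<xi> l)
      show "locally_integrable (\<lambda>t. e * norm (h' t))" using n unfolding locally_integrable_def by auto
      fix t assume "t \<in> {y..z}"
      then have "\<bar>\<phi> \<xi> - \<phi> (h t)\<bar> \<le> e"
        using r(2)[of \<xi>, unfolded dist_real_def, OF \<xi>(1)] r(2)[of "h t", unfolded dist_real_def, OF hb] by linarith
      then show "norm (\<phi> \<xi> * h' t - \<phi> (h t) * h' t) \<le> e * norm (h' t)"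
        by (simp add: left_diff_distrib[symmetric] abs_mult mult_right_mono)
    qed
    finally show "norm (\<Phi> (h z) - \<Phi> (h y) - (LINT t:{y..z}|lborel. \<phi> (h t) * h' t))
        \<le> e * (LINT t:{y..z}|lborel. norm (h' t))" by simp
  qed
qed

lemma primitive_vector_derivative:
  fixes v :: "real \<Rightarrow> 'a::euclidean_space"
  assumes "\<And>x. (v has_vector_derivative v' x) (at x)" "continuous_on UNIV v'"
  shows "primitive v v'"
  unfolding primitive_def
proof (intro conjI allI impI)
  show "locally_integrable v'" using assms(2) by (rule locally_integrable_continuous)
  fix a b :: real assume "a \<le> b"
  then show "v b - v a = (LINT x:{a..b}|lborel. v' x)"
    unfolding set_lebesgue_integral_def
    by (rule integral_FTC_atLeastAtMost[symmetric])
       (use assms in \<open>auto intro: has_vector_derivative_at_within continuous_on_subset\<close>)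
qed

text \<open>Borel induction extends the vanishing of the integrals from intervals to all Borel sets,
  which forces the integrand to vanish. The truncation to a bounded interval supplies the
  integrability for complements and countable unions.\<close>

lemma AE_eq_0_if_Icc_integrals_0:
  fixes f :: "real \<Rightarrow> 'a::{banach, second_countable_topology}"
  assumes f: "locally_integrable f" and 0: "\<And>a b. a \<le> b \<Longrightarrow> (LINT x:{a..b}|lborel. f x) = 0"
  shows "AE x in lborel. f x = 0"
proof -
  have "AE x in lborel. indicator {-real n..real n} x *\<^sub>R f x = 0" for n
  proof (rule sigma_finite_measure.density_zero[OF sigma_finite_lborel])
    let ?f = "\<lambda>x. indicator {-real n..real n} x *\<^sub>R f x"
    show i: "integrable lborel ?f" using locally_integrableD[OF f] unfolding set_integrable_def .
    have I: "set_integrable lborel A ?f" if "A \<in> sets borel" for A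
      unfolding set_integrable_def by (rule integrable_mult_indicator[OF _ i]) (use that in simp)
    fix A :: "real set" assume "A \<in> sets lborel"
    then have "A \<in> sets borel" by simp
    then show "set_lebesgue_integral lborel A ?f = 0"
    proof (induct rule: borel_set_induct)
      case empty then show ?case by (simp add: set_lebesgue_integral_def)
    next
      case (interval a b)
      have e: "indicator {a..b} x *\<^sub>R ?f x = indicator {max a (-real n)..min b (real n)} x *\<^sub>R f x" for x
        by (auto simp: indicator_def)
      show ?case unfolding set_lebesgue_integral_def e
        using 0[of "max a (-real n)" "min b (real n)"]
        by (cases "max a (-real n) \<le> min b (real n)") (simp_all add: set_lebesgue_integral_def)
    next
      case (compl A)
      have "set_lebesgue_integral lborel (A \<union> -A) ?f = set_lebesgue_integral lborel A ?f + set_lebesgue_integral lborel (-A) ?f"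
        by (rule set_integral_Un) (use compl(1) in \<open>auto intro!: I\<close>)
      moreover have "set_lebesgue_integral lborel (A \<union> -A) ?f = 0"
        using 0[of "-real n" "real n"] by (simp add: set_lebesgue_integral_def)
      ultimately show ?case using compl(2) by simp
    next
      case (union F)
      have "set_lebesgue_integral lborel (\<Union>i. F i) ?f = (\<Sum>i. set_lebesgue_integral lborel (F i) ?f)"
        by (rule lebesgue_integral_countable_add)
           (use union(1,2) in \<open>auto simp: disjoint_family_on_def intro!: I\<close>)
      then show ?case using union(3) by simp
    qed
  qed
  then have "AE x in lborel. \<forall>n. indicator {-real n..real n} x *\<^sub>R f x = 0" by (simp only: AE_all_countable simp_thms)
  then show ?thesis
  proof eventually_elim
    case (elim x)
    obtain N :: nat where "\<bar>x\<bar> \<le> real N" using real_arch_simple by blast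
    then show ?case using elim[rule_format, of N] by (auto simp: indicator_def)
  qed
qed

lemma primitive_unique:
  assumes "primitive v w" "primitive v w'"
  shows "AE x in lborel. w x = w' x"
proof -
  note w = primitiveD[OF assms(1)] and w' = primitiveD[OF assms(2)]
  have "AE x in lborel. w x - w' x = 0"
  proof (rule AE_eq_0_if_Icc_integrals_0)
    show "locally_integrable (\<lambda>x. w x - w' x)" by (rule locally_integrable_diff[OF w(1) w'(1)])
    fix a b :: real assume "a \<le> b"
    then show "(LINT x:{a..b}|lborel. w x - w' x) = 0"
      using w(2) w'(2) set_integral_diff(2)[OF locally_integrableD[OF w(1)] locally_integrableD[OF w'(1)]] by simp
  qed
  then show ?thesis by eventually_elim simp
qed

section \<open>Equivalence of weak derivatives and primitives\<close>

lemma test_function_cases: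
  assumes "test_function \<phi>"
  obtains D N where "\<forall>x. DERIV \<phi> x :> D x" "continuous_on UNIV D" "deriv \<phi> = D" "N > 0"
    "\<forall>x. x \<notin> {-N..N} \<longrightarrow> \<phi> x = 0" "\<forall>x. x \<notin> {-N..N} \<longrightarrow> D x = 0" "\<phi> N = 0" "\<phi> (-N) = 0"
proof -
  from assms obtain D where D: "\<And>x. (\<phi> has_vector_derivative D x) (at x)" "continuous_on UNIV D"
    unfolding test_function_def C1_differentiable_on_def by auto
  then have D': "DERIV \<phi> x :> D x" for x by (simp add: has_real_derivative_iff_has_vector_derivative)
  from assms obtain B where B: "B > 0" "\<And>x. x \<in> closure {x. \<phi> x \<noteq> 0} \<Longrightarrow> norm x \<le> B"
    unfolding test_function_def using compact_imp_bounded bounded_pos by metis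
  have z: "\<phi> x = 0" if "\<bar>x\<bar> > B" for x
    using B(2)[of x] closure_subset[of "{x. \<phi> x \<noteq> 0}"] that by force
  have "D x = 0" if "\<bar>x\<bar> > B" for x
  proof -
    have "open {x::real. \<bar>x\<bar> > B}" by (intro open_Collect_less continuous_intros)
    then have "((\<lambda>_. 0) has_real_derivative D x) (at x)"
      by (rule has_field_derivative_transform_within_open[OF D']) (use z that in auto)
    then show ?thesis using DERIV_unique[OF _ DERIV_const] by blast
  qed
  \<comment> \<open>The function vanishes for arguments of modulus larger than \<open>B\<close>; the
    margin in \<open>B + 1\<close> makes it vanish at the two end points as well.\<close>
  then show ?thesis using B(1) z D(2) D'
    by (intro that[of D "B + 1"] D' D(2) ext DERIV_imp_deriv allI) (auto simp: abs_if split: if_splits)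
qed

text \<open>Integration by parts: the product rule is integrated over an interval at whose ends the
  test function vanishes.\<close>

lemma primitive_imp_has_weak_deriv:
  fixes v :: "real \<Rightarrow> 'a::{banach, second_countable_topology}"
  assumes "primitive v w"
  shows "has_weak_deriv v w"
  unfolding has_weak_deriv_def
proof (intro conjI allI impI)
  note w = primitiveD[OF assms]
  show "locally_integrable v" using primitive_continuous[OF assms] by (rule locally_integrable_continuous)
  show "locally_integrable w" by (rule w)
  fix \<phi> :: "real \<Rightarrow> real" assume "test_function \<phi>"
  then obtain D N where D: "\<forall>x. DERIV \<phi> x :> D x" "continuous_on UNIV D" "deriv \<phi> = D" "N > 0"
    "\<forall>x. x \<notin> {-N..N} \<longrightarrow> \<phi> x = 0" "\<forall>x. x \<notin> {-N..N} \<longrightarrow> D x = 0" "\<phi> N = 0" "\<phi> (-N) = 0"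
    by (rule test_function_cases) blast
  have p\<phi>: "primitive \<phi> D"
    by (rule primitive_vector_derivative) (use D in \<open>auto simp: has_real_derivative_iff_has_vector_derivative[symmetric]\<close>)
  have l: "locally_integrable (\<lambda>x. D x *\<^sub>R v x)" "locally_integrable (\<lambda>x. \<phi> x *\<^sub>R w x)"
    using locally_integrable_bilinear[OF bounded_bilinear_scaleR D(2) locally_integrable_continuous[OF primitive_continuous[OF assms]]]
      locally_integrable_bilinear[OF bounded_bilinear_scaleR primitive_continuous[OF p\<phi>] w(1)] .
  have "(LINT x:{-N..N}|lborel. D x *\<^sub>R v x + \<phi> x *\<^sub>R w x) = 0"
    using primitiveD(2)[OF primitive_bilinear[OF bounded_bilinear_scaleR p\<phi> assms], of "-N" N] D by simp
  moreover have "(LINT x:{-N..N}|lborel. D x *\<^sub>R v x + \<phi> x *\<^sub>R w x) =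
     (LINT x:{-N..N}|lborel. D x *\<^sub>R v x) + (LINT x:{-N..N}|lborel. \<phi> x *\<^sub>R w x)"
    by (intro set_integral_add locally_integrableD l)
  moreover have "(LINT x:{-N..N}|lborel. D x *\<^sub>R v x) = (LINT x|lborel. D x *\<^sub>R v x)"
    "(LINT x:{-N..N}|lborel. \<phi> x *\<^sub>R w x) = (LINT x|lborel. \<phi> x *\<^sub>R w x)"
    unfolding set_lebesgue_integral_def by (intro Bochner_Integration.integral_cong; use D(5,6) in \<open>auto simp: indicator_def\<close>)+
  ultimately show "(LINT x|lborel. deriv \<phi> x *\<^sub>R v x) = - (LINT x|lborel. \<phi> x *\<^sub>R w x)"
    unfolding D(3) by (simp add: eq_neg_iff_add_eq_0)
qed

text \<open>A corner of \<open>y\<close> is harmless where \<open>\<Phi>\<close> is flat. This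
  handles the break points of truncated ramps and of inserted plateaus, where \<open>y\<close>
  itself has no derivative.\<close>

lemma DERIV_compose_Lipschitz_0:
  fixes \<Phi> y :: "real \<Rightarrow> real"
  assumes "\<And>x'. \<bar>y x' - y x\<bar> \<le> \<bar>x' - x\<bar>" "DERIV \<Phi> (y x) :> 0"
  shows "DERIV (\<lambda>x. \<Phi> (y x)) x :> 0"
proof -
  have *: "\<exists>d>0. \<forall>x'. \<bar>x' - x\<bar> < d \<longrightarrow> \<bar>\<Phi> (y x') - \<Phi> (y x)\<bar> \<le> e * \<bar>x' - x\<bar>" if e: "e > 0" for e
  proof -
    from assms(2)[unfolded has_field_derivative_def has_derivative_at_alt] e
    obtain d where d: "d > 0" "\<And>s. norm (s - y x) < d \<Longrightarrow> norm (\<Phi> s - \<Phi> (y x) - 0 * (s - y x)) \<le> e * norm (s - y x)"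
      by blast
    show ?thesis
    proof (intro exI[of _ d] conjI allI impI d(1))
      fix x' assume "\<bar>x' - x\<bar> < d"
      then have "\<bar>\<Phi> (y x') - \<Phi> (y x)\<bar> \<le> e * \<bar>y x' - y x\<bar>" using d(2)[of "y x'"] assms(1)[of x'] by auto
      also have "\<dots> \<le> e * \<bar>x' - x\<bar>" using assms(1) e by (intro mult_left_mono) auto
      finally show "\<bar>\<Phi> (y x') - \<Phi> (y x)\<bar> \<le> e * \<bar>x' - x\<bar>" .
    qed
  qed
  then show ?thesis unfolding has_field_derivative_def has_derivative_at_alt by (auto intro!: bounded_linear_intros)
qed

lemma AE_lborel_continuous_eq_0:
  fixes f :: "real \<Rightarrow> real"
  assumes "AE x in lborel. f x = 0" "continuous_on UNIV f"
  shows "f x = 0"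
proof (rule ccontr)
  assume "f x \<noteq> 0"
  have "open {x. f x \<noteq> 0}" using assms(2) by (intro open_Collect_neq) auto
  then obtain d where d: "d > 0" "\<And>y. \<bar>y - x\<bar> < d \<Longrightarrow> f y \<noteq> 0"
    using \<open>f x \<noteq> 0\<close> unfolding open_dist by (auto simp: dist_real_def)
  from assms(1) have "AE y in lborel. y \<notin> {x<..<x+d}"
    by eventually_elim (use d in \<open>auto simp: abs_if\<close>)
  then have "emeasure lborel {x<..<x+d} = 0"
    using emeasure_eq_0_AE[of "\<lambda>y. y \<in> {x<..<x+d}" lborel]
    by (simp add: greaterThanLessThan_def greaterThan_def lessThan_def Int_def)
  then show False using d by simp
qed

text \<open>The function is a difference of two ramps, starting at \<open>a\<close> and at
  \<open>b\<close>, each of width \<open>e\<close>; its derivative is a bump at \<open>a\<close>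
  minus a translate of it at \<open>b\<close>.\<close>

lemma ramp_test_function:
  fixes a b e :: real
  assumes e: "0 < e" "a + e < b"
  obtains \<phi> where "test_function \<phi>"
    "deriv \<phi> = (\<lambda>x. 6 * max 0 ((x - a) / e * (1 - (x - a) / e)) / e - 6 * max 0 ((x - b) / e * (1 - (x - b) / e)) / e)"
proof -
  define y where "y x = max 0 (min 1 x)" for x :: real
  \<comment> \<open>The cubic rises from 0 to 1 with derivative 6 s (1 - s), which vanishes at both
    ends, so clamping its argument to [0, 1] keeps it continuously differentiable.\<close>
  define \<Phi> where "\<Phi> s = 3 * s^2 - 2 * s^3" for s :: real
  have d\<Phi>: "DERIV \<Phi> s :> 6 * s - 6 * s^2" for s
    unfolding \<Phi>_def by (auto intro!: derivative_eq_intros)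
  have dT: "DERIV (\<lambda>x. \<Phi> (y x)) x :> 6 * max 0 (x * (1 - x))" for x
  proof -
    consider "0 < x" "x < 1" | "x \<le> 0" | "x \<ge> 1" by linarith
    then show ?thesis
    proof cases
      case 1
      have "DERIV \<Phi> x :> 6 * max 0 (x * (1 - x))"
        using d\<Phi>[of x] 1 by (auto simp: max_def algebra_simps power2_eq_square mult_less_cancel_left1)
      then show ?thesis
        by (rule has_field_derivative_transform_within_open[of _ _ _ "{0<..<1}"]) (use 1 in \<open>auto simp: y_def\<close>)
    next
      case 2
      have "DERIV (\<lambda>x. \<Phi> (y x)) x :> 0"
      proof (rule DERIV_compose_Lipschitz_0[where y = y and \<Phi> = \<Phi>])
        show "\<bar>y x' - y x\<bar> \<le> \<bar>x' - x\<bar>" for x' by (auto simp: y_def)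
        show "DERIV \<Phi> (y x) :> 0" using d\<Phi>[of "y x"] 2 by (auto simp: y_def)
      qed
      moreover have "x * (1 - x) \<le> 0" using 2 by (intro mult_nonpos_nonneg) auto
      ultimately show ?thesis by (simp only: max_absorb1 mult_zero_right)
    next
      case 3
      have "DERIV (\<lambda>x. \<Phi> (y x)) x :> 0"
      proof (rule DERIV_compose_Lipschitz_0[where y = y and \<Phi> = \<Phi>])
        show "\<bar>y x' - y x\<bar> \<le> \<bar>x' - x\<bar>" for x' by (auto simp: y_def)
        show "DERIV \<Phi> (y x) :> 0" using d\<Phi>[of "y x"] 3 by (auto simp: y_def)
      qed
      moreover have "x * (1 - x) \<le> 0" using 3 by (intro mult_nonneg_nonpos) auto
      ultimately show ?thesis by (simp only: max_absorb1 mult_zero_right)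
    qed
  qed
  define \<phi> where "\<phi> x = \<Phi> (y ((x - a) / e)) - \<Phi> (y ((x - b) / e))" for x
  define D where "D x = 6 * max 0 ((x - a) / e * (1 - (x - a) / e)) / e - 6 * max 0 ((x - b) / e * (1 - (x - b) / e)) / e" for x
  have dc: "DERIV (\<lambda>x. \<Phi> (y ((x - c) / e))) x :> 6 * max 0 ((x - c) / e * (1 - (x - c) / e)) / e" for c x
  proof -
    have "DERIV (\<lambda>x. (x - c) / e) x :> 1 / e" using e by (auto intro!: derivative_eq_intros)
    from DERIV_chain2[OF dT this] show ?thesis by simp
  qed
  have d: "DERIV \<phi> x :> D x" for x
    unfolding \<phi>_def D_def by (intro DERIV_diff dc)
  have "continuous_on UNIV D" unfolding D_def using e by (intro continuous_intros) auto
  then have "\<phi> C1_differentiable_on UNIV"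
    unfolding C1_differentiable_on_def using d by (auto simp: has_real_derivative_iff_has_vector_derivative[symmetric])
  moreover have "compact (closure {x. \<phi> x \<noteq> 0})"
  proof -
    have "x \<in> {a..b+e}" if "\<phi> x \<noteq> 0" for x
    proof (rule ccontr)
      assume "x \<notin> {a..b+e}"
      then consider "x < a" | "x > b + e" by fastforce
      then show False
      proof cases
        case 1
        then have "(x - a) / e \<le> 0" "(x - b) / e \<le> 0" using e by (auto simp: divide_le_0_iff)
        then show ?thesis using that by (simp add: \<phi>_def y_def)
      next
        case 2
        then have "(x - a) / e \<ge> 1" "(x - b) / e \<ge> 1" using e by (auto simp: field_simps)
        then show ?thesis using that by (simp add: \<phi>_def y_def)
      qed
    qed
    then have "bounded {x. \<phi> x \<noteq> 0}" by (intro bounded_subset[OF bounded_closed_interval[of a "b + e"]]) auto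
    then show ?thesis by (simp add: compact_closure)
  qed
  ultimately have "test_function \<phi>" unfolding test_function_def by simp
  moreover have "deriv \<phi> = D" using d DERIV_imp_deriv by blast
  ultimately show ?thesis using that unfolding D_def by blast
qed

text \<open>The derivative of a smoothed indicator function of \<open>{a..b}\<close> compares averages of \<open>g\<close> near the
  two endpoints.\<close>

lemma real_weak_deriv_0_imp_const:
  fixes g :: "real \<Rightarrow> real"
  assumes c: "continuous_on UNIV g"
    and 0: "\<And>\<phi>. test_function \<phi> \<Longrightarrow> (LINT x|lborel. deriv \<phi> x * g x) = 0"
  shows "a < b \<Longrightarrow> g b \<le> g a"
proof (rule ccontr)
  assume ab: "a < b" and "\<not> g b \<le> g a"
  then have lt: "g a < g b" by simp
  define m where "m = (g a + g b) / 2"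
  have m: "g a < m" "m < g b" using lt by (auto simp: m_def)
  have "isCont g a" "isCont g b" using c by (auto simp: continuous_on_eq_continuous_at)
  then obtain da db where da: "da > 0" "\<And>x. dist x a < da \<Longrightarrow> dist (g x) (g a) < m - g a"
    and db: "db > 0" "\<And>x. dist x b < db \<Longrightarrow> dist (g x) (g b) < g b - m"
    using m unfolding continuous_at_eps_delta by (metis diff_gt_0_iff_gt)
  define e where "e = min (min da db) (b - a) / 2"
  have "e \<le> da / 2" "e \<le> db / 2" "e \<le> (b - a) / 2" "0 < e" using da db ab by (auto simp: e_def)
  note e' = this
  have e: "0 < e" "a + e < b" "e < da" "e < db" using e' da(1) db(1) ab by (auto simp: field_simps)
  obtain \<phi> where \<phi>: "test_function \<phi>"
    "deriv \<phi> = (\<lambda>x. 6 * max 0 ((x - a) / e * (1 - (x - a) / e)) / e - 6 * max 0 ((x - b) / e * (1 - (x - b) / e)) / e)"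
    by (rule ramp_test_function[OF e(1,2)])
  define \<beta> where "\<beta> c x = 6 * max 0 ((x - c) / e * (1 - (x - c) / e)) / e" for c x
  have d\<phi>: "deriv \<phi> = (\<lambda>x. \<beta> a x - \<beta> b x)" by (simp only: \<phi>(2) \<beta>_def)
  have \<beta>0: "\<beta> c x \<ge> 0" for c x using e by (auto simp: \<beta>_def)
  have \<beta>z: "\<beta> c x = 0" if "x \<notin> {c<..<c+e}" for c x
  proof -
    have "(x - c) / e \<le> 0 \<or> (x - c) / e \<ge> 1" using that e by (auto simp: field_simps)
    then have "(x - c) / e * (1 - (x - c) / e) \<le> 0"
      using mult_nonpos_nonneg[of "(x - c) / e" "1 - (x - c) / e"] mult_nonneg_nonpos[of "(x - c) / e" "1 - (x - c) / e"]
      by argo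
    then show ?thesis by (simp add: \<beta>_def max_def)
  qed
  have c\<beta>: "continuous_on UNIV (\<beta> c)" for c unfolding \<beta>_def using e by (intro continuous_intros) auto
  have i: "integrable lborel (\<lambda>x. \<beta> c x * h x)" if "continuous_on UNIV h" for c h
  proof -
    have "set_integrable lborel {c..c+e} (\<lambda>x. \<beta> c x * h x)"
      by (intro locally_integrableD locally_integrable_mult_continuous c\<beta> locally_integrable_continuous that)
    moreover have "indicator {c..c+e} x *\<^sub>R (\<beta> c x * h x) = \<beta> c x * h x" for x
      using \<beta>z[of x c] by (cases "x \<in> {c<..<c+e}") (auto simp: indicator_def)
    ultimately show ?thesis unfolding set_integrable_def by (simp only:)
  qed
  \<comment> \<open>Near \<open>b\<close> the function \<open>g\<close> lies above the midpoint
    \<open>m\<close>, near \<open>a\<close> below it, so \<open>f\<close> is nonnegative. Its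
    integral is 0, because the two bumps have equal mass and \<open>g\<close> has vanishing weak
    derivative. Hence \<open>f\<close> vanishes, which fails at the centre of the bump at
    \<open>b\<close>.\<close>
  define f where "f x = \<beta> b x * (g x - m) - \<beta> a x * (g x - m)" for x
  have cg: "continuous_on UNIV (\<lambda>x. g x - m)" by (intro continuous_intros c)
  have f0: "f x \<ge> 0" for x
  proof -
    have "\<beta> b x * (g x - m) \<ge> 0"
      using \<beta>0[of b x] \<beta>z[of x b] db(2)[of x] e
      by (cases "x \<in> {b<..<b+e}") (auto simp: dist_real_def abs_if split: if_splits)
    moreover have "\<beta> a x * (g x - m) \<le> 0"
      using \<beta>0[of a x] \<beta>z[of x a] da(2)[of x] e
      by (cases "x \<in> {a<..<a+e}") (auto simp: dist_real_def abs_if mult_nonneg_nonpos split: if_splits)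
    ultimately show ?thesis by (simp add: f_def)
  qed
  have one: "continuous_on UNIV (\<lambda>x. 1::real)" by simp
  have const: "(LINT x|lborel. \<beta> b x * 1) = (LINT x|lborel. \<beta> a x * 1)"
  proof -
    have "\<beta> b x = \<beta> a ((a - b) + 1 * x)" for x by (simp add: \<beta>_def algebra_simps)
    then show ?thesis using lborel_integral_real_affine[of 1 "\<beta> a" "a - b"] by simp
  qed
  have "(LINT x|lborel. f x) = (LINT x|lborel. \<beta> b x * g x) - (LINT x|lborel. \<beta> a x * g x)
        - m * ((LINT x|lborel. \<beta> b x * 1) - (LINT x|lborel. \<beta> a x * 1))"
    unfolding f_def using i[OF c, of a] i[OF c, of b] i[OF one, of a] i[OF one, of b]
    by (simp add: right_diff_distrib)
  also have "\<dots> = - (LINT x|lborel. deriv \<phi> x * g x)"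
    unfolding d\<phi> const using i[OF c, of a] i[OF c, of b] by (simp add: left_diff_distrib)
  also have "\<dots> = 0" using 0[OF \<phi>(1)] by simp
  finally have "(LINT x|lborel. f x) = 0" .
  moreover have "integrable lborel f" unfolding f_def by (intro Bochner_Integration.integrable_diff i cg)
  ultimately have "AE x in lborel. f x = 0" using integral_nonneg_eq_0_iff_AE[of lborel f] f0 by simp
  moreover have "continuous_on UNIV f" unfolding f_def
    by (intro continuous_intros cg continuous_on_mult c\<beta>)
  ultimately have fz: "f x = 0" for x
    by (rule AE_lborel_continuous_eq_0)
  define x where "x = b + e/2"
  have "\<beta> b x > 0" unfolding \<beta>_def x_def using e by (auto simp: field_simps)
  moreover have "\<beta> a x = 0" by (rule \<beta>z) (use e in \<open>auto simp: x_def\<close>)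
  moreover have "g x > m" using db(2)[of x] e by (auto simp: x_def dist_real_def abs_if split: if_splits)
  ultimately have "f x > 0" by (simp add: f_def)
  then show False using fz[of x] by simp
qed

text \<open>The difference of \<open>v\<close> and an explicit primitive \<open>V\<close> of
  \<open>w\<close> has weak derivative 0. If it changed by \<open>z\<close> between two points, its
  inner product with \<open>z\<close> would be a real function growing by
  \<open>z \<bullet> z\<close>, against the real-valued case; for this the one-sided inequality
  proved there suffices.\<close>

lemma has_weak_deriv_imp_primitive:
  fixes v :: "real \<Rightarrow> 'a::euclidean_space"
  assumes v: "has_weak_deriv v w" and c: "continuous_on UNIV v"
  shows "primitive v w"
proof -
  have w: "locally_integrable w" using v by (simp add: has_weak_deriv_def)
  \<comment> \<open>One of the two intervals is empty or a point, so this is the oriented integral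
    from 0 to \<open>x\<close>.\<close>
  define V where "V x = (LINT t:{0..x}|lborel. w t) - (LINT t:{x..0}|lborel. w t)" for x
  have sing: "(LINT t:{0..0::real}|lborel. w t) = 0"
    using set_integral_Icc_split[OF w, of 0 0 0] by simp
  have empty: "(LINT t:{a..b::real}|lborel. w t) = 0" if "b < a" for a b
    using that by (simp add: set_lebesgue_integral_def)
  have pV: "primitive V w"
    unfolding primitive_def
  proof (intro conjI w allI impI)
    fix a b :: real assume ab: "a \<le> b"
    consider "0 \<le> a" | "a < 0" "0 \<le> b" | "b < 0" by linarith
    then show "V b - V a = (LINT t:{a..b}|lborel. w t)"
    proof cases
      case 1
      then have "(LINT t:{0..b}|lborel. w t) = (LINT t:{0..a}|lborel. w t) + (LINT t:{a..b}|lborel. w t)"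
        using ab by (intro set_integral_Icc_split w)
      moreover have "(LINT t:{b..0}|lborel. w t) = 0" "(LINT t:{a..0}|lborel. w t) = 0"
        using 1 ab empty[of 0 a] empty[of 0 b] sing by (cases "a = 0"; cases "b = 0"; force)+
      ultimately show ?thesis unfolding V_def by simp
    next
      case 2
      then have "(LINT t:{a..b}|lborel. w t) = (LINT t:{a..0}|lborel. w t) + (LINT t:{0..b}|lborel. w t)"
        by (intro set_integral_Icc_split w) auto
      moreover have "(LINT t:{b..0}|lborel. w t) = 0" "(LINT t:{0..a}|lborel. w t) = 0"
        using 2 ab empty[of a 0] empty[of 0 b] sing by (cases "b = 0"; force)+
      ultimately show ?thesis unfolding V_def by simp
    next
      case 3
      then have "(LINT t:{a..0}|lborel. w t) = (LINT t:{a..b}|lborel. w t) + (LINT t:{b..0}|lborel. w t)"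
        using ab by (intro set_integral_Icc_split w) auto
      moreover have "(LINT t:{0..b}|lborel. w t) = 0" "(LINT t:{0..a}|lborel. w t) = 0"
        using 3 ab empty[of a 0] empty[of b 0] by auto
      ultimately show ?thesis unfolding V_def by simp
    qed
  qed
  have wV: "has_weak_deriv V w" by (rule primitive_imp_has_weak_deriv[OF pV])
  have cV: "continuous_on UNIV V" by (rule primitive_continuous[OF pV])
  have eq: "v b - V b = v a - V a" if ab: "a < b" for a b
  proof (rule ccontr)
    define z where "z = (v b - V b) - (v a - V a)"
    assume "\<not> ?thesis"
    then have z: "z \<noteq> 0" by (simp add: z_def)
    define g where "g x = (v x - V x) \<bullet> z" for x
    have cg: "continuous_on UNIV g" unfolding g_def by (intro continuous_intros c cV)
    have "g b \<le> g a"
    proof (rule real_weak_deriv_0_imp_const[OF cg _ ab])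
      fix \<phi> :: "real \<Rightarrow> real" assume t: "test_function \<phi>"
      then obtain D N where D: "\<forall>x. DERIV \<phi> x :> D x" "continuous_on UNIV D" "deriv \<phi> = D" "N > 0"
        "\<forall>x. x \<notin> {-N..N} \<longrightarrow> \<phi> x = 0" "\<forall>x. x \<notin> {-N..N} \<longrightarrow> D x = 0" "\<phi> N = 0" "\<phi> (-N) = 0"
        by (rule test_function_cases) blast
      have i: "integrable lborel (\<lambda>x. D x *\<^sub>R u x)" if "continuous_on UNIV u" for u :: "real \<Rightarrow> 'a"
      proof -
        have "indicator {-N..N} x *\<^sub>R (D x *\<^sub>R u x) = D x *\<^sub>R u x" for x
          using D(6) by (auto simp: indicator_def)
        moreover have "set_integrable lborel {-N..N} (\<lambda>x. D x *\<^sub>R u x)"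
          by (intro locally_integrableD locally_integrable_continuous continuous_intros D that)
        ultimately show ?thesis unfolding set_integrable_def by (simp only:)
      qed
      have "(LINT x|lborel. D x *\<^sub>R (v x - V x)) = 0"
        using v wV t i[OF c] i[OF cV] unfolding has_weak_deriv_def scaleR_diff_right
        by (simp add: D(3)[symmetric])
      moreover have "(LINT x|lborel. D x * g x) = (LINT x|lborel. (D x *\<^sub>R (v x - V x)) \<bullet> z)"
        unfolding g_def by simp
      moreover have "\<dots> = (LINT x|lborel. D x *\<^sub>R (v x - V x)) \<bullet> z"
        by (rule integral_inner_left) (intro i continuous_intros c cV)
      ultimately show "(LINT x|lborel. deriv \<phi> x * g x) = 0" unfolding D(3) by simp
    qed
    moreover have "g b - g a = z \<bullet> z" unfolding g_def z_def by (simp add: inner_diff_left)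
    ultimately show False using z by (metis diff_le_0_iff_le inner_gt_zero_iff linorder_not_le)
  qed
  show ?thesis unfolding primitive_def
  proof (intro conjI w allI impI)
    fix a b :: real assume ab: "a \<le> b"
    have "v b - V b = v a - V a" using ab eq[of a b] by (cases "a = b") auto
    then show "v b - v a = (LINT x:{a..b}|lborel. w x)"
      using primitiveD(2)[OF pV ab] by (simp add: algebra_simps)
  qed
qed

text \<open>Makes the arbitrary choice in \<open>weak_deriv\<close> harmless: it agrees almost
  everywhere with any integrand that can be exhibited.\<close>

lemma primitive_weak_deriv:
  fixes v :: "real \<Rightarrow> 'a::euclidean_space"
  assumes "primitive v w"
  shows "primitive v (weak_deriv v)" "AE x in lborel. weak_deriv v x = w x"
proof -
  have "has_weak_deriv v (weak_deriv v)"
    unfolding weak_deriv_def by (rule someI[of _ w]) (rule primitive_imp_has_weak_deriv[OF assms])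
  then show "primitive v (weak_deriv v)"
    by (rule has_weak_deriv_imp_primitive) (rule primitive_continuous[OF assms])
  then show "AE x in lborel. weak_deriv v x = w x" by (rule primitive_unique[OF _ assms])
qed

text \<open>Equality in an integral inequality gives equations almost everywhere; this turns them
  into classical differential equations, since the derivative then has a continuous version.\<close>

lemma primitive_continuous_imp_derivative:
  fixes v :: "real \<Rightarrow> 'a::euclidean_space"
  assumes p: "primitive v w" and ae: "AE x in lborel. x \<in> {a<..<b} \<longrightarrow> w x = w' x"
    and c: "continuous_on {a<..<b} w'" and x: "x \<in> {a<..<b}"
  shows "(v has_vector_derivative w' x) (at x)"
proof -
  obtain p q where pq: "a < p" "p < x" "x < q" "q < b" using x dense by (metis greaterThanLessThan_iff)
  have cs: "continuous_on {p..q} w'" by (rule continuous_on_subset[OF c]) (use pq in auto)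
  have eq: "v y = v p + integral {p..y} w'" if y: "y \<in> {p..q}" for y
  proof -
    have "v y - v p = (LINT t:{p..y}|lborel. w t)" using primitiveD(2)[OF assms(1), of p y] y by auto
    also have "\<dots> = (LINT t:{p..y}|lborel. w' t)"
      unfolding set_lebesgue_integral_def
    proof (rule integral_cong_AE)
      show "AE t in lborel. indicat_real {p..y} t *\<^sub>R w t = indicat_real {p..y} t *\<^sub>R w' t"
        using ae by eventually_elim (use y pq in \<open>auto simp: indicator_def\<close>)
      show "(\<lambda>t. indicat_real {p..y} t *\<^sub>R w t) \<in> borel_measurable lborel"
        using locally_integrableD[OF primitiveD(1)[OF assms(1)]] unfolding set_integrable_def by auto
      show "(\<lambda>t. indicat_real {p..y} t *\<^sub>R w' t) \<in> borel_measurable lborel"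
        using borel_integrable_atLeastAtMost'[OF continuous_on_subset[OF cs, of "{p..y}"]] y
        unfolding set_integrable_def by auto
    qed
    also have "\<dots> = integral {p..y} w'"
      by (intro set_borel_integral_eq_integral(2) borel_integrable_atLeastAtMost' continuous_on_subset[OF cs]) (use y in auto)
    finally show ?thesis by (simp add: algebra_simps)
  qed
  have "((\<lambda>y. v p + integral {p..y} w') has_vector_derivative w' x) (at x within {p..q})"
    using has_vector_derivative_add[OF has_vector_derivative_const integral_has_vector_derivative[OF cs, of x]] pq by auto
  then have "((\<lambda>y. v p + integral {p..y} w') has_vector_derivative w' x) (at x)"
    using at_within_Icc_at[of p x q] pq by simp
  then show ?thesis
    by (rule has_vector_derivative_transform_within_open[of _ _ _ "{p<..<q}"]) (use pq in \<open>auto intro!: eq[symmetric]\<close>)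
qed

subsection \<open>Energy and momentum of the solitons\<close>

text \<open>For \<open>k\<close> = - kappa, \<open>a\<close> = 1 + k c^2 and w^2 = 2 - c^2 - 2 eta,
  the radicand equals 1 + 2 k (1 - eta), the denominator that occurs in
  \<open>G_fun\<close>.\<close>

definition rt :: "real \<Rightarrow> real \<Rightarrow> real \<Rightarrow> real" where
  "rt k a w = sqrt (a + k * w\<^sup>2)"

text \<open>The antiderivative of \<open>1 / rt k a w\<close> that vanishes at 0. The case
  \<open>k = 0\<close> is its limit, since the general formula would divide by 0 there.\<close>

definition lam :: "real \<Rightarrow> real \<Rightarrow> real \<Rightarrow> real" where
  "lam k a w = (if k = 0 then w / sqrt a else artanh (sqrt k * w / rt k a w) / sqrt k)"

lemma rt_pos: "a > 0 \<Longrightarrow> k \<ge> 0 \<Longrightarrow> rt k a w > 0"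
  unfolding rt_def by (auto intro!: add_pos_nonneg)

lemma rt_sq: "a > 0 \<Longrightarrow> k \<ge> 0 \<Longrightarrow> (rt k a w)\<^sup>2 = a + k * w\<^sup>2"
  unfolding rt_def by (auto intro!: add_nonneg_nonneg)

lemma rt_minus [simp]: "rt k a (- w) = rt k a w"
  by (simp add: rt_def)

lemma DERIV_rt:
  assumes "a > 0" "k \<ge> 0"
  shows "DERIV (rt k a) w :> k * w / rt k a w"
proof -
  have "a + k * w\<^sup>2 > 0" using assms by (intro add_pos_nonneg) auto
  then show ?thesis unfolding rt_def[abs_def]
    by (auto intro!: derivative_eq_intros simp: field_simps)
qed

lemma DERIV_div_rt:
  assumes "a > 0" "k \<ge> 0"
  shows "DERIV (\<lambda>w. w / rt k a w) w :> a / (rt k a w)^3"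
proof -
  let ?s = "rt k a w"
  have s: "?s > 0" and s2: "?s\<^sup>2 = a + k * w\<^sup>2" using rt_pos[OF assms] rt_sq[OF assms] by auto
  have "DERIV (\<lambda>w. w / rt k a w) w :> (1 * ?s - w * (k * w / ?s)) / (?s * ?s)"
    using s by (intro DERIV_quotient[OF DERIV_ident DERIV_rt[OF assms], unfolded power2_eq_square]
        DERIV_divide DERIV_ident DERIV_rt[OF assms]) auto
  moreover have "(1 * ?s - w * (k * w / ?s)) / (?s * ?s) = (?s\<^sup>2 - k * w\<^sup>2) / ?s^3"
    using s by (simp add: field_simps power2_eq_square power3_eq_cube)
  ultimately show ?thesis using s2 by simp
qed

lemma abs_less_rt:
  assumes "a > 0" "k \<ge> 0"
  shows "\<bar>sqrt k * w / rt k a w\<bar> < 1"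
proof -
  have "(sqrt k * w)\<^sup>2 < (rt k a w)\<^sup>2" using assms rt_sq[OF assms, of w] by (simp add: power_mult_distrib)
  then have "\<bar>sqrt k * w\<bar> < rt k a w" using rt_pos[OF assms, of w] power2_less_imp_less[of "\<bar>sqrt k * w\<bar>" "rt k a w"] by simp
  then show ?thesis using rt_pos[OF assms, of w] by (simp add: abs_divide abs_mult)
qed

lemma DERIV_lam:
  assumes "a > 0" "k \<ge> 0"
  shows "DERIV (lam k a) w :> 1 / rt k a w"
proof (cases "k = 0")
  case True
  then show ?thesis unfolding lam_def[abs_def] rt_def using DERIV_cdivide[OF DERIV_ident, of "sqrt a"] by simp
next
  case False
  let ?s = "rt k a w" and ?x = "sqrt k * (w / rt k a w)"
  have k: "k > 0" using False assms by auto
  have s: "?s > 0" and s2: "?s\<^sup>2 = a + k * w\<^sup>2" using rt_pos[OF assms] rt_sq[OF assms] by auto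
  have x1: "\<bar>?x\<bar> < 1" using abs_less_rt[OF assms, of w] by simp
  have d1: "DERIV (\<lambda>w. sqrt k * (w / rt k a w)) w :> sqrt k * (a / ?s^3)"
    by (rule DERIV_cmult[OF DERIV_div_rt[OF assms]])
  have "DERIV (\<lambda>w. artanh (sqrt k * (w / rt k a w)) / sqrt k) w
      :> (1 / (1 - ?x\<^sup>2)) * (sqrt k * (a / ?s^3)) / sqrt k"
    using x1 by (intro DERIV_cdivide DERIV_chain2[OF artanh_real_has_field_derivative d1]) auto
  moreover have "1 - ?x\<^sup>2 = (?s\<^sup>2 - k * w\<^sup>2) / ?s\<^sup>2"
    using s k by (simp add: power_mult_distrib power_divide diff_divide_distrib)
  then have e: "1 - ?x\<^sup>2 = a / ?s\<^sup>2" using s2 by simp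
  have "(1 / (1 - ?x\<^sup>2)) * (sqrt k * (a / ?s^3)) / sqrt k = 1 / ?s"
    unfolding e using s k assms(1) by (simp add: field_simps power2_eq_square power3_eq_cube)
  ultimately show ?thesis using False unfolding lam_def[abs_def] by simp
qed

lemma lam_minus:
  assumes "a > 0" "k \<ge> 0"
  shows "lam k a (- w) = - lam k a w"
  using abs_less_rt[OF assms, of w] by (auto simp: lam_def)

text \<open>With \<open>w\<^sup>2 = 2 - c\<^sup>2 - 2 \<eta>\<close>, these are the energy and momentum densities of a soliton,
  integrated against \<open>dw\<close>.\<close>

definition en_prim :: "real \<Rightarrow> real \<Rightarrow> real \<Rightarrow> real" where
  "en_prim k c w = (let a = 1 + k * c\<^sup>2; j = (w * rt k a w + a * lam k a w) / 2 in
     if k = 0 then ((2 - c\<^sup>2) * w - w^3 / 3) / 4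
     else ((2 - c\<^sup>2) * j - (w * rt k a w ^ 3 - a * j) / (4 * k)) / 4)"

definition mom_prim :: "real \<Rightarrow> real \<Rightarrow> real \<Rightarrow> real" where
  "mom_prim k c w = (let a = 1 + k * c\<^sup>2 in
     arctan (w / (c * rt k a w)) / 2 + c / 8 * (4 * k - a) * lam k a w - c / 8 * (w * rt k a w))"

lemma DERIV_mult_rt:
  assumes "a > 0" "k \<ge> 0"
  shows "DERIV (\<lambda>w. w * rt k a w) w :> (a + 2 * k * w\<^sup>2) / rt k a w"
proof -
  have s: "rt k a w > 0" and s2: "(rt k a w)\<^sup>2 = a + k * w\<^sup>2" using rt_pos[OF assms] rt_sq[OF assms] by auto
  have "DERIV (\<lambda>w. w * rt k a w) w :> 1 * rt k a w + (k * w / rt k a w) * w"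
    by (rule DERIV_mult[OF DERIV_ident DERIV_rt[OF assms]])
  moreover have "1 * rt k a w + (k * w / rt k a w) * w = ((rt k a w)\<^sup>2 + k * w\<^sup>2) / rt k a w"
    using s by (simp add: field_simps power2_eq_square)
  ultimately show ?thesis using s2 by (simp add: algebra_simps)
qed

lemma DERIV_en_prim:
  assumes "k \<ge> 0"
  shows "DERIV (en_prim k c) w :> (2 - c\<^sup>2 - w\<^sup>2) * rt k (1 + k * c\<^sup>2) w / 4"
proof (cases "k = 0")
  case True
  then show ?thesis unfolding en_prim_def[abs_def] Let_def
    by (auto intro!: derivative_eq_intros simp: rt_def power2_eq_square field_simps)
next
  case False
  define a where "a = 1 + k * c\<^sup>2"
  have a: "a > 0" unfolding a_def using assms by (intro add_pos_nonneg) auto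
  have k: "k > 0" using False assms by simp
  let ?s = "rt k a w"
  have s: "?s > 0" and s2: "?s\<^sup>2 = a + k * w\<^sup>2" using rt_pos[OF a assms] rt_sq[OF a assms] by auto
  define j where "j w = (w * rt k a w + a * lam k a w) / 2" for w
  have "DERIV j w :> ((a + 2 * k * w\<^sup>2) / ?s + a * (1 / ?s)) / 2"
    unfolding j_def by (intro DERIV_cdivide DERIV_add DERIV_mult_rt DERIV_cmult DERIV_lam a assms)
  moreover have "((a + 2 * k * w\<^sup>2) / ?s + a * (1 / ?s)) / 2 = ?s\<^sup>2 / ?s"
    unfolding s2 using s by (simp add: field_simps)
  ultimately have dj: "DERIV j w :> ?s" using s by (simp add: power2_eq_square)
  have d3: "DERIV (\<lambda>w. w * rt k a w ^ 3) w :> 1 * ?s ^ 3 + (real 3 * (k * w / ?s * ?s ^ (3 - Suc 0))) * w"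
    by (rule DERIV_mult[OF DERIV_ident DERIV_power[OF DERIV_rt[OF a assms]]])
  have e3: "1 * ?s ^ 3 + (real 3 * (k * w / ?s * ?s ^ (3 - Suc 0))) * w = ?s * (a + 4 * k * w\<^sup>2)"
  proof -
    have "1 * ?s ^ 3 + (real 3 * (k * w / ?s * ?s ^ (3 - Suc 0))) * w = ?s * (?s\<^sup>2 + 3 * k * w\<^sup>2)"
      using s by (simp add: field_simps power2_eq_square power3_eq_cube)
    then show ?thesis unfolding s2 by simp
  qed
  have "DERIV (\<lambda>w. ((2 - c\<^sup>2) * j w - (w * rt k a w ^ 3 - a * j w) / (4 * k)) / 4) w
      :> ((2 - c\<^sup>2) * ?s - (?s * (a + 4 * k * w\<^sup>2) - a * ?s) / (4 * k)) / 4"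
    by (intro DERIV_cdivide DERIV_diff DERIV_cmult dj d3[unfolded e3])
  moreover have "((2 - c\<^sup>2) * ?s - (?s * (a + 4 * k * w\<^sup>2) - a * ?s) / (4 * k)) / 4 = (2 - c\<^sup>2 - w\<^sup>2) * ?s / 4"
    using k by (simp add: field_simps)
  ultimately show ?thesis using False unfolding en_prim_def[abs_def] Let_def a_def[symmetric] j_def by simp
qed

lemma DERIV_mom_prim:
  assumes "k \<ge> 0" "c > 0"
  shows "DERIV (mom_prim k c) w :> c * (2 - c\<^sup>2 - w\<^sup>2) / (4 * (c\<^sup>2 + w\<^sup>2)) * rt k (1 + k * c\<^sup>2) w"
proof -
  define a where "a = 1 + k * c\<^sup>2"
  have a: "a > 0" unfolding a_def using assms by (intro add_pos_nonneg) auto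
  let ?s = "rt k a w"
  define z where "z = c\<^sup>2 + w\<^sup>2"
  have s: "?s > 0" and s2: "?s\<^sup>2 = a + k * w\<^sup>2" using rt_pos[OF a] rt_sq[OF a] assms by auto
  have z: "z > 0" unfolding z_def using assms by (intro add_pos_nonneg) auto
  have sz: "?s\<^sup>2 = 1 + k * z" by (subst s2) (simp add: a_def z_def algebra_simps)
  have d1: "DERIV (\<lambda>w. w / (c * rt k a w)) w :> a / ?s^3 / c"
    using DERIV_cdivide[OF DERIV_div_rt[OF a assms(1), of w], of c] by (simp add: field_simps)
  have d2: "DERIV (\<lambda>w. arctan (w / (c * rt k a w))) w :> inverse (1 + (w / (c * ?s))\<^sup>2) * (a / ?s^3 / c)"
    by (rule DERIV_chain2[OF DERIV_arctan d1])
  have e1: "1 + (w / (c * ?s))\<^sup>2 = (c\<^sup>2 * ?s\<^sup>2 + w\<^sup>2) / (c\<^sup>2 * ?s\<^sup>2)"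
    using s assms by (simp add: power_divide power_mult_distrib field_simps)
  have "c\<^sup>2 * ?s\<^sup>2 + w\<^sup>2 = c\<^sup>2 * (1 + k * z) + w\<^sup>2" by (simp only: sz)
  \<comment> \<open>This factorization reduces the derivative of the arctan term to
    \<open>c / (z * ?s)\<close>.\<close>
  also have "\<dots> = z * a" unfolding a_def z_def by (simp add: algebra_simps power2_eq_square)
  finally have e2: "c\<^sup>2 * ?s\<^sup>2 + w\<^sup>2 = z * a" .
  have e3: "inverse (1 + (w / (c * ?s))\<^sup>2) * (a / ?s^3 / c) = c / (z * ?s)"
    unfolding e1 e2 using s z a assms by (simp add: field_simps power2_eq_square power3_eq_cube)
  have "DERIV (\<lambda>w. arctan (w / (c * rt k a w)) / 2 + c / 8 * (4 * k - a) * lam k a w - c / 8 * (w * rt k a w)) w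
    :> c / (z * ?s) / 2 + c / 8 * (4 * k - a) * (1 / ?s) - c / 8 * ((a + 2 * k * w\<^sup>2) / ?s)"
    by (intro DERIV_diff DERIV_add DERIV_cdivide DERIV_cmult DERIV_lam DERIV_mult_rt a assms(1) d2[unfolded e3])
  moreover have "c / (z * ?s) / 2 + c / 8 * (4 * k - a) * (1 / ?s) - c / 8 * ((a + 2 * k * w\<^sup>2) / ?s)
    = c * (2 - z) / (4 * z) * (?s\<^sup>2 / ?s)"
  proof -
    have "c / (z * ?s) / 2 + c / 8 * (4 * k - a) * (1 / ?s) - c / 8 * ((a + 2 * k * w\<^sup>2) / ?s)
      = c * (4 + (4 * k - a) * z - (a + 2 * k * w\<^sup>2) * z) / (8 * z * ?s)"
      using s z by (simp add: field_simps)
    also have "4 + (4 * k - a) * z - (a + 2 * k * w\<^sup>2) * z = 2 * (2 - z) * (1 + k * z)"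
      unfolding a_def z_def by (simp add: algebra_simps power2_eq_square)
    also have "c * (2 * (2 - z) * (1 + k * z)) / (8 * z * ?s) = c * (2 - z) / (4 * z) * (?s\<^sup>2 / ?s)"
      unfolding sz using s z by (simp add: field_simps)
    finally show ?thesis .
  qed
  ultimately show ?thesis
    unfolding mom_prim_def[abs_def] Let_def a_def[symmetric] using s
    by (simp add: power2_eq_square z_def algebra_simps)
qed

lemma en_prim_minus: "k \<ge> 0 \<Longrightarrow> en_prim k c (- w) = - en_prim k c w"
  unfolding en_prim_def Let_def
  by (simp add: lam_minus add_pos_nonneg field_simps)

lemma mom_prim_minus: "k \<ge> 0 \<Longrightarrow> mom_prim k c (- w) = - mom_prim k c w"
  unfolding mom_prim_def Let_def
  by (simp add: lam_minus add_pos_nonneg arctan_minus field_simps)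

section \<open>Energy, momentum and action as functions of the speed\<close>

definition sol_energy :: "real \<Rightarrow> real \<Rightarrow> real" where
  "sol_energy k c = 2 * en_prim k c (sqrt (2 - c\<^sup>2))"

text \<open>Along the soliton \<open>w\<close> runs through the interval between - sqrt(2 - c^2) and
  sqrt(2 - c^2), and the primitives are odd, hence the factor 2. At \<open>c = 0\<close> division by
  zero makes the value 0, while the limit is pi/2; continuity is therefore claimed only for positive
  speeds.\<close>

definition sol_momentum :: "real \<Rightarrow> real \<Rightarrow> real" where
  "sol_momentum k c = 2 * mom_prim k c (sqrt (2 - c\<^sup>2))"

definition sol_action :: "real \<Rightarrow> real \<Rightarrow> real" where
  "sol_action k c = sol_energy k c - c * sol_momentum k c"

text \<open>The value of \<open>lam\<close> at the end point w = sqrt(2 - c^2), where the radicand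
  of \<open>rt\<close> is 1 + 2 k for every speed; only the numerator still depends on
  \<open>c\<close>, which makes differentiation in \<open>c\<close> manageable.\<close>

definition sol_lam :: "real \<Rightarrow> real \<Rightarrow> real" where
  "sol_lam k c = (if k = 0 then sqrt (2 - c\<^sup>2)
     else artanh (sqrt k * sqrt (2 - c\<^sup>2) / sqrt (1 + 2 * k)) / sqrt k)"

lemma rt_sol: "\<bar>c\<bar> \<le> sqrt 2 \<Longrightarrow> rt k (1 + k * c\<^sup>2) (sqrt (2 - c\<^sup>2)) = sqrt (1 + 2 * k)"
proof -
  assume "\<bar>c\<bar> \<le> sqrt 2"
  then have "c\<^sup>2 \<le> 2" using real_sqrt_le_iff[of "c\<^sup>2" 2] by simp
  then show ?thesis unfolding rt_def by (simp add: algebra_simps)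
qed

lemma lam_sol: "\<bar>c\<bar> \<le> sqrt 2 \<Longrightarrow> lam k (1 + k * c\<^sup>2) (sqrt (2 - c\<^sup>2)) = sol_lam k c"
  unfolding lam_def sol_lam_def rt_sol by simp

lemma sol_lam_arg:
  assumes "k \<ge> 0" "\<bar>c\<bar> \<le> sqrt 2"
  shows "0 \<le> sqrt k * sqrt (2 - c\<^sup>2) / sqrt (1 + 2 * k)" "sqrt k * sqrt (2 - c\<^sup>2) / sqrt (1 + 2 * k) < 1"
proof -
  have c2: "c\<^sup>2 \<le> 2" using assms(2) real_sqrt_le_iff[of "c\<^sup>2" 2] by simp
  show "0 \<le> sqrt k * sqrt (2 - c\<^sup>2) / sqrt (1 + 2 * k)" using assms c2 by simp
  have "k * (2 - c\<^sup>2) < 1 + 2 * k" using assms by (simp add: algebra_simps add_pos_nonneg)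
  then have "sqrt (k * (2 - c\<^sup>2)) < sqrt (1 + 2 * k)" by simp
  then show "sqrt k * sqrt (2 - c\<^sup>2) / sqrt (1 + 2 * k) < 1" using assms by (simp add: real_sqrt_mult)
qed

lemma sol_energy_eq:
  assumes "\<bar>c\<bar> \<le> sqrt 2"
  shows "sol_energy k c = (let a = 1 + k * c\<^sup>2; b = sqrt (2 - c\<^sup>2); R = sqrt (1 + 2 * k);
     j = (b * R + a * sol_lam k c) / 2 in
     if k = 0 then ((2 - c\<^sup>2) * b - b^3 / 3) / 2
     else ((2 - c\<^sup>2) * j - (b * R^3 - a * j) / (4 * k)) / 2)"
  unfolding sol_energy_def en_prim_def Let_def rt_sol[OF assms] lam_sol[OF assms] by simp

lemma sol_momentum_eq:
  assumes "\<bar>c\<bar> \<le> sqrt 2"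
  shows "sol_momentum k c = arctan (sqrt (2 - c\<^sup>2) / (c * sqrt (1 + 2 * k)))
     + c / 4 * (4 * k - (1 + k * c\<^sup>2)) * sol_lam k c - c / 4 * (sqrt (2 - c\<^sup>2) * sqrt (1 + 2 * k))"
  unfolding sol_momentum_def mom_prim_def Let_def rt_sol[OF assms] lam_sol[OF assms] by (simp add: field_simps)

text \<open>The derivative P'(c). Differentiating the arctan and \<open>sol_lam\<close> produces
  terms with sqrt(2 - c^2) in the denominator; together they collapse to the last, regular
  summand.\<close>

definition sol_slope :: "real \<Rightarrow> real \<Rightarrow> real" where
  "sol_slope k c = (k - 1/4 - 3/4 * k * c\<^sup>2) * sol_lam k c - 3/4 * (sqrt (2 - c\<^sup>2) * sqrt (1 + 2 * k))"

lemma speed_range: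
  assumes "0 < c" "c < sqrt 2"
  shows "c\<^sup>2 < 2" "sqrt (2 - c\<^sup>2) > 0" "\<bar>c\<bar> \<le> sqrt 2"
proof -
  show "c\<^sup>2 < 2" using assms real_sqrt_less_iff[of "c\<^sup>2" 2] by simp
  then show "sqrt (2 - c\<^sup>2) > 0" by simp
  show "\<bar>c\<bar> \<le> sqrt 2" using assms by simp
qed

lemma DERIV_b:
  assumes "0 < c" "c < sqrt 2"
  shows "DERIV (\<lambda>c. sqrt (2 - c\<^sup>2)) c :> - c / sqrt (2 - c\<^sup>2)"
  using speed_range[OF assms] by (auto intro!: derivative_eq_intros simp: field_simps)

lemma DERIV_sol_lam:
  assumes "k \<ge> 0" "0 < c" "c < sqrt 2"
  shows "DERIV (sol_lam k) c :> - (c * sqrt (1 + 2 * k) / ((1 + k * c\<^sup>2) * sqrt (2 - c\<^sup>2)))"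
proof (cases "k = 0")
  case True
  then show ?thesis using DERIV_b[OF assms(2,3)] unfolding sol_lam_def[abs_def] by simp
next
  case False
  define R b where "R = sqrt (1 + 2 * k)" and "b = sqrt (2 - c\<^sup>2)"
  have k: "k > 0" using False assms by simp
  have b: "b > 0" "b\<^sup>2 = 2 - c\<^sup>2" and R: "R > 0" "R\<^sup>2 = 1 + 2 * k"
    using speed_range[OF assms(2,3)] k by (auto simp: b_def R_def)
  have a: "1 + k * c\<^sup>2 > 0" using k by (intro add_pos_nonneg) auto
  let ?x = "sqrt k / R * b"
  have x: "0 \<le> ?x" "?x < 1" using sol_lam_arg[OF assms(1) speed_range(3)[OF assms(2,3)]] by (auto simp: b_def R_def)
  have d: "DERIV (\<lambda>c. sqrt k / R * sqrt (2 - c\<^sup>2)) c :> sqrt k / R * (- c / b)"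
    unfolding b_def by (rule DERIV_cmult[OF DERIV_b[OF assms(2,3)]])
  have "DERIV (\<lambda>c. artanh (sqrt k / R * sqrt (2 - c\<^sup>2)) / sqrt k) c
      :> (1 / (1 - ?x\<^sup>2)) * (sqrt k / R * (- c / b)) / sqrt k"
    using x unfolding b_def
    by (intro DERIV_cdivide DERIV_chain2[OF artanh_real_has_field_derivative d[unfolded b_def]]) auto
  moreover have "1 - ?x\<^sup>2 = (1 + k * c\<^sup>2) / R\<^sup>2"
  proof -
    have "1 - ?x\<^sup>2 = (R\<^sup>2 - k * b\<^sup>2) / R\<^sup>2" using R k by (simp add: power_mult_distrib power_divide field_simps)
    then show ?thesis unfolding b(2) by (simp add: R algebra_simps)
  qed
  note e = this
  have "(1 / (1 - ?x\<^sup>2)) * (sqrt k / R * (- c / b)) / sqrt k = - (c * R / ((1 + k * c\<^sup>2) * b))"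
    unfolding e using R(1) k a b(1) by (simp add: power2_eq_square)
  ultimately show ?thesis using False unfolding sol_lam_def[abs_def] R_def b_def by simp
qed

lemma DERIV_sol_momentum:
  assumes "k \<ge> 0" "0 < c" "c < sqrt 2"
  shows "DERIV (sol_momentum k) c :> sol_slope k c"
proof -
  define R b a L where "R = sqrt (1 + 2 * k)" and "b = sqrt (2 - c\<^sup>2)" and "a = 1 + k * c\<^sup>2" and "L = sol_lam k c"
  have b: "b > 0" "b\<^sup>2 = 2 - c\<^sup>2" and R: "R > 0" "R\<^sup>2 = 1 + 2 * k"
    using speed_range[OF assms(2,3)] assms(1) by (auto simp: b_def R_def)
  have a: "a > 0" unfolding a_def using assms by (intro add_pos_nonneg) auto
  have db: "DERIV (\<lambda>c. sqrt (2 - c\<^sup>2)) c :> - c / b" unfolding b_def by (rule DERIV_b[OF assms(2,3)])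
  have dL: "DERIV (sol_lam k) c :> - (c * R / (a * b))" unfolding R_def a_def b_def by (rule DERIV_sol_lam[OF assms])
  have dq: "DERIV (\<lambda>c. sqrt (2 - c\<^sup>2) / (c * R)) c :> ((- c / b) * (c * R) - b * R) / ((c * R) * (c * R))"
    using assms R unfolding b_def
    by (intro DERIV_divide db[unfolded b_def]) (auto intro!: derivative_eq_intros)
  have dat: "DERIV (\<lambda>c. arctan (sqrt (2 - c\<^sup>2) / (c * R))) c
      :> inverse (1 + (b / (c * R))\<^sup>2) * (((- c / b) * (c * R) - b * R) / ((c * R) * (c * R)))"
    unfolding b_def by (rule DERIV_chain2[OF DERIV_arctan dq[unfolded b_def]])
  have e1: "1 + (b / (c * R))\<^sup>2 = 2 * a / (c * R)\<^sup>2"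
  proof -
    have "1 + (b / (c * R))\<^sup>2 = ((c * R)\<^sup>2 + b\<^sup>2) / (c * R)\<^sup>2" using assms R(1) by (simp add: power_divide add_divide_distrib)
    also have "(c * R)\<^sup>2 + b\<^sup>2 = 2 * a" unfolding power_mult_distrib b R a_def by (simp add: algebra_simps)
    finally show ?thesis .
  qed
  have e2: "(- c / b) * (c * R) - b * R = - 2 * R / b"
  proof -
    have "(- c / b) * (c * R) - b * R = - (c\<^sup>2 + b\<^sup>2) * R / b" using b(1) by (simp add: field_simps power2_eq_square)
    then show ?thesis unfolding b(2) by simp
  qed
  have e3: "inverse (1 + (b / (c * R))\<^sup>2) * (((- c / b) * (c * R) - b * R) / ((c * R) * (c * R))) = - R / (a * b)"
    unfolding e1 e2 using assms(2) R(1) a b(1) by (simp add: field_simps power2_eq_square)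
  have dc: "DERIV (\<lambda>c. c / 4 * (4 * k - (1 + k * c\<^sup>2))) c :> k - a / 4 - k * c\<^sup>2 / 2"
    unfolding a_def by (auto intro!: derivative_eq_intros simp: field_simps power2_eq_square)
  have dbc: "DERIV (\<lambda>c. c / 4 * (sqrt (2 - c\<^sup>2) * R)) c :> 1 / 4 * (b * R) + (- c / b * R) * (c / 4)"
    unfolding b_def by (intro DERIV_mult DERIV_cdivide DERIV_ident DERIV_cmult_right db[unfolded b_def])
  have "DERIV (\<lambda>c. arctan (sqrt (2 - c\<^sup>2) / (c * R)) + c / 4 * (4 * k - (1 + k * c\<^sup>2)) * sol_lam k c - c / 4 * (sqrt (2 - c\<^sup>2) * R)) c
    :> - R / (a * b) + ((k - a / 4 - k * c\<^sup>2 / 2) * L + - (c * R / (a * b)) * (c / 4 * (4 * k - a))) - (1 / 4 * (b * R) + (- c / b * R) * (c / 4))"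
    unfolding L_def a_def
    by (intro DERIV_diff DERIV_add dat[unfolded e3, unfolded a_def] DERIV_mult dc[unfolded a_def] dL[unfolded a_def] dbc)
  moreover have "- R / (a * b) + ((k - a / 4 - k * c\<^sup>2 / 2) * L + - (c * R / (a * b)) * (c / 4 * (4 * k - a))) - (1 / 4 * (b * R) + (- c / b * R) * (c / 4))
     = sol_slope k c"
  proof -
    have "- R / (a * b) - (c * R / (a * b)) * (c / 4 * (4 * k - a)) - (1 / 4 * (b * R) + (- c / b * R) * (c / 4))
      = - (R / b) * ((1 + k * c\<^sup>2) / a - c\<^sup>2 / 4 + b\<^sup>2 / 4 - c\<^sup>2 / 4)"
      using a b(1) by (simp add: field_simps power2_eq_square)
    also have "(1 + k * c\<^sup>2) / a = 1" using a by (simp add: a_def)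
    also have "1 - c\<^sup>2 / 4 + b\<^sup>2 / 4 - c\<^sup>2 / 4 = 3 / 4 * b\<^sup>2"
      unfolding b(2) by (simp add: field_simps)
    also have "- (R / b) * (3 / 4 * b\<^sup>2) = - 3 / 4 * (b * R)" using b(1) by (simp add: power2_eq_square)
    finally have X: "- R / (a * b) - (c * R / (a * b)) * (c / 4 * (4 * k - a)) - (1 / 4 * (b * R) + (- c / b * R) * (c / 4)) = - 3 / 4 * (b * R)" .
    have Y: "k - a / 4 - k * c\<^sup>2 / 2 = k - 1/4 - 3/4 * k * c\<^sup>2" by (simp add: a_def field_simps)
    show ?thesis unfolding sol_slope_def L_def[symmetric] b_def[symmetric] R_def[symmetric] Y
      using X by argo
  qed
  ultimately have "DERIV (\<lambda>c. arctan (sqrt (2 - c\<^sup>2) / (c * R)) + c / 4 * (4 * k - (1 + k * c\<^sup>2)) * sol_lam k c - c / 4 * (sqrt (2 - c\<^sup>2) * R)) c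
    :> sol_slope k c" by (simp only:)
  then show ?thesis
    by (rule has_field_derivative_transform_within_open[of _ _ _ "{0<..<sqrt 2}"])
       (use assms sol_momentum_eq in \<open>auto simp: R_def\<close>)
qed

text \<open>The Hamiltonian relation dE = c dP along the branch of solitons, checked on the closed
  formulas. It is the reason why E - c P has derivative - P.\<close>

lemma DERIV_sol_energy:
  assumes "k \<ge> 0" "0 < c" "c < sqrt 2"
  shows "DERIV (sol_energy k) c :> c * sol_slope k c"
proof -
  define R b a L where "R = sqrt (1 + 2 * k)" and "b = sqrt (2 - c\<^sup>2)" and "a = 1 + k * c\<^sup>2" and "L = sol_lam k c"
  have b: "b > 0" "b\<^sup>2 = 2 - c\<^sup>2" and R: "R > 0" "R\<^sup>2 = 1 + 2 * k"
    using speed_range[OF assms(2,3)] assms(1) by (auto simp: b_def R_def)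
  have a: "a > 0" unfolding a_def using assms by (intro add_pos_nonneg) auto
  have db: "DERIV (\<lambda>c. sqrt (2 - c\<^sup>2)) c :> - c / b" unfolding b_def by (rule DERIV_b[OF assms(2,3)])
  have dL: "DERIV (sol_lam k) c :> - (c * R / (a * b))" unfolding R_def a_def b_def by (rule DERIV_sol_lam[OF assms])
  have dc: "DERIV (\<lambda>c. 2 - c\<^sup>2) c :> - (2 * c)" by (auto intro!: derivative_eq_intros)
  show ?thesis
  proof (cases "k = 0")
    case True
    have "DERIV (\<lambda>c. ((2 - c\<^sup>2) * sqrt (2 - c\<^sup>2) - sqrt (2 - c\<^sup>2)^3 / 3) / 2) c
       :> ((- (2 * c) * b + (- c / b) * (2 - c\<^sup>2)) - real 3 * (- c / b * b ^ (3 - Suc 0)) / 3) / 2"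
      unfolding b_def by (intro DERIV_cdivide DERIV_diff DERIV_mult DERIV_power dc db[unfolded b_def])
    moreover have "((- (2 * c) * b + (- c / b) * (2 - c\<^sup>2)) - real 3 * (- c / b * b ^ (3 - Suc 0)) / 3) / 2 = c * sol_slope k c"
      using b(1) True unfolding b(2)[symmetric] sol_slope_def sol_lam_def b_def[symmetric]
      by (simp add: power2_eq_square)
    ultimately have "DERIV (\<lambda>c. ((2 - c\<^sup>2) * sqrt (2 - c\<^sup>2) - sqrt (2 - c\<^sup>2)^3 / 3) / 2) c :> c * sol_slope k c" by (simp only:)
    then show ?thesis
      by (rule has_field_derivative_transform_within_open[of _ _ _ "{0<..<sqrt 2}"])
         (use assms True sol_energy_eq[of _ k] in \<open>auto simp: Let_def\<close>)
  next
    case False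
    then have k: "k > 0" using assms by simp
    define j where "j c = (sqrt (2 - c\<^sup>2) * R + (1 + k * c\<^sup>2) * sol_lam k c) / 2" for c
    have da: "DERIV (\<lambda>c. 1 + k * c\<^sup>2) c :> 2 * k * c" by (auto intro!: derivative_eq_intros)
    have "DERIV j c :> (- c / b * R + ((2 * k * c) * L + - (c * R / (a * b)) * a)) / 2"
      unfolding j_def L_def a_def
      by (intro DERIV_cdivide DERIV_add DERIV_cmult_right DERIV_mult db da dL[unfolded a_def])
    moreover have "(- c / b * R + ((2 * k * c) * L + - (c * R / (a * b)) * a)) / 2 = - c * R / b + k * c * L"
      using a b(1) by (simp add: field_simps)
    ultimately have dj: "DERIV j c :> - c * R / b + k * c * L" by (simp only:)
    have "DERIV (\<lambda>c. ((2 - c\<^sup>2) * j c - (sqrt (2 - c\<^sup>2) * R^3 - (1 + k * c\<^sup>2) * j c) / (4 * k)) / 2) c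
      :> ((- (2 * c) * j c + (- c * R / b + k * c * L) * (2 - c\<^sup>2))
          - (- c / b * R^3 - ((2 * k * c) * j c + (- c * R / b + k * c * L) * (1 + k * c\<^sup>2))) / (4 * k)) / 2"
      by (intro DERIV_cdivide DERIV_diff DERIV_mult DERIV_cmult_right dc dj db da)
    moreover have "((- (2 * c) * j c + (- c * R / b + k * c * L) * (2 - c\<^sup>2))
          - (- c / b * R^3 - ((2 * k * c) * j c + (- c * R / b + k * c * L) * (1 + k * c\<^sup>2))) / (4 * k)) / 2 = c * sol_slope k c"
    proof -
      have jc: "j c = (b * R + a * L) / 2" by (simp add: j_def b_def a_def L_def)
      have "((- (2 * c) * j c + (- c * R / b + k * c * L) * b\<^sup>2)
          - (- c / b * R^3 - ((2 * k * c) * j c + (- c * R / b + k * c * L) * a)) / (4 * k)) / 2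
        = c * ((- 3/4 * (b * R + a * L) - R * b + k * L * b\<^sup>2) + (R * (R\<^sup>2 - a) / b + k * L * a) / (4 * k)) / 2"
        unfolding jc using b(1) k by (simp add: field_simps power2_eq_square power3_eq_cube)
      also have "R\<^sup>2 - a = k * b\<^sup>2" unfolding R a_def b by (simp add: algebra_simps)
      also have "(R * (k * b\<^sup>2) / b + k * L * a) / (4 * k) = (R * b + L * a) / 4"
        using b(1) k by (simp add: field_simps power2_eq_square)
      also have "c * (- 3/4 * (b * R + a * L) - R * b + k * L * b\<^sup>2 + (R * b + L * a) / 4) / 2 = c * sol_slope k c"
        unfolding sol_slope_def L_def[symmetric] b_def[symmetric] R_def[symmetric] b(2) a_def
        by (simp add: field_simps)
      finally show ?thesis unfolding b(2) a_def .
    qed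
    ultimately have "DERIV (\<lambda>c. ((2 - c\<^sup>2) * j c - (sqrt (2 - c\<^sup>2) * R^3 - (1 + k * c\<^sup>2) * j c) / (4 * k)) / 2) c
       :> c * sol_slope k c" by (simp only:)
    then show ?thesis
      by (rule has_field_derivative_transform_within_open[of _ _ _ "{0<..<sqrt 2}"])
         (use assms False sol_energy_eq[of _ k] in \<open>auto simp: Let_def j_def R_def\<close>)
  qed
qed

lemma DERIV_sol_action:
  assumes "k \<ge> 0" "0 < c" "c < sqrt 2"
  shows "DERIV (sol_action k) c :> - sol_momentum k c"
proof -
  have "DERIV (sol_action k) c :> c * sol_slope k c - (1 * sol_momentum k c + sol_slope k c * c)"
    unfolding sol_action_def[abs_def]
    by (intro DERIV_diff DERIV_mult DERIV_ident DERIV_sol_energy DERIV_sol_momentum assms)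
  then show ?thesis by (simp add: algebra_simps)
qed

lemma continuous_on_sol_lam:
  assumes "k \<ge> 0"
  shows "continuous_on {0..sqrt 2} (sol_lam k)"
proof (cases "k = 0")
  case True
  then show ?thesis unfolding sol_lam_def[abs_def] by (auto intro!: continuous_intros)
next
  case False
  show ?thesis unfolding sol_lam_def[abs_def] if_not_P[OF False]
  proof (rule continuous_on_divide[OF continuous_on_artanh'])
    show "continuous_on {0..sqrt 2} (\<lambda>c. sqrt k * sqrt (2 - c\<^sup>2) / sqrt (1 + 2 * k))"
      using assms by (intro continuous_intros) auto
    show "sqrt k * sqrt (2 - c\<^sup>2) / sqrt (1 + 2 * k) \<in> {-1<..<1}" if "c \<in> {0..sqrt 2}" for c
      using sol_lam_arg[OF assms, of c] that by auto
  qed (use False in auto)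
qed

lemma continuous_on_sol_energy:
  assumes "k \<ge> 0"
  shows "continuous_on {0..sqrt 2} (sol_energy k)"
proof -
  have "continuous_on {0..sqrt 2} (\<lambda>c. let a = 1 + k * c\<^sup>2; b = sqrt (2 - c\<^sup>2); R = sqrt (1 + 2 * k);
     j = (b * R + a * sol_lam k c) / 2 in
     if k = 0 then ((2 - c\<^sup>2) * b - b^3 / 3) / 2
     else ((2 - c\<^sup>2) * j - (b * R^3 - a * j) / (4 * k)) / 2)"
    unfolding Let_def
    by (cases "k = 0") (auto intro!: continuous_intros continuous_on_sol_lam assms)
  then show ?thesis by (rule continuous_on_eq) (use sol_energy_eq in auto)
qed

lemma continuous_on_sol_momentum:
  assumes "k \<ge> 0"
  shows "continuous_on {0<..sqrt 2} (sol_momentum k)"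
proof -
  have R: "sqrt (1 + 2 * k) \<noteq> 0" using assms by simp
  have "continuous_on {0<..sqrt 2} (\<lambda>c. arctan (sqrt (2 - c\<^sup>2) / (c * sqrt (1 + 2 * k)))
     + c / 4 * (4 * k - (1 + k * c\<^sup>2)) * sol_lam k c - c / 4 * (sqrt (2 - c\<^sup>2) * sqrt (1 + 2 * k)))"
    by (intro continuous_intros continuous_on_subset[OF continuous_on_sol_lam[OF assms]]) (use R in auto)
  then show ?thesis by (rule continuous_on_eq) (use sol_momentum_eq in auto)
qed

lemma sol_momentum_bounded:
  assumes "k \<ge> 0"
  obtains B where "B > 0" "\<And>c. 0 \<le> c \<Longrightarrow> c \<le> sqrt 2 \<Longrightarrow> \<bar>sol_momentum k c\<bar> \<le> B"
proof -
  let ?g = "\<lambda>c. c / 4 * (4 * k - (1 + k * c\<^sup>2)) * sol_lam k c - c / 4 * (sqrt (2 - c\<^sup>2) * sqrt (1 + 2 * k))"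
  have "continuous_on {0..sqrt 2} ?g"
    by (intro continuous_intros continuous_on_sol_lam assms) auto
  then have "bounded (?g ` {0..sqrt 2})" by (intro compact_imp_bounded compact_continuous_image) auto
  then obtain B where B: "B > 0" "\<And>c. c \<in> {0..sqrt 2} \<Longrightarrow> \<bar>?g c\<bar> \<le> B"
    unfolding bounded_pos by auto
  have "\<bar>sol_momentum k c\<bar> \<le> B + pi" if "0 \<le> c" "c \<le> sqrt 2" for c
    using B(2)[of c] arctan_bounded[of "sqrt (2 - c\<^sup>2) / (c * sqrt (1 + 2 * k))"] sol_momentum_eq[of c k] that
    by auto
  then show ?thesis using B(1) pi_gt_zero by (intro that[of "B + pi"]) (auto intro: add_pos_pos)
qed

text \<open>The point at issue is \<open>c = 0\<close>, where \<open>sol_momentum\<close> jumps: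
  being bounded and multiplied by \<open>c\<close>, it still contributes 0 in the limit. This
  connects the action at small speeds with the energy of the black soliton.\<close>

lemma continuous_on_sol_action:
  assumes "k \<ge> 0"
  shows "continuous_on {0..sqrt 2} (sol_action k)"
proof -
  have "continuous_on {0..sqrt 2} (\<lambda>c. c * sol_momentum k c)"
    unfolding continuous_on_eq_continuous_within
  proof
    fix c assume c: "c \<in> {0..sqrt 2}"
    show "continuous (at c within {0..sqrt 2}) (\<lambda>c. c * sol_momentum k c)"
    proof (cases "c = 0")
      case True
      obtain B where B: "B > 0" "\<And>c. 0 \<le> c \<Longrightarrow> c \<le> sqrt 2 \<Longrightarrow> \<bar>sol_momentum k c\<bar> \<le> B"
        using sol_momentum_bounded[OF assms] by blast
      have "((\<lambda>c. c * sol_momentum k c) \<longlongrightarrow> 0) (at 0 within {0..sqrt 2})"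
      proof (rule Lim_null_comparison)
        show "\<forall>\<^sub>F c in at 0 within {0..sqrt 2}. norm (c * sol_momentum k c) \<le> \<bar>c\<bar> * B"
          unfolding eventually_at_filter
          by (rule always_eventually) (auto simp: abs_mult intro!: mult_left_mono B)
        show "((\<lambda>c. \<bar>c\<bar> * B) \<longlongrightarrow> 0) (at 0 within {0..sqrt 2})"
          by (auto intro!: tendsto_eq_intros)
      qed
      then show ?thesis unfolding continuous_within True by simp
    next
      case False
      have "continuous_on {0<..sqrt 2} (\<lambda>c. c * sol_momentum k c)"
        by (intro continuous_intros continuous_on_sol_momentum assms)
      then have "continuous (at c within {0<..sqrt 2}) (\<lambda>c. c * sol_momentum k c)"
        using False c by (auto simp: continuous_on_eq_continuous_within)
      moreover have "at c within {0..sqrt 2} = at c within {0<..sqrt 2}"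
        by (rule at_within_nhd[of c "{0<..}"]) (use False c in auto)
      ultimately show ?thesis by simp
    qed
  qed
  then show ?thesis unfolding sol_action_def[abs_def]
    by (intro continuous_on_diff continuous_on_sol_energy assms)
qed

lemma sol_sqrt2: "sol_energy k (sqrt 2) = 0" "sol_momentum k (sqrt 2) = 0" "sol_action k (sqrt 2) = 0"
  by (simp_all add: sol_action_def sol_energy_def sol_momentum_def en_prim_def mom_prim_def lam_def Let_def)

lemma sol_action_0: "sol_action k 0 = sol_energy k 0"
  by (simp add: sol_action_def)

lemma sol_momentum_pos:
  assumes "k \<ge> 0" "0 < c" "c < sqrt 2"
  shows "sol_momentum k c > 0"
proof -
  note s = speed_range[OF assms(2,3)]
  have "mom_prim k c 0 < mom_prim k c (sqrt (2 - c\<^sup>2))"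
  proof (rule DERIV_pos_imp_increasing_open[OF s(2)])
    fix w assume w: "0 < w" "w < sqrt (2 - c\<^sup>2)"
    then have "w\<^sup>2 < 2 - c\<^sup>2" using real_less_rsqrt real_sqrt_less_iff[of "w\<^sup>2" "2 - c\<^sup>2"] by simp
    then have "c * (2 - c\<^sup>2 - w\<^sup>2) / (4 * (c\<^sup>2 + w\<^sup>2)) * rt k (1 + k * c\<^sup>2) w > 0"
      using assms by (intro mult_pos_pos divide_pos_pos rt_pos add_pos_nonneg) (auto intro: add_pos_nonneg)
    then show "\<exists>y. DERIV (mom_prim k c) w :> y \<and> 0 < y" using DERIV_mom_prim[OF assms(1,2)] by blast
  next
    show "continuous_on {0..sqrt (2 - c\<^sup>2)} (mom_prim k c)"
      using DERIV_mom_prim[OF assms(1,2)] by (meson DERIV_isCont continuous_at_imp_continuous_on)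
  qed
  moreover have "mom_prim k c 0 = 0" using mom_prim_minus[OF assms(1), of c 0] by simp
  ultimately show ?thesis by (simp add: sol_momentum_def)
qed

section \<open>Shape of the momentum as a function of the speed\<close>

lemma artanh_div_mono:
  fixes x y :: real
  assumes "0 < x" "x < y" "y < 1"
  shows "artanh x / x < artanh y / y"
proof -
  have d: "DERIV artanh s :> 1 / (1 - s\<^sup>2)" if "0 \<le> s" "s \<le> y" for s
    using that assms by (intro artanh_real_has_field_derivative) auto
  have "\<exists>s. 0 < s \<and> s < x \<and> artanh x - artanh 0 = (x - 0) * (1 / (1 - s\<^sup>2))"
    by (rule MVT2) (use assms in \<open>auto intro!: d\<close>)
  then obtain s where s: "0 < s" "s < x" "artanh x = x * (1 / (1 - s\<^sup>2))" by auto
  have "\<exists>t. x < t \<and> t < y \<and> artanh y - artanh x = (y - x) * (1 / (1 - t\<^sup>2))"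
    by (rule MVT2) (use assms in \<open>auto intro!: d\<close>)
  then obtain t where t: "x < t" "t < y" "artanh y - artanh x = (y - x) * (1 / (1 - t\<^sup>2))" by auto
  \<comment> \<open>Convexity of artanh on the nonnegative side: the secant slope over the interval
    from \<open>x\<close> to \<open>y\<close> exceeds the one from 0 to \<open>x\<close>.\<close>
  have "s\<^sup>2 < t\<^sup>2" "t\<^sup>2 < 1" using s t assms by (auto intro!: power_strict_mono simp: power_less_one_iff abs_square_less_1)
  then have "1 / (1 - s\<^sup>2) < 1 / (1 - t\<^sup>2)" by (intro divide_strict_left_mono) auto
  then have "(y - x) * (1 / (1 - s\<^sup>2)) < artanh y - artanh x" unfolding t(3) using assms by (intro mult_strict_left_mono) auto
  then have "y * (1 / (1 - s\<^sup>2)) < artanh y" unfolding s(3) left_diff_distrib by linarith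
  then have "1 / (1 - s\<^sup>2) < artanh y / y" using assms by (simp add: field_simps)
  then show ?thesis using s(3) assms by simp
qed

text \<open>Up to a positive constant the ratio is artanh(t) / t at t = q sqrt(2 - c^2), which
  increases in t, while t decreases in the speed.\<close>

lemma sol_lam_ratio_antimono:
  assumes "k > 0" "0 < c1" "c1 < c2" "c2 < sqrt 2"
  shows "sol_lam k c2 / sqrt (2 - c2\<^sup>2) < sol_lam k c1 / sqrt (2 - c1\<^sup>2)"
    "sol_lam k c2 / sqrt (2 - c2\<^sup>2) > 0"
proof -
  define q where "q = sqrt k / sqrt (1 + 2 * k)"
  have q: "q > 0" using assms by (simp add: q_def)
  have b1: "sqrt (2 - c1\<^sup>2) > 0" and b2: "sqrt (2 - c2\<^sup>2) > 0"
    using speed_range[of c1] speed_range[of c2] assms by auto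
  have lt: "sqrt (2 - c2\<^sup>2) < sqrt (2 - c1\<^sup>2)" using assms by (simp add: power_strict_mono)
  have x1: "q * sqrt (2 - c1\<^sup>2) < 1" using sol_lam_arg(2)[of k c1] assms by (simp add: q_def)
  have e: "sol_lam k c / sqrt (2 - c\<^sup>2) = (artanh (q * sqrt (2 - c\<^sup>2)) / (q * sqrt (2 - c\<^sup>2))) * (q / sqrt k)" for c
    using assms q by (simp add: sol_lam_def q_def)
  have "q * sqrt (2 - c2\<^sup>2) < q * sqrt (2 - c1\<^sup>2)" using lt q by (rule mult_strict_left_mono)
  from artanh_div_mono[OF mult_pos_pos[OF q b2] this x1]
  show "sol_lam k c2 / sqrt (2 - c2\<^sup>2) < sol_lam k c1 / sqrt (2 - c1\<^sup>2)"
    unfolding e using q assms(1) by (intro mult_strict_right_mono) auto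
  have "artanh (q * sqrt (2 - c2\<^sup>2)) > 0"
  proof -
    have x2: "q * sqrt (2 - c2\<^sup>2) < 1" "0 < q * sqrt (2 - c2\<^sup>2)" using order.strict_trans[OF mult_strict_left_mono[OF lt q] x1] mult_pos_pos[OF q b2] .
    then have "1 < (1 + q * sqrt (2 - c2\<^sup>2)) / (1 - q * sqrt (2 - c2\<^sup>2))" by (subst less_divide_eq_1_pos) auto
    then show ?thesis unfolding artanh_def by simp
  qed
  then show "sol_lam k c2 / sqrt (2 - c2\<^sup>2) > 0" unfolding e using q b2 assms(1) by simp
qed

text \<open>The slope divided by \<open>sqrt (2 - c\<^sup>2)\<close> decreases as long as it is nonnegative.\<close>

lemma sol_slope_sign:
  assumes "k \<ge> 0" "0 < c1" "c1 < c2" "c2 < sqrt 2" "sol_slope k c2 \<ge> 0"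
  shows "sol_slope k c1 > 0"
proof -
  define b1 b2 where "b1 = sqrt (2 - c1\<^sup>2)" and "b2 = sqrt (2 - c2\<^sup>2)"
  define C where "C c = k - 1/4 - 3/4 * k * c\<^sup>2" for c
  define R where "R = sqrt (1 + 2 * k)"
  have b: "b1 > 0" "b2 > 0" using speed_range[of c1] speed_range[of c2] assms by (auto simp: b1_def b2_def)
  have R: "R > 0" using assms by (simp add: R_def)
  have k: "k \<noteq> 0"
  proof
    assume "k = 0"
    then have "sol_slope k c2 = - b2" by (simp add: sol_slope_def sol_lam_def b2_def)
    then show False using assms b by simp
  qed
  then have k: "k > 0" using assms by simp
  have l: "sol_lam k c2 / b2 < sol_lam k c1 / b1" "sol_lam k c2 / b2 > 0"
    unfolding b1_def b2_def by (rule sol_lam_ratio_antimono[OF k assms(2-4)])+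
  have f: "sol_slope k c1 = b1 * (C c1 * (sol_lam k c1 / b1) - 3/4 * R)"
    "sol_slope k c2 = b2 * (C c2 * (sol_lam k c2 / b2) - 3/4 * R)"
    using b by (auto simp: sol_slope_def b1_def[symmetric] b2_def[symmetric] R_def C_def field_simps)
  have "C c2 * (sol_lam k c2 / b2) - 3/4 * R \<ge> 0"
    using assms(5) b unfolding f(2) by (simp add: zero_le_mult_iff)
  then have c2: "C c2 * (sol_lam k c2 / b2) \<ge> 3/4 * R" by simp
  then have "C c2 * (sol_lam k c2 / b2) > 0" using R by linarith
  \<comment> \<open>A nonnegative slope forces the coefficient to be positive, so that both factors
    are positive and can be compared separately with their values at \<open>c1\<close>.\<close>
  then have "C c2 > 0" using l(2) by (rule zero_less_mult_pos2)
  moreover have "c1\<^sup>2 < c2\<^sup>2" using assms by (intro power_strict_mono) auto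
  then have "C c2 \<le> C c1" using k by (simp add: C_def)
  ultimately have "C c2 * (sol_lam k c2 / b2) < C c1 * (sol_lam k c1 / b1)"
    using l by (intro mult_le_less_imp_less) auto
  then have "C c1 * (sol_lam k c1 / b1) - 3/4 * R > 0" using c2 by linarith
  then show ?thesis unfolding f(1) using b by simp
qed

text \<open>The turning point is the supremum of the speeds with nonnegative slope; by the sign
  lemma every smaller speed has positive slope. Inserting 0 keeps the set nonempty: for
  \<open>k = 0\<close>, for instance, the momentum decreases on the whole range and the turning
  point is 0.\<close>

lemma sol_momentum_unimodal:
  assumes k: "k \<ge> 0"
  obtains m where "0 \<le> m" "m \<le> sqrt 2"
    "\<And>c1 c2. 0 < c1 \<Longrightarrow> c1 < c2 \<Longrightarrow> c2 \<le> m \<Longrightarrow> c2 < sqrt 2 \<Longrightarrow> sol_momentum k c1 < sol_momentum k c2"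
    "\<And>c1 c2. 0 < c1 \<Longrightarrow> m \<le> c1 \<Longrightarrow> c1 < c2 \<Longrightarrow> c2 < sqrt 2 \<Longrightarrow> sol_momentum k c2 < sol_momentum k c1"
proof -
  define T where "T = insert 0 {c. 0 < c \<and> c < sqrt 2 \<and> sol_slope k c \<ge> 0}"
  define m where "m = Sup T"
  have bdd: "bdd_above T" unfolding T_def by (intro bdd_aboveI[of _ "sqrt 2"]) auto
  have m: "0 \<le> m" "m \<le> sqrt 2" unfolding m_def
    by (rule cSup_upper[OF _ bdd], simp add: T_def) (rule cSup_least, auto simp: T_def)
  have inc: "sol_slope k c > 0" if c: "0 < c" "c < m" for c
  proof -
    have "T \<noteq> {}" by (simp add: T_def)
    then obtain c2 where "c2 \<in> T" "c < c2" using c(2) less_cSup_iff[OF _ bdd, of c] unfolding m_def by blast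
    then show ?thesis using c sol_slope_sign[OF k c(1), of c2] by (auto simp: T_def)
  qed
  have dec: "sol_slope k c < 0" if "m < c" "c < sqrt 2" for c
    using cSup_upper[OF _ bdd, of c] that m by (force simp: m_def T_def not_le)
  have cont: "continuous_on {c1..c2} (sol_momentum k)" if "0 < c1" "c2 < sqrt 2" for c1 c2
    by (rule continuous_on_subset[OF continuous_on_sol_momentum[OF k]]) (use that in auto)
  show ?thesis
  proof (rule that[OF m])
    fix c1 c2 :: real assume c: "0 < c1" "c1 < c2" "c2 \<le> m" "c2 < sqrt 2"
    show "sol_momentum k c1 < sol_momentum k c2"
    proof (rule DERIV_pos_imp_increasing_open[OF c(2) _ cont[OF c(1,4)]])
      fix x assume "c1 < x" "x < c2"
      then show "\<exists>y. DERIV (sol_momentum k) x :> y \<and> 0 < y"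
        using DERIV_sol_momentum[OF k, of x] inc[of x] c by (intro exI[of _ "sol_slope k x"]) auto
    qed
  next
    fix c1 c2 :: real assume c: "0 < c1" "m \<le> c1" "c1 < c2" "c2 < sqrt 2"
    show "sol_momentum k c2 < sol_momentum k c1"
    proof (rule DERIV_neg_imp_decreasing_open[OF c(3) _ cont[OF c(1,4)]])
      fix x assume "c1 < x" "x < c2"
      then show "\<exists>y. DERIV (sol_momentum k) x :> y \<and> y < 0"
        using DERIV_sol_momentum[OF k, of x] dec[of x] c by (intro exI[of _ "sol_slope k x"]) auto
    qed
  qed
qed

subsection \<open>The soliton profile\<close>

locale soliton_profile =
  fixes k c :: real
  assumes k0: "0 \<le> k" and c0: "0 \<le> c" and c2: "c < sqrt 2"
begin

definition b :: real where "b = sqrt (2 - c\<^sup>2)"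
definition a :: real where "a = 1 + k * c\<^sup>2"

abbreviation S :: "real \<Rightarrow> real" where "S \<equiv> rt k a"

text \<open>In the variable \<open>w = sqrt (2 - c\<^sup>2 - 2 * \<eta>)\<close>, continued to negative \<open>w\<close> as an odd function,
  \<open>G_fun\<close> is smooth across the peak of the soliton.\<close>

definition travel :: "real \<Rightarrow> real" where
  "travel w = 2 * (sqrt (1 + 2 * k) / b) * artanh (sqrt (1 + 2 * k) / b * (w / S w))
     - 2 * sqrt k * artanh (sqrt k * (w / S w))"

lemma c_sq: "c\<^sup>2 < 2"
  using c0 c2 real_sqrt_less_iff[of "c\<^sup>2" 2] by simp

lemma b_pos: "b > 0" and b_sq: "b\<^sup>2 = 2 - c\<^sup>2"
  using c_sq by (auto simp: b_def)

lemma a_pos: "a > 0"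
  unfolding a_def using k0 by (intro add_pos_nonneg) auto

lemmas S_pos = rt_pos[OF a_pos k0] and S_sq = rt_sq[OF a_pos k0]

lemma S_sq': "(S w)\<^sup>2 = 1 + k * (c\<^sup>2 + w\<^sup>2)"
  unfolding S_sq by (simp add: a_def algebra_simps)

lemma isCont_S [continuous_intros]: "isCont S w"
  using DERIV_rt[OF a_pos k0] by (rule DERIV_isCont)

lemma continuous_on_S [continuous_intros]: "continuous_on A f \<Longrightarrow> continuous_on A (\<lambda>x. S (f x))"
  unfolding rt_def by (intro continuous_intros)

lemma travel_arg1:
  assumes "\<bar>w\<bar> < b"
  shows "\<bar>sqrt (1 + 2 * k) / b * (w / S w)\<bar> < 1"
    "1 - (sqrt (1 + 2 * k) / b * (w / S w))\<^sup>2 = a * (b\<^sup>2 - w\<^sup>2) / (b\<^sup>2 * (S w)\<^sup>2)"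
proof -
  have w: "w\<^sup>2 < b\<^sup>2" using assms b_pos by (metis abs_ge_zero power2_abs power_strict_mono zero_less_numeral)
  have bS: "b\<^sup>2 * (S w)\<^sup>2 > 0" by (intro mult_pos_pos zero_less_power b_pos S_pos)
  have "(sqrt (1 + 2 * k) / b * (w / S w))\<^sup>2 = (1 + 2 * k) * w\<^sup>2 / (b\<^sup>2 * (S w)\<^sup>2)"
    using k0 by (simp add: power_mult_distrib power_divide)
  then have "1 - (sqrt (1 + 2 * k) / b * (w / S w))\<^sup>2 = (b\<^sup>2 * (S w)\<^sup>2 - (1 + 2 * k) * w\<^sup>2) / (b\<^sup>2 * (S w)\<^sup>2)"
    using bS b_pos S_pos[of w] by (simp add: diff_divide_distrib)
  also have "b\<^sup>2 * (S w)\<^sup>2 - (1 + 2 * k) * w\<^sup>2 = a * (b\<^sup>2 - w\<^sup>2)"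
    by (simp only: S_sq' b_sq) (simp add: a_def algebra_simps power2_eq_square)
  finally show e: "1 - (sqrt (1 + 2 * k) / b * (w / S w))\<^sup>2 = a * (b\<^sup>2 - w\<^sup>2) / (b\<^sup>2 * (S w)\<^sup>2)" .
  have "a * (b\<^sup>2 - w\<^sup>2) / (b\<^sup>2 * (S w)\<^sup>2) > 0" using w bS a_pos by simp
  then have "(sqrt (1 + 2 * k) / b * (w / S w))\<^sup>2 < 1" unfolding e[symmetric] by simp
  then show "\<bar>sqrt (1 + 2 * k) / b * (w / S w)\<bar> < 1" by (simp add: abs_square_less_1)
qed

lemma travel_arg2: "\<bar>sqrt k * (w / S w)\<bar> < 1" "1 - (sqrt k * (w / S w))\<^sup>2 = a / (S w)\<^sup>2"
proof -
  show "\<bar>sqrt k * (w / S w)\<bar> < 1" using abs_less_rt[OF a_pos k0, of w] by simp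
  have "1 - (sqrt k * (w / S w))\<^sup>2 = ((S w)\<^sup>2 - k * w\<^sup>2) / (S w)\<^sup>2"
    using S_pos[of w] k0 by (simp add: power_mult_distrib power_divide diff_divide_distrib)
  then show "1 - (sqrt k * (w / S w))\<^sup>2 = a / (S w)\<^sup>2" using S_sq[of w] by simp
qed

text \<open>Read backwards this is the profile equation w' = (b^2 - w^2) / (2 S(w)):
  \<open>travel w\<close> is the position at which the profile reaches the value
  \<open>w\<close>.\<close>

lemma DERIV_travel:
  assumes "\<bar>w\<bar> < b"
  shows "DERIV travel w :> 2 * S w / (b\<^sup>2 - w\<^sup>2)"
proof -
  define R s where "R = sqrt (1 + 2 * k)" and "s = S w"
  have s: "s > 0" using S_pos by (simp add: s_def)
  have R2: "R\<^sup>2 = 1 + 2 * k" using k0 by (simp add: R_def)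
  have w: "b\<^sup>2 - w\<^sup>2 > 0" using assms b_pos by (metis abs_ge_zero power2_abs power_strict_mono zero_less_numeral diff_gt_0_iff_gt)
  have d: "DERIV (\<lambda>w. q * (w / S w)) w :> q * (a / s^3)" for q
    unfolding s_def by (rule DERIV_cmult[OF DERIV_div_rt[OF a_pos k0]])
  have "DERIV travel w :> 2 * (R / b) * ((1 / (1 - (R / b * (w / S w))\<^sup>2)) * (R / b * (a / s^3)))
     - 2 * sqrt k * ((1 / (1 - (sqrt k * (w / S w))\<^sup>2)) * (sqrt k * (a / s^3)))"
    unfolding travel_def[abs_def] R_def using travel_arg1(1)[OF assms] travel_arg2(1)[of w]
    by (intro DERIV_diff DERIV_cmult DERIV_chain2[OF artanh_real_has_field_derivative d]) auto
  moreover have "2 * (R / b) * ((1 / (1 - (R / b * (w / S w))\<^sup>2)) * (R / b * (a / s^3)))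
     - 2 * sqrt k * ((1 / (1 - (sqrt k * (w / S w))\<^sup>2)) * (sqrt k * (a / s^3))) = 2 * s / (b\<^sup>2 - w\<^sup>2)"
  proof -
    define D where "D = b\<^sup>2 - w\<^sup>2"
    have D: "D > 0" using w by (simp add: D_def)
    have e1: "1 - (R / b * (w / S w))\<^sup>2 = a * D / (b\<^sup>2 * s\<^sup>2)" unfolding R_def s_def D_def by (rule travel_arg1(2)[OF assms])
    have e2: "1 - (sqrt k * (w / S w))\<^sup>2 = a / s\<^sup>2" unfolding s_def by (rule travel_arg2(2))
    have "2 * (R / b) * ((1 / (1 - (R / b * (w / S w))\<^sup>2)) * (R / b * (a / s^3)))
       = 2 * R\<^sup>2 / (D * s)"
      unfolding e1 using a_pos b_pos D s by (simp add: power2_eq_square power3_eq_cube)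
    moreover have "2 * sqrt k * ((1 / (1 - (sqrt k * (w / S w))\<^sup>2)) * (sqrt k * (a / s^3))) = 2 * k / s"
      unfolding e2 using a_pos s k0 by (simp add: power2_eq_square power3_eq_cube)
    moreover have "2 * R\<^sup>2 / (D * s) - 2 * k / s = 2 * (R\<^sup>2 - k * D) / (D * s)"
      using D s by (simp add: field_simps)
    moreover have "R\<^sup>2 - k * D = s\<^sup>2" unfolding R2 D_def b_sq s_def S_sq' by (simp add: algebra_simps)
    moreover have "2 * s\<^sup>2 / (D * s) = 2 * s / D" using s by (simp add: power2_eq_square)
    ultimately show ?thesis unfolding D_def by (simp only:)
  qed
  ultimately show ?thesis unfolding s_def by (simp only:)
qed

lemma travel_minus:
  assumes "\<bar>w\<bar> < b"
  shows "travel (- w) = - travel w"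
proof -
  have "artanh (- (sqrt (1 + 2 * k) / b * (w / S w))) = - artanh (sqrt (1 + 2 * k) / b * (w / S w))"
    by (rule artanh_minus_real[OF travel_arg1(1)[OF assms]])
  moreover have "artanh (- (sqrt k * (w / S w))) = - artanh (sqrt k * (w / S w))"
    by (rule artanh_minus_real[OF travel_arg2(1)])
  ultimately show ?thesis by (simp add: travel_def)
qed

lemma travel_0: "travel 0 = 0" by (simp add: travel_def)

lemma travel_strict_mono:
  assumes "- b < v" "v < w" "w < b"
  shows "travel v < travel w"
proof (rule DERIV_pos_imp_increasing[OF assms(2)])
  fix x assume x: "v \<le> x" "x \<le> w"
  then have ax: "\<bar>x\<bar> < b" using assms by auto
  then have "b\<^sup>2 - x\<^sup>2 > 0" using b_pos by (metis abs_ge_zero power2_abs power_strict_mono zero_less_numeral diff_gt_0_iff_gt)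
  then show "\<exists>y. DERIV travel x :> y \<and> 0 < y" using DERIV_travel[OF ax] S_pos[of x]
    by (intro exI[of _ "2 * S x / (b\<^sup>2 - x\<^sup>2)"] conjI divide_pos_pos) auto
qed

text \<open>Since S(b) = sqrt(1 + 2 k), the argument of the first artanh tends to 1, while that of
  the second stays away from 1.\<close>

lemma travel_at_b: "filterlim travel at_top (at_left b)"
proof -
  define R where "R = sqrt (1 + 2 * k)"
  have R: "R > 0" using k0 by (simp add: R_def)
  have Sb: "S b = R"
    using S_sq'[of b] S_pos[of b] unfolding b_sq R_def by (intro real_sqrt_unique[symmetric]) auto
  have lt: "((\<lambda>w. w / S w) \<longlongrightarrow> b / R) (at_left b)"
    using isCont_S[of b] S_pos[of b] unfolding isCont_def
    by (intro tendsto_divide tendsto_ident_at) (auto simp: Sb intro: tendsto_mono[OF at_le] filterlim_at_withinI)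
  have l1: "filterlim (\<lambda>w. R / b * (w / S w)) (at_left 1) (at_left b)"
    unfolding filterlim_at
  proof
    show "((\<lambda>w. R / b * (w / S w)) \<longlongrightarrow> 1) (at_left b)"
      using tendsto_mult[OF tendsto_const[of "R / b"] lt] R b_pos by simp
    have "\<forall>\<^sub>F w in at_left b. w \<in> {0<..<b}" using b_pos by (intro eventually_at_leftI[of 0]) auto
    then show "\<forall>\<^sub>F w in at_left b. R / b * (w / S w) \<in> {..<1} \<and> R / b * (w / S w) \<noteq> 1"
    proof eventually_elim
      case (elim w)
      then have "\<bar>R / b * (w / S w)\<bar> < 1" unfolding R_def by (intro travel_arg1(1)) auto
      then have "R / b * (w / S w) < 1" by linarith
      then show ?case by (metis lessThan_iff less_irrefl)
    qed
  qed
  have "filterlim (\<lambda>w. 2 * (R / b) * artanh (R / b * (w / S w))) at_top (at_left b)"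
    by (rule filterlim_tendsto_pos_mult_at_top[OF tendsto_const _ filterlim_compose[OF artanh_real_at_left_1 l1]])
       (use R b_pos in auto)
  moreover have "((\<lambda>w. - (2 * sqrt k * artanh (sqrt k * (w / S w)))) \<longlongrightarrow> - (2 * sqrt k * artanh (sqrt k * (b / R)))) (at_left b)"
  proof (intro tendsto_minus tendsto_mult tendsto_const tendsto_artanh lt)
    have "\<bar>sqrt k * (b / R)\<bar> < 1" using travel_arg2(1)[of b] unfolding Sb .
    then show "- 1 < sqrt k * (b / R)" "sqrt k * (b / R) < 1" by linarith+
  qed
  ultimately have "filterlim (\<lambda>w. - (2 * sqrt k * artanh (sqrt k * (w / S w))) + 2 * (R / b) * artanh (R / b * (w / S w))) at_top (at_left b)"
    by (intro filterlim_tendsto_add_at_top)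
  then show ?thesis by (simp add: travel_def[abs_def] R_def)
qed

lemma travel_surj:
  obtains w where "\<bar>w\<bar> < b" "travel w = x"
proof -
  have ex: "\<exists>w\<ge>0. w < b \<and> travel w = x" if x: "x \<ge> 0" for x
  proof -
    have "\<forall>\<^sub>F w in at_left b. travel w \<ge> x" using travel_at_b by (simp add: filterlim_at_top)
    moreover have "\<forall>\<^sub>F w in at_left b. w \<in> {0<..<b}" using b_pos by (intro eventually_at_leftI[of 0]) auto
    ultimately have "\<forall>\<^sub>F w in at_left b. travel w \<ge> x \<and> w \<in> {0<..<b}" by eventually_elim auto
    then obtain w where w: "travel w \<ge> x" "0 < w" "w < b"
      by (metis (no_types, lifting) eventually_happens' greaterThanLessThan_iff trivial_limit_at_left_real)
    have "\<exists>v. 0 \<le> v \<and> v \<le> w \<and> travel v = x"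
    proof (rule IVT)
      show "\<forall>v. 0 \<le> v \<and> v \<le> w \<longrightarrow> isCont travel v"
        using w by (auto intro!: DERIV_isCont[OF DERIV_travel])
    qed (use w x travel_0 in auto)
    then show ?thesis using w by force
  qed
  show ?thesis
  proof (cases "x \<ge> 0")
    case True then show ?thesis using ex[of x] that by force
  next
    case False
    then obtain w where "w \<ge> 0" "w < b" "travel w = - x" using ex[of "- x"] by force
    then show ?thesis using that[of "- w"] travel_minus[of w] by auto
  qed
qed

text \<open>The odd inverse of \<open>travel\<close>. The profile eta depends only on its square,
  and for \<open>c = 0\<close> the black soliton is \<open>W x / sqrt 2\<close> itself.\<close>

definition W :: "real \<Rightarrow> real" where
  "W x = (THE w. \<bar>w\<bar> < b \<and> travel w = x)"

lemma W_unique: "\<bar>w\<bar> < b \<Longrightarrow> travel w = x \<Longrightarrow> W x = w"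
  unfolding W_def
proof (rule the_equality)
  fix v assume "\<bar>w\<bar> < b" "travel w = x" "\<bar>v\<bar> < b \<and> travel v = x"
  then show "v = w" using travel_strict_mono[of v w] travel_strict_mono[of w v]
    by (cases v w rule: linorder_cases) (auto simp: abs_less_iff)
qed auto

lemma abs_W: "\<bar>W x\<bar> < b" and travel_W: "travel (W x) = x"
proof -
  obtain w where "\<bar>w\<bar> < b" "travel w = x" by (rule travel_surj)
  then show "\<bar>W x\<bar> < b" "travel (W x) = x" using W_unique by auto
qed

lemma W_travel: "\<bar>w\<bar> < b \<Longrightarrow> W (travel w) = w" by (rule W_unique) auto

lemma W_0: "W 0 = 0" by (rule W_unique) (use b_pos travel_0 in auto)

lemma W_minus: "W (- x) = - W x"
  by (rule W_unique) (use abs_W[of x] travel_minus[OF abs_W] travel_W in auto)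

lemma W_sq_less: "(W x)\<^sup>2 < b\<^sup>2"
  using abs_W[of x] b_pos by (metis abs_ge_zero power2_abs power_strict_mono zero_less_numeral)

definition W' :: "real \<Rightarrow> real" where "W' x = (b\<^sup>2 - (W x)\<^sup>2) / (2 * S (W x))"

lemma DERIV_W: "DERIV W x :> W' x"
proof -
  have cW: "isCont W x"
  proof -
    define w where "w = W x"
    have w: "\<bar>w\<bar> < b" using abs_W by (simp add: w_def)
    have "isCont W (travel w)"
    proof (rule isCont_inverse_function2[of "(w - b) / 2" w "(w + b) / 2"])
      fix z assume "(w - b) / 2 \<le> z" "z \<le> (w + b) / 2"
      then have "\<bar>z\<bar> < b" using w by (auto simp: abs_less_iff)
      then show "W (travel z) = z" "isCont travel z" using W_travel DERIV_isCont[OF DERIV_travel] by auto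
    qed (use w in auto)
    then show ?thesis unfolding w_def travel_W .
  qed
  have "DERIV W x :> inverse (2 * S (W x) / (b\<^sup>2 - (W x)\<^sup>2))"
    by (rule DERIV_inverse_function[where f = travel and g = W and a = "x - 1" and b = "x + 1", OF DERIV_travel[OF abs_W]])
       (use S_pos[of "W x"] W_sq_less[of x] travel_W cW in auto)
  then show ?thesis by (simp add: W'_def)
qed

lemma W'_pos: "W' x > 0"
  using W_sq_less[of x] S_pos[of "W x"] by (simp add: W'_def)

lemma isCont_W: "isCont W x" using DERIV_W by (rule DERIV_isCont)

lemma continuous_on_W [continuous_intros]: "continuous_on A f \<Longrightarrow> continuous_on A (\<lambda>x. W (f x))"
  by (rule continuous_on_compose2[of UNIV W])
     (use isCont_W in \<open>auto simp: continuous_on_eq_continuous_at\<close>)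

lemma W_strict_mono: "x < y \<Longrightarrow> W x < W y"
  using DERIV_W W'_pos by (meson DERIV_pos_imp_increasing)

lemma W_at_top: "(W \<longlongrightarrow> b) at_top"
proof (rule order_tendstoI)
  fix e assume e: "b < e"
  then show "\<forall>\<^sub>F x in at_top. W x < e" using abs_W by (intro always_eventually) (auto simp: abs_less_iff intro: less_trans)
next
  fix e assume e: "e < b"
  define v where "v = max e 0"
  have v: "\<bar>v\<bar> < b" using e b_pos by (auto simp: v_def)
  show "\<forall>\<^sub>F x in at_top. e < W x"
    using eventually_gt_at_top[of "travel v"]
  proof eventually_elim
    case (elim x)
    then have "W (travel v) < W x" by (rule W_strict_mono)
    then show ?case using W_travel[OF v] by (simp add: v_def)
  qed
qed

lemma W_at_bot: "(W \<longlongrightarrow> - b) at_bot"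
  using tendsto_minus[OF W_at_top] unfolding filterlim_at_bot_mirror by (simp add: W_minus)

definition et :: "real \<Rightarrow> real" where "et x = (b\<^sup>2 - (W x)\<^sup>2) / 2"

lemma et_pos: "et x > 0" using W_sq_less by (simp add: et_def)

lemma one_minus_et: "1 - et x = (c\<^sup>2 + (W x)\<^sup>2) / 2"
  unfolding et_def b_sq by (simp add: field_simps)

lemma G_fun_travel:
  assumes "y \<le> 1 - c\<^sup>2 / 2"
  shows "G_fun c (- k) y = travel (sqrt (2 - c\<^sup>2 - 2 * y))"
proof -
  define w where "w = sqrt (2 - c\<^sup>2 - 2 * y)"
  have w2: "w\<^sup>2 = 2 - c\<^sup>2 - 2 * y" using assms by (simp add: w_def)
  have Sw: "sqrt (1 - 2 * - k + 2 * - k * y) = S w"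
    unfolding rt_def w2 a_def by (simp add: algebra_simps)
  have 1: "sqrt (- (- k)) * sqrt ((2 - c\<^sup>2 - 2 * y) / (1 - 2 * - k + 2 * - k * y)) = sqrt k * (w / S w)"
    by (simp only: real_sqrt_divide w_def[symmetric] Sw minus_minus)
  have 2: "sqrt (((1 - 2 * - k) * (2 - c\<^sup>2 - 2 * y)) / ((2 - c\<^sup>2) * (1 - 2 * - k + 2 * - k * y)))
     = sqrt (1 + 2 * k) / b * (w / S w)"
    by (simp only: real_sqrt_divide real_sqrt_mult w_def[symmetric] Sw) (simp add: b_def)
  have 3: "sqrt ((1 - 2 * - k) / (2 - c\<^sup>2)) = sqrt (1 + 2 * k) / b"
    unfolding b_def by (simp add: real_sqrt_divide)
  show ?thesis unfolding G_fun_def 1 2 3 travel_def w_def[symmetric] by simp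
qed

text \<open>Bridge from the inverse function in the definition of the solitons to the smooth
  variable \<open>W\<close>: on nonnegative arguments the two inverses correspond through the
  nonnegative square root, and both sides are even.\<close>

lemma eta_eq_et: "eta c (- k) x = et x"
proof -
  have inj: "inj_on (G_fun c (- k)) {0<..1 - c\<^sup>2 / 2}"
  proof (rule inj_onI)
    fix y z assume y: "y \<in> {0<..1 - c\<^sup>2 / 2}" and z: "z \<in> {0<..1 - c\<^sup>2 / 2}" and e: "G_fun c (- k) y = G_fun c (- k) z"
    have lt: "\<bar>sqrt (2 - c\<^sup>2 - 2 * y)\<bar> < b" if "y \<in> {0<..1 - c\<^sup>2 / 2}" for y
      using that by (simp add: b_def)
    have "travel (sqrt (2 - c\<^sup>2 - 2 * y)) = travel (sqrt (2 - c\<^sup>2 - 2 * z))"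
      using e G_fun_travel y z by simp
    then have "sqrt (2 - c\<^sup>2 - 2 * y) = sqrt (2 - c\<^sup>2 - 2 * z)"
      using W_travel[OF lt[OF y]] W_travel[OF lt[OF z]] by metis
    then show "y = z" by simp
  qed
  have Wa: "W \<bar>x\<bar> \<ge> 0" using W_strict_mono[of 0 "\<bar>x\<bar>"] W_0 by (cases "x = 0") auto
  have sq: "sqrt (2 - c\<^sup>2 - 2 * et \<bar>x\<bar>) = W \<bar>x\<bar>"
  proof -
    have "2 - c\<^sup>2 - 2 * et \<bar>x\<bar> = (W \<bar>x\<bar>)\<^sup>2" unfolding et_def b_sq by (simp add: field_simps)
    then show ?thesis using Wa by simp
  qed
  have rng: "et \<bar>x\<bar> \<in> {0<..1 - c\<^sup>2 / 2}" using et_pos[of "\<bar>x\<bar>"] unfolding et_def b_sq by (auto simp: field_simps)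
  have "eta c (- k) x = et \<bar>x\<bar>"
    unfolding eta_def
    by (rule the_inv_into_f_eq[OF inj _ rng]) (use G_fun_travel[of "et \<bar>x\<bar>"] rng sq travel_W in auto)
  also have "et \<bar>x\<bar> = et x" using W_minus[of x] by (auto simp: et_def abs_if)
  finally show ?thesis .
qed

lemma DERIV_et: "DERIV et x :> - W x * W' x"
  unfolding et_def[abs_def] using DERIV_W by (auto intro!: derivative_eq_intros)

lemma W'_eq: "W' x = et x / S (W x)"
  using S_pos[of "W x"] by (simp add: W'_def et_def)

lemma continuous_on_W' [continuous_intros]: "continuous_on A f \<Longrightarrow> continuous_on A (\<lambda>x. W' (f x))"
  unfolding W'_def using S_pos by (intro continuous_intros) (auto simp: less_imp_neq[symmetric])

lemma continuous_on_et [continuous_intros]: "continuous_on A f \<Longrightarrow> continuous_on A (\<lambda>x. et (f x))"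
  unfolding et_def by (intro continuous_intros) auto

end

subsection \<open>Solitons with a plateau\<close>

lemma norm_sq_primitive:
  fixes u :: "real \<Rightarrow> complex"
  assumes "primitive u w"
  shows "primitive (\<lambda>x. (norm (u x))\<^sup>2) (\<lambda>x. 2 * (u x \<bullet> w x))"
  using primitive_bilinear[OF bounded_bilinear_inner assms assms]
  by (simp add: power2_norm_eq_inner inner_commute)

lemma X_spaceI:
  assumes p: "primitive u w" and i: "integrable lborel (\<lambda>x. (norm (w x))\<^sup>2)"
    "integrable lborel (\<lambda>x. (1 - (norm (u x))\<^sup>2)\<^sup>2)"
  shows "u \<in> X_space"
proof -
  note d = primitive_weak_deriv[OF p]
  note c = primitive_continuous[OF p]
  have m: "weak_deriv u \<in> borel_measurable lborel" "w \<in> borel_measurable lborel" "u \<in> borel_measurable lborel"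
    using locally_integrable_measurable primitiveD(1) d(1) p locally_integrable_continuous[OF c] by blast+
  have i': "integrable lborel (\<lambda>x. (norm (weak_deriv u x))\<^sup>2)"
  proof (rule integrable_cong_AE[THEN iffD1, OF _ _ _ i(1)])
    show "AE x in lborel. (norm (w x))\<^sup>2 = (norm (weak_deriv u x))\<^sup>2" using d(2) by eventually_elim simp
  qed (use m in measurable)
  have l: "set_integrable lborel {a..b} (\<lambda>x. (norm (weak_deriv u x))\<^sup>2)" for a b
    using integrable_imp_locally_integrable[OF i'] unfolding locally_integrable_def by auto
  have l': "set_integrable lborel {a..b} (\<lambda>x. (norm (u x))\<^sup>2)" for a b
    by (intro locally_integrableD locally_integrable_continuous continuous_intros c)
  have "u \<in> H1_loc" unfolding H1_loc_def L2_loc_def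
    using c m l l' primitive_imp_has_weak_deriv[OF p] by auto
  moreover have "weak_deriv u \<in> L2" unfolding L2_def using m i' by auto
  moreover have "(\<lambda>x. 1 - (norm (u x))\<^sup>2) \<in> L2" unfolding L2_def using i(2) m by auto
  ultimately show ?thesis unfolding X_space_def by auto
qed

lemma X_spaceD:
  assumes "u \<in> X_space"
  shows "primitive u (weak_deriv u)" "integrable lborel (\<lambda>x. (norm (weak_deriv u x))\<^sup>2)"
    "integrable lborel (\<lambda>x. (1 - (norm (u x))\<^sup>2)\<^sup>2)"
proof -
  from assms obtain w where "continuous_on UNIV u" "has_weak_deriv u w"
    unfolding X_space_def H1_loc_def by auto
  then have "primitive u w" by (intro has_weak_deriv_imp_primitive)
  then show "primitive u (weak_deriv u)" by (rule primitive_weak_deriv)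
  show "integrable lborel (\<lambda>x. (norm (weak_deriv u x))\<^sup>2)"
    "integrable lborel (\<lambda>x. (1 - (norm (u x))\<^sup>2)\<^sup>2)"
    using assms unfolding X_space_def L2_def by auto
qed

lemma energy_eq:
  assumes "primitive u w"
  shows "energy \<kappa> u = 1 / 2 * (LINT x|lborel. (norm (w x))\<^sup>2)
     + 1 / 4 * (LINT x|lborel. (1 - (norm (u x))\<^sup>2)\<^sup>2)
     - \<kappa> / 4 * (LINT x|lborel. (2 * (u x \<bullet> w x))\<^sup>2)"
proof -
  note d = primitive_weak_deriv[OF assms] and e = primitive_weak_deriv[OF norm_sq_primitive[OF assms]]
  have m: "weak_deriv u \<in> borel_measurable lborel" "w \<in> borel_measurable lborel"
    "weak_deriv (\<lambda>y. (norm (u y))\<^sup>2) \<in> borel_measurable lborel" "(\<lambda>x. 2 * (u x \<bullet> w x)) \<in> borel_measurable lborel"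
    using locally_integrable_measurable primitiveD(1) d(1) e(1) assms norm_sq_primitive[OF assms] by blast+
  have "(LINT x|lborel. (norm (weak_deriv u x))\<^sup>2) = (LINT x|lborel. (norm (w x))\<^sup>2)"
    by (rule integral_cong_AE) (use m d(2) in \<open>auto elim: eventually_mono\<close>)
  moreover have "(LINT x|lborel. (weak_deriv (\<lambda>y. (norm (u y))\<^sup>2) x)\<^sup>2) = (LINT x|lborel. (2 * (u x \<bullet> w x))\<^sup>2)"
  proof (rule integral_cong_AE)
    show "AE x in lborel. (weak_deriv (\<lambda>y. (norm (u y))\<^sup>2) x)\<^sup>2 = (2 * (u x \<bullet> w x))\<^sup>2"
      using e(2) by eventually_elim simp
    show "(\<lambda>x. (2 * (u x \<bullet> w x))\<^sup>2) \<in> borel_measurable lborel" using m(4) by (rule borel_measurable_power)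
    show "(\<lambda>x. (weak_deriv (\<lambda>y. (norm (u y))\<^sup>2) x)\<^sup>2) \<in> borel_measurable lborel" using m(3) by (rule borel_measurable_power)
  qed
  ultimately show ?thesis unfolding energy_def by simp
qed

lemma momentum_eq:
  assumes "primitive u w"
  shows "momentum u = 1 / 2 * (LINT x|lborel. ((\<i> * w x) \<bullet> u x) * (1 - 1 / (norm (u x))\<^sup>2))"
proof -
  note d = primitive_weak_deriv[OF assms]
  have m: "weak_deriv u \<in> borel_measurable lborel" "w \<in> borel_measurable lborel" "u \<in> borel_measurable lborel"
    using locally_integrable_measurable primitiveD(1) d(1) assms
      locally_integrable_continuous[OF primitive_continuous[OF assms]] by blast+
  have "(LINT x|lborel. ((\<i> * weak_deriv u x) \<bullet> u x) * (1 - 1 / (norm (u x))\<^sup>2))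
     = (LINT x|lborel. ((\<i> * w x) \<bullet> u x) * (1 - 1 / (norm (u x))\<^sup>2))"
  proof (rule integral_cong_AE)
    show "AE x in lborel. ((\<i> * weak_deriv u x) \<bullet> u x) * (1 - 1 / (norm (u x))\<^sup>2) = ((\<i> * w x) \<bullet> u x) * (1 - 1 / (norm (u x))\<^sup>2)"
      using d(2) by eventually_elim simp
  qed (use m in measurable)
  then show ?thesis unfolding momentum_def by simp
qed

lemma integral_UNIV_FTC:
  fixes f D :: "real \<Rightarrow> real"
  assumes D: "\<And>x. DERIV D x :> f x" and f: "continuous_on UNIV f" and nn: "\<And>x. f x \<ge> 0"
    and A: "(D \<longlongrightarrow> A) at_bot" and B: "(D \<longlongrightarrow> B) at_top"
  shows "integrable lborel f" "(LINT x|lborel. f x) = B - A"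
proof -
  have "((D \<circ> real_of_ereal) \<longlongrightarrow> A) (at_right (-\<infinity>))" "((D \<circ> real_of_ereal) \<longlongrightarrow> B) (at_left \<infinity>)"
    using A B by (auto simp: ereal_tendsto_simps)
  then have "set_integrable lborel (einterval (-\<infinity>) \<infinity>) f" "(LBINT x=-\<infinity>..\<infinity>. f x) = B - A"
    using interval_integral_FTC_nonneg[of "-\<infinity>" \<infinity> D f A B] D f nn
    by (auto simp: continuous_on_eq_continuous_at)
  then show "integrable lborel f" "(LINT x|lborel. f x) = B - A"
    by (auto simp: set_integrable_def interval_lebesgue_integral_def set_lebesgue_integral_def einterval_def)
qed

text \<open>The map sending \<open>x\<close> to \<open>x - clamp_to l x\<close> collapses [-l, l] to
  0 and shifts the two outer half-lines until they meet there. Composing a profile with it inserts a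
  plateau of length 2 l.\<close>

definition clamp_to :: "real \<Rightarrow> real \<Rightarrow> real" where
  "clamp_to l x = max (- l) (min l x)"

lemma DERIV_plateau_0:
  assumes l: "l \<ge> 0" and \<Phi>: "\<And>x. DERIV \<Phi> x :> \<phi> x" and 0: "\<phi> 0 = 0"
  shows "DERIV (\<lambda>x. \<Phi> (x - clamp_to l x)) x :> \<phi> (x - clamp_to l x)"
proof (cases "x - clamp_to l x = 0")
  case True
  show ?thesis unfolding True 0
  proof (rule DERIV_compose_Lipschitz_0[where \<Phi> = \<Phi>])
    show "\<bar>(x' - clamp_to l x') - (x - clamp_to l x)\<bar> \<le> \<bar>x' - x\<bar>" for x'
      using l by (auto simp: clamp_to_def max_def min_def)
    show "DERIV \<Phi> (x - clamp_to l x) :> 0" using \<Phi>[of 0] 0 unfolding True by simp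
  qed
next
  case False
  then consider "x > l" | "x < - l" using l by (fastforce simp: clamp_to_def)
  then show ?thesis
  proof cases
    case 1
    have "DERIV (\<lambda>x. \<Phi> (x + - l)) x :> \<phi> (x + - l)" using \<Phi>[of "x + - l"] by (simp only: DERIV_shift)
    then have "DERIV (\<lambda>x. \<Phi> (x - clamp_to l x)) x :> \<phi> (x + - l)"
      by (rule has_field_derivative_transform_within_open[of _ _ _ "{l<..}"]) (use 1 l in \<open>auto simp: clamp_to_def\<close>)
    then show ?thesis using 1 l by (simp add: clamp_to_def)
  next
    case 2
    have "DERIV (\<lambda>x. \<Phi> (x + l)) x :> \<phi> (x + l)" using \<Phi>[of "x + l"] by (simp only: DERIV_shift)
    then have "DERIV (\<lambda>x. \<Phi> (x - clamp_to l x)) x :> \<phi> (x + l)"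
      by (rule has_field_derivative_transform_within_open[of _ _ _ "{..< -l}"]) (use 2 l in \<open>auto simp: clamp_to_def\<close>)
    then show ?thesis using 2 l by (simp add: clamp_to_def)
  qed
qed

text \<open>Subtracting the linear function with slope \<open>\<phi> 0\<close> reduces this to a
  derivative vanishing at the collapsed point; adding it back makes the function run along the
  plateau with that slope.\<close>

lemma DERIV_plateau:
  assumes l: "l \<ge> 0" and \<Phi>: "\<And>x. DERIV \<Phi> x :> \<phi> x"
  shows "DERIV (\<lambda>x. \<Phi> (x - clamp_to l x) + \<phi> 0 * clamp_to l x) x :> \<phi> (x - clamp_to l x)"
proof -
  have "DERIV (\<lambda>x. (\<Phi> (x - clamp_to l x) - \<phi> 0 * (x - clamp_to l x)) + \<phi> 0 * x) x
     :> (\<phi> (x - clamp_to l x) - \<phi> 0) + \<phi> 0"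
  proof (rule DERIV_add)
    show "DERIV (\<lambda>x. \<Phi> (x - clamp_to l x) - \<phi> 0 * (x - clamp_to l x)) x :> \<phi> (x - clamp_to l x) - \<phi> 0"
    proof (rule DERIV_plateau_0[OF l, where \<Phi> = "\<lambda>x. \<Phi> x - \<phi> 0 * x" and \<phi> = "\<lambda>x. \<phi> x - \<phi> 0"])
      show "DERIV (\<lambda>x. \<Phi> x - \<phi> 0 * x) x :> \<phi> x - \<phi> 0" for x
        by (rule DERIV_diff[OF \<Phi>]) (auto intro!: derivative_eq_intros)
    qed simp
  qed (auto intro!: derivative_eq_intros)
  then show ?thesis by (simp add: algebra_simps)
qed

lemma clamp_to_at_top: "l \<ge> 0 \<Longrightarrow> \<forall>\<^sub>F x in at_top. clamp_to l x = l"
  by (rule eventually_mono[OF eventually_ge_at_top[of l]]) (auto simp: clamp_to_def)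

lemma clamp_to_at_bot: "l \<ge> 0 \<Longrightarrow> \<forall>\<^sub>F x in at_bot. clamp_to l x = - l"
  by (rule eventually_mono[OF eventually_le_at_bot[of "- l"]]) (auto simp: clamp_to_def)

lemma integral_plateau:
  fixes f \<Phi> :: "real \<Rightarrow> real"
  assumes l: "l \<ge> 0" and \<Phi>: "\<And>x. DERIV \<Phi> x :> f x" and f: "continuous_on UNIV f" and nn: "\<And>x. f x \<ge> 0"
    and A: "(\<Phi> \<longlongrightarrow> A) at_bot" and B: "(\<Phi> \<longlongrightarrow> B) at_top"
  shows "integrable lborel (\<lambda>x. f (x - clamp_to l x))"
    "(LINT x|lborel. f (x - clamp_to l x)) = B - A + 2 * l * f 0"
proof -
  have c: "continuous_on UNIV (\<lambda>x. x - clamp_to l x)" unfolding clamp_to_def by (intro continuous_intros)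
  have t: "((\<lambda>x. \<Phi> (x - clamp_to l x) + f 0 * clamp_to l x) \<longlongrightarrow> B + f 0 * l) at_top"
  proof (rule Lim_transform_eventually)
    have "filterlim (\<lambda>x. - l + x) at_top at_top" by (rule filterlim_tendsto_add_at_top[OF tendsto_const filterlim_ident])
    from filterlim_compose[OF B this]
    show "((\<lambda>x. \<Phi> (- l + x) + f 0 * l) \<longlongrightarrow> B + f 0 * l) at_top" by (intro tendsto_add tendsto_const)
    show "\<forall>\<^sub>F x in at_top. \<Phi> (- l + x) + f 0 * l = \<Phi> (x - clamp_to l x) + f 0 * clamp_to l x"
      using clamp_to_at_top[OF l] by eventually_elim (simp add: algebra_simps)
  qed
  have b: "((\<lambda>x. \<Phi> (x - clamp_to l x) + f 0 * clamp_to l x) \<longlongrightarrow> A + f 0 * - l) at_bot"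
  proof (rule Lim_transform_eventually)
    have "filterlim (\<lambda>x. l + x) at_bot at_bot" 
      unfolding filterlim_at_bot
    proof
      show "\<forall>\<^sub>F x in at_bot. l + x \<le> Z" for Z
        using eventually_le_at_bot[of "Z - l"] by eventually_elim simp
    qed
    from filterlim_compose[OF A this]
    show "((\<lambda>x. \<Phi> (l + x) + f 0 * - l) \<longlongrightarrow> A + f 0 * - l) at_bot" by (intro tendsto_add tendsto_const)
    show "\<forall>\<^sub>F x in at_bot. \<Phi> (l + x) + f 0 * - l = \<Phi> (x - clamp_to l x) + f 0 * clamp_to l x"
      using clamp_to_at_bot[OF l] by eventually_elim (simp add: algebra_simps)
  qed
  have c': "continuous_on UNIV (\<lambda>x. f (x - clamp_to l x))" using continuous_on_compose2[OF f c] by simp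
  note * = integral_UNIV_FTC[OF DERIV_plateau[OF l \<Phi>] c' nn b t]
  show "integrable lborel (\<lambda>x. f (x - clamp_to l x))" by (rule *(1))
  show "(LINT x|lborel. f (x - clamp_to l x)) = B - A + 2 * l * f 0" using *(2) by (simp add: algebra_simps)
qed

context soliton_profile
begin

lemma energy_density_prim: "DERIV (\<lambda>x. en_prim k c (W x)) x :> (et x)\<^sup>2 / 2"
proof -
  have "DERIV (\<lambda>x. en_prim k c (W x)) x :> (2 - c\<^sup>2 - (W x)\<^sup>2) * S (W x) / 4 * W' x"
    using DERIV_chain2[OF DERIV_en_prim[OF k0] DERIV_W] by (simp add: a_def)
  moreover have "(2 - c\<^sup>2 - (W x)\<^sup>2) * S (W x) / 4 * W' x = (et x)\<^sup>2 / 2"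
    unfolding b_sq[symmetric] W'_eq et_def using S_pos[of "W x"] by (simp add: power2_eq_square)
  ultimately show ?thesis by (simp only:)
qed

lemma isCont_en_prim: "isCont (en_prim k c) w"
  using DERIV_en_prim[OF k0] by (rule DERIV_isCont)

lemma energy_density_plateau:
  assumes l: "l \<ge> 0"
  shows "integrable lborel (\<lambda>x. (et (x - clamp_to l x))\<^sup>2 / 2)"
    "(LINT x|lborel. (et (x - clamp_to l x))\<^sup>2 / 2) = sol_energy k c + l * (et 0)\<^sup>2"
proof -
  have t: "((\<lambda>x. en_prim k c (W x)) \<longlongrightarrow> en_prim k c b) at_top" "((\<lambda>x. en_prim k c (W x)) \<longlongrightarrow> en_prim k c (- b)) at_bot"
    by (rule isCont_tendsto_compose[OF isCont_en_prim] W_at_top W_at_bot)+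
  note * = integral_plateau[OF l energy_density_prim _ _ t(2) t(1)]
  show "integrable lborel (\<lambda>x. (et (x - clamp_to l x))\<^sup>2 / 2)"
    by (rule *(1)) (auto intro!: continuous_intros)
  show "(LINT x|lborel. (et (x - clamp_to l x))\<^sup>2 / 2) = sol_energy k c + l * (et 0)\<^sup>2"
    by (subst *(2)) (auto intro!: continuous_intros simp: en_prim_minus[OF k0] sol_energy_def b_def)
qed

lemma momentum_density_prim:
  assumes "c > 0"
  shows "DERIV (\<lambda>x. mom_prim k c (W x)) x :> c / 4 * ((et x)\<^sup>2 / (1 - et x))"
proof -
  have z: "c\<^sup>2 + (W x)\<^sup>2 > 0" using assms by (intro add_pos_nonneg) auto
  have "DERIV (\<lambda>x. mom_prim k c (W x)) x :> c * (2 - c\<^sup>2 - (W x)\<^sup>2) / (4 * (c\<^sup>2 + (W x)\<^sup>2)) * S (W x) * W' x"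
    using DERIV_chain2[OF DERIV_mom_prim[OF k0 assms] DERIV_W] by (simp add: a_def)
  moreover have "c * (2 - c\<^sup>2 - (W x)\<^sup>2) / (4 * (c\<^sup>2 + (W x)\<^sup>2)) * S (W x) * W' x = c / 4 * ((et x)\<^sup>2 / (1 - et x))"
  proof -
    have "2 - c\<^sup>2 - (W x)\<^sup>2 = 2 * et x" unfolding et_def b_sq by simp
    moreover have "c\<^sup>2 + (W x)\<^sup>2 = 2 * (1 - et x)" unfolding one_minus_et by simp
    moreover have "S (W x) * W' x = et x" unfolding W'_eq using S_pos[of "W x"] by simp
    ultimately have e: "c * (2 - c\<^sup>2 - (W x)\<^sup>2) / (4 * (c\<^sup>2 + (W x)\<^sup>2)) * S (W x) * W' x
       = c * (2 * et x) / (4 * (2 * (1 - et x))) * et x" by (simp only: mult.assoc)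
    have "c * (2 * e) / (4 * (2 * v)) * e = c / 4 * (e\<^sup>2 / v)" if "v \<noteq> 0" for e v :: real
      using that by (simp add: field_simps power2_eq_square)
    moreover have "1 - et x > 0" unfolding one_minus_et using z by simp
    then have "1 - et x \<noteq> 0" by simp
    ultimately show ?thesis unfolding e by blast
  qed
  ultimately show ?thesis by (simp only:)
qed

lemma one_minus_et_pos: "c > 0 \<Longrightarrow> 1 - et x > 0"
  unfolding one_minus_et by (simp add: add_pos_nonneg)

lemma momentum_density_plateau:
  assumes c: "c > 0" and l: "l \<ge> 0"
  shows "integrable lborel (\<lambda>x. c / 4 * ((et (x - clamp_to l x))\<^sup>2 / (1 - et (x - clamp_to l x))))"
    "(LINT x|lborel. c / 4 * ((et (x - clamp_to l x))\<^sup>2 / (1 - et (x - clamp_to l x))))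
      = sol_momentum k c + l / c * (et 0)\<^sup>2"
proof -
  have i: "isCont (mom_prim k c) w" for w using DERIV_mom_prim[OF k0 c] by (rule DERIV_isCont)
  have t: "((\<lambda>x. mom_prim k c (W x)) \<longlongrightarrow> mom_prim k c b) at_top" "((\<lambda>x. mom_prim k c (W x)) \<longlongrightarrow> mom_prim k c (- b)) at_bot"
    by (rule isCont_tendsto_compose[OF i] W_at_top W_at_bot)+
  have nz: "1 - et x \<noteq> 0" "0 \<le> 1 - et x" for x using one_minus_et_pos[OF c, of x] by auto
  note * = integral_plateau[OF l momentum_density_prim[OF c] _ _ t(2) t(1)]
  show "integrable lborel (\<lambda>x. c / 4 * ((et (x - clamp_to l x))\<^sup>2 / (1 - et (x - clamp_to l x))))"
    by (rule *(1)) (use nz c in \<open>auto intro!: continuous_intros\<close>)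
  have "(LINT x|lborel. c / 4 * ((et (x - clamp_to l x))\<^sup>2 / (1 - et (x - clamp_to l x))))
      = mom_prim k c b - mom_prim k c (- b) + 2 * l * (c / 4 * ((et 0)\<^sup>2 / (1 - et 0)))"
    by (rule *(2)) (use nz c in \<open>auto intro!: continuous_intros\<close>)
  also have "mom_prim k c b - mom_prim k c (- b) = sol_momentum k c"
    by (simp add: mom_prim_minus[OF k0] sol_momentum_def b_def)
  also have "2 * l * (c / 4 * ((et 0)\<^sup>2 / (1 - et 0))) = l / c * (et 0)\<^sup>2"
    unfolding one_minus_et[of 0] W_0 using c by (simp add: power2_eq_square)
  finally show "(LINT x|lborel. c / 4 * ((et (x - clamp_to l x))\<^sup>2 / (1 - et (x - clamp_to l x))))
      = sol_momentum k c + l / c * (et 0)\<^sup>2" .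
qed

end

lemma polar_derivative:
  assumes "DERIV \<rho> x :> r'" "DERIV \<theta> x :> t'"
  shows "((\<lambda>x. complex_of_real (\<rho> x) * exp (\<i> * complex_of_real (\<theta> x))) has_vector_derivative
    Complex r' (\<rho> x * t') * exp (\<i> * complex_of_real (\<theta> x))) (at x)"
proof -
  have 1: "((\<lambda>x. complex_of_real (\<rho> x)) has_vector_derivative complex_of_real r') (at x)"
    using assms(1) by (intro has_vector_derivative_of_real) (simp add: has_real_derivative_iff_has_vector_derivative)
  have 2: "((\<lambda>x. \<i> * complex_of_real (\<theta> x)) has_vector_derivative \<i> * complex_of_real t') (at x)"
    using assms(2)
    by (intro has_vector_derivative_mult_right has_vector_derivative_of_real)
       (simp add: has_real_derivative_iff_has_vector_derivative)
  have 3: "((\<lambda>x. exp (\<i> * complex_of_real (\<theta> x))) has_vector_derivative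
      \<i> * complex_of_real t' * exp (\<i> * complex_of_real (\<theta> x))) (at x)"
    using field_vector_diff_chain_at[OF 2 DERIV_exp] by (simp add: o_def)
  show ?thesis
    using has_vector_derivative_mult[OF 1 3] by (simp add: Complex_eq algebra_simps)
qed

lemma polar_values:
  fixes r t' r' ph :: real
  assumes "r \<ge> 0"
  defines "e \<equiv> exp (\<i> * complex_of_real ph)"
  shows "norm (complex_of_real r * e) = r" "(norm (Complex r' (r * t') * e))\<^sup>2 = r'\<^sup>2 + r\<^sup>2 * t'\<^sup>2"
    "(complex_of_real r * e) \<bullet> (Complex r' (r * t') * e) = r * r'"
    "(\<i> * (Complex r' (r * t') * e)) \<bullet> (complex_of_real r * e) = - (r\<^sup>2 * t')"
proof -
  have n: "norm e = 1" by (simp add: e_def)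
  have sc: "cos ph * cos ph = 1 - sin ph * sin ph" using cos_squared_eq[of ph] by (simp add: power2_eq_square)
  have "e = cis ph" by (simp add: e_def cis_conv_exp)
  then have e: "Re e = cos ph" "Im e = sin ph" by simp_all
  show "norm (complex_of_real r * e) = r" using assms(1) n by (simp add: norm_mult)
  show "(norm (Complex r' (r * t') * e))\<^sup>2 = r'\<^sup>2 + r\<^sup>2 * t'\<^sup>2"
    unfolding norm_mult n by (simp add: cmod_power2 power_mult_distrib)
  show "(complex_of_real r * e) \<bullet> (Complex r' (r * t') * e) = r * r'"
    by (simp add: inner_complex_def e algebra_simps sc)
  show "(\<i> * (Complex r' (r * t') * e)) \<bullet> (complex_of_real r * e) = - (r\<^sup>2 * t')"
    by (simp add: inner_complex_def e algebra_simps power2_eq_square sc)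
qed

text \<open>The three energy terms add up to an integrable density; being nonnegative they are then
  integrable one by one.\<close>

lemma X_space_energy:
  assumes p: "primitive u w" and \<kappa>: "\<kappa> \<le> 0"
    and dens: "\<And>x. 1 / 2 * (norm (w x))\<^sup>2 + 1 / 4 * (1 - (norm (u x))\<^sup>2)\<^sup>2 - \<kappa> / 4 * (2 * (u x \<bullet> w x))\<^sup>2 = f x"
    and i: "integrable lborel f"
  shows "u \<in> X_space" "energy \<kappa> u = (LINT x|lborel. f x)"
proof -
  have m: "w \<in> borel_measurable lborel" "u \<in> borel_measurable lborel"
    using locally_integrable_measurable primitiveD(1)[OF p] locally_integrable_continuous[OF primitive_continuous[OF p]] by blast+
  have nn: "0 \<le> - \<kappa> / 4 * (2 * (u x \<bullet> w x))\<^sup>2" for x using \<kappa> by (intro mult_nonneg_nonneg) auto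
  have le: "(norm (w x))\<^sup>2 \<le> 2 * f x" "(1 - (norm (u x))\<^sup>2)\<^sup>2 \<le> 4 * f x" for x
    using dens[of x] nn[of x] zero_le_power2[of "1 - (norm (u x))\<^sup>2"] zero_le_power2[of "norm (w x)"] by linarith+
  have i1: "integrable lborel (\<lambda>x. (norm (w x))\<^sup>2)"
  proof (rule Bochner_Integration.integrable_bound)
    show "integrable lborel (\<lambda>x. 2 * f x)" using i by simp
    show "AE x in lborel. norm ((norm (w x))\<^sup>2) \<le> norm (2 * f x)"
      unfolding real_norm_def abs_power2 by (intro AE_I2 order_trans[OF le(1) abs_ge_self])
  qed (use m in measurable)
  have i2: "integrable lborel (\<lambda>x. (1 - (norm (u x))\<^sup>2)\<^sup>2)"
  proof (rule Bochner_Integration.integrable_bound)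
    show "integrable lborel (\<lambda>x. 4 * f x)" using i by simp
    show "AE x in lborel. norm ((1 - (norm (u x))\<^sup>2)\<^sup>2) \<le> norm (4 * f x)"
      unfolding real_norm_def abs_power2 by (intro AE_I2 order_trans[OF le(2) abs_ge_self])
  qed (use m in measurable)
  show "u \<in> X_space" by (rule X_spaceI[OF p i1 i2])
  have e: "- \<kappa> / 4 * (2 * (u x \<bullet> w x))\<^sup>2 = f x - 1 / 2 * (norm (w x))\<^sup>2 - 1 / 4 * (1 - (norm (u x))\<^sup>2)\<^sup>2" for x
    using dens[of x] by simp
  have "- \<kappa> / 4 * (LINT x|lborel. (2 * (u x \<bullet> w x))\<^sup>2) = (LINT x|lborel. - \<kappa> / 4 * (2 * (u x \<bullet> w x))\<^sup>2)"
    by (rule integral_mult_right_zero[symmetric])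
  also have "\<dots> = (LINT x|lborel. f x) - 1 / 2 * (LINT x|lborel. (norm (w x))\<^sup>2) - 1 / 4 * (LINT x|lborel. (1 - (norm (u x))\<^sup>2)\<^sup>2)"
    unfolding e using i i1 i2 by simp
  finally show "energy \<kappa> u = (LINT x|lborel. f x)" unfolding energy_eq[OF p] by simp
qed

context soliton_profile
begin

abbreviation phase :: "real \<Rightarrow> real" where "phase \<equiv> theta c (- k)"

definition phase' :: "real \<Rightarrow> real" where "phase' x = c / 2 * (et x / (1 - et x))"

lemma continuous_on_phase':
  assumes "c > 0"
  shows "continuous_on A phase'"
  unfolding phase'_def[abs_def] using one_minus_et_pos[OF assms]
  by (intro continuous_intros) (auto simp: less_imp_neq[symmetric])

lemma DERIV_phase:
  assumes "c > 0"
  shows "DERIV phase x :> phase' x"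
proof -
  let ?f = "\<lambda>y. et y / (1 - et y)"
  have cf: "continuous_on A ?f" for A
    using one_minus_et_pos[OF assms] by (intro continuous_intros) (auto simp: less_imp_neq[symmetric])
  define A B where "A = min 0 x - 1" and "B = max 0 x + 1"
  have "((\<lambda>u. LBINT y=0..u. ?f y) has_vector_derivative ?f x) (at x within {A..B})"
    unfolding zero_ereal_def by (rule interval_integral_FTC2) (auto simp: A_def B_def intro: cf)
  moreover have "at x within {A..B} = at x" by (rule at_within_Icc_at) (auto simp: A_def B_def)
  ultimately have "DERIV (\<lambda>u. LBINT y=ereal 0..ereal u. ?f y) x :> ?f x"
    by (simp add: has_real_derivative_iff_has_vector_derivative zero_ereal_def)
  from DERIV_cmult[OF this, of "c / 2"] show ?thesis
    unfolding theta_def[abs_def] eta_eq_et phase'_def .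
qed

text \<open>A stretch of length \<open>2 * l\<close> of a plane wave is inserted at the peak of the soliton. This adds
  momentum \<open>p\<close> at the energetic cost \<open>c * p\<close>, so energy minus \<open>c\<close> times momentum does not change.\<close>

definition plateau_soliton :: "real \<Rightarrow> real \<Rightarrow> complex" where
  "plateau_soliton l x = complex_of_real (sqrt (1 - et (x - clamp_to l x))) *
     exp (\<i> * complex_of_real (phase (x - clamp_to l x) + phase' 0 * clamp_to l x))"

lemma dark_soliton_eq: "c > 0 \<Longrightarrow> dark_soliton c (- k) = plateau_soliton 0"
  by (rule ext) (simp add: dark_soliton_def plateau_soliton_def eta_eq_et clamp_to_def)

definition modulus' :: "real \<Rightarrow> real" where
  "modulus' x = W x * W' x / (2 * sqrt (1 - et x))"

lemma DERIV_modulus: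
  assumes "c > 0"
  shows "DERIV (\<lambda>x. sqrt (1 - et x)) x :> modulus' x"
  unfolding modulus'_def using one_minus_et_pos[OF assms, of x]
  by (auto intro!: derivative_eq_intros DERIV_et simp: field_simps)

definition plateau_deriv :: "real \<Rightarrow> real \<Rightarrow> complex" where
  "plateau_deriv l x = Complex (modulus' (x - clamp_to l x)) (sqrt (1 - et (x - clamp_to l x)) * phase' (x - clamp_to l x)) *
     exp (\<i> * complex_of_real (phase (x - clamp_to l x) + phase' 0 * clamp_to l x))"

lemma continuous_on_modulus':
  assumes "c > 0"
  shows "continuous_on A modulus'"
  unfolding modulus'_def[abs_def] using one_minus_et_pos[OF assms]
  by (intro continuous_intros) (auto simp: less_imp_neq[symmetric])

lemma plateau_has_derivative:
  assumes c: "c > 0" and l: "l \<ge> 0"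
  shows "(plateau_soliton l has_vector_derivative plateau_deriv l x) (at x)"
  unfolding plateau_soliton_def[abs_def] plateau_deriv_def
proof (rule polar_derivative)
  \<comment> \<open>At the peak the modulus is stationary because \<open>W 0 = 0\<close>, so it
    stays constant on the plateau; the phase is not stationary and continues with slope
    \<open>phase' 0\<close>.\<close>
  show "DERIV (\<lambda>x. sqrt (1 - et (x - clamp_to l x))) x :> modulus' (x - clamp_to l x)"
    by (rule DERIV_plateau_0[OF l DERIV_modulus[OF c]]) (simp add: modulus'_def W_0)
  show "DERIV (\<lambda>x. phase (x - clamp_to l x) + phase' 0 * clamp_to l x) x :> phase' (x - clamp_to l x)"
    by (rule DERIV_plateau[OF l DERIV_phase[OF c]])
qed

lemma primitive_plateau:
  assumes c: "c > 0" and l: "l \<ge> 0"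
  shows "primitive (plateau_soliton l) (plateau_deriv l)"
proof (rule primitive_vector_derivative[OF plateau_has_derivative[OF c l]])
  have cl: "continuous_on UNIV (clamp_to l)" unfolding clamp_to_def by (intro continuous_intros)
  have c1: "continuous_on UNIV (\<lambda>x. x - clamp_to l x)" by (intro continuous_intros cl)
  have cph: "continuous_on UNIV phase" using DERIV_phase[OF c] by (meson DERIV_isCont continuous_at_imp_continuous_on)
  have cC: "continuous_on UNIV (\<lambda>x. Complex (modulus' (x - clamp_to l x)) (sqrt (1 - et (x - clamp_to l x)) * phase' (x - clamp_to l x)))"
    unfolding Complex_eq
    by (intro continuous_intros c1 continuous_on_compose2[OF continuous_on_modulus'[OF c, of UNIV] c1]
        continuous_on_compose2[OF continuous_on_phase'[OF c, of UNIV] c1]) auto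
  show "continuous_on UNIV (plateau_deriv l)"
    unfolding plateau_deriv_def[abs_def] by (intro continuous_on_mult[OF cC] continuous_intros continuous_on_compose2[OF cph c1] cl) auto
qed

lemma norm_plateau: "c > 0 \<Longrightarrow> norm (plateau_soliton l x) = sqrt (1 - et (x - clamp_to l x))"
  unfolding plateau_soliton_def using one_minus_et_pos by (intro polar_values(1)) (auto simp: less_imp_le)

lemma modulus_ge: "sqrt (1 - et x) \<ge> c / sqrt 2"
proof -
  have "c\<^sup>2 / 2 \<le> 1 - et x" unfolding one_minus_et by simp
  then have "sqrt (c\<^sup>2 / 2) \<le> sqrt (1 - et x)" by (rule real_sqrt_le_mono)
  then show ?thesis using c0 by (simp add: real_sqrt_divide)
qed

text \<open>Equipartition: along the profile the kinetic and the potential part of the energy density agree.\<close>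

lemma profile_virial: "(W x * W' x)\<^sup>2 / (8 * (1 - et x)) + c\<^sup>2 * (et x)\<^sup>2 / (8 * (1 - et x)) + k / 4 * (W x * W' x)\<^sup>2 = (et x)\<^sup>2 / 4"
  if "c > 0"
proof -
  define z s e where "z = c\<^sup>2 + (W x)\<^sup>2" and "s = S (W x)" and "e = et x"
  have z: "z > 0" unfolding z_def using that by (intro add_pos_nonneg) auto
  have s: "s > 0" using S_pos by (simp add: s_def)
  have s2: "s\<^sup>2 = 1 + k * z" unfolding s_def z_def by (rule S_sq')
  have "(W x * W' x)\<^sup>2 = (W x)\<^sup>2 * e\<^sup>2 / s\<^sup>2" unfolding W'_eq e_def s_def by (simp add: power_mult_distrib power_divide)
  note A = this
  have B: "1 - et x = z / 2" unfolding one_minus_et z_def ..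
  have "(W x * W' x)\<^sup>2 / (8 * (1 - et x)) + c\<^sup>2 * (et x)\<^sup>2 / (8 * (1 - et x)) + k / 4 * (W x * W' x)\<^sup>2
    = e\<^sup>2 / 4 * ((W x)\<^sup>2 * (1 + k * z) / (s\<^sup>2 * z) + c\<^sup>2 / z)"
    unfolding A B unfolding e_def[symmetric] using z s by (simp add: field_simps)
  also have "(W x)\<^sup>2 * (1 + k * z) / (s\<^sup>2 * z) + c\<^sup>2 / z = (c\<^sup>2 + (W x)\<^sup>2) / z"
    unfolding s2[symmetric] using z s by (simp add: add_divide_distrib)
  also have "\<dots> = 1" unfolding z_def[symmetric] using z by simp
  finally show ?thesis by (simp add: e_def)
qed

lemma plateau_soliton_props:
  assumes c: "c > 0" and l: "l \<ge> 0"
  shows "plateau_soliton l \<in> NX_space"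
    "energy (- k) (plateau_soliton l) = sol_energy k c + l * (et 0)\<^sup>2"
    "momentum (plateau_soliton l) = sol_momentum k c + l / c * (et 0)\<^sup>2"
proof -
  note p = primitive_plateau[OF c l]
  define y where "y x = x - clamp_to l x" for x
  have pos: "1 - et x > 0" for x by (rule one_minus_et_pos[OF c])
  have nu: "(norm (plateau_soliton l x))\<^sup>2 = 1 - et (y x)" for x
    unfolding norm_plateau[OF c] using pos[of "y x"] by (simp add: y_def)
  have nw: "(norm (plateau_deriv l x))\<^sup>2 = (modulus' (y x))\<^sup>2 + (1 - et (y x)) * (phase' (y x))\<^sup>2" for x
    unfolding plateau_deriv_def y_def[symmetric] using pos[of "y x"] by (subst polar_values(2)) auto
  have uw: "plateau_soliton l x \<bullet> plateau_deriv l x = sqrt (1 - et (y x)) * modulus' (y x)" for x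
    unfolding plateau_deriv_def plateau_soliton_def y_def[symmetric] using pos[of "y x"] by (subst polar_values(3)) auto
  have iw: "(\<i> * plateau_deriv l x) \<bullet> plateau_soliton l x = - ((1 - et (y x)) * phase' (y x))" for x
    unfolding plateau_deriv_def plateau_soliton_def y_def[symmetric] using pos[of "y x"] by (subst polar_values(4)) auto
  have m2: "(modulus' x)\<^sup>2 = (W x * W' x)\<^sup>2 / (4 * (1 - et x))" for x
    unfolding modulus'_def using pos[of x] by (simp add: power_divide power_mult_distrib)
  have dens: "1 / 2 * (norm (plateau_deriv l x))\<^sup>2 + 1 / 4 * (1 - (norm (plateau_soliton l x))\<^sup>2)\<^sup>2
     - - k / 4 * (2 * (plateau_soliton l x \<bullet> plateau_deriv l x))\<^sup>2 = (et (y x))\<^sup>2 / 2" for x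
  proof -
    define v e where "v = 1 - et (y x)" and "e = et (y x)"
    have v: "v > 0" using pos by (simp add: v_def)
    have 1: "(norm (plateau_deriv l x))\<^sup>2 = 2 * ((W (y x) * W' (y x))\<^sup>2 / (8 * v)) + 2 * (c\<^sup>2 * e\<^sup>2 / (8 * v))"
      unfolding nw m2 phase'_def unfolding v_def[symmetric] unfolding e_def[symmetric] using v by (simp add: power2_eq_square ac_simps)
    have 2: "(2 * (plateau_soliton l x \<bullet> plateau_deriv l x))\<^sup>2 = (W (y x) * W' (y x))\<^sup>2"
      unfolding uw power_mult_distrib m2 v_def[symmetric] using v by (simp add: power_mult_distrib)
    have 3: "1 - (norm (plateau_soliton l x))\<^sup>2 = e" unfolding nu e_def by simp
    have "(W (y x) * W' (y x))\<^sup>2 / (8 * v) + c\<^sup>2 * e\<^sup>2 / (8 * v) + k / 4 * (W (y x) * W' (y x))\<^sup>2 = e\<^sup>2 / 4"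
      unfolding v_def e_def by (rule profile_virial[OF c])
    then show ?thesis unfolding 1 2 3 e_def[symmetric] by argo
  qed
  note i = energy_density_plateau[OF l, folded y_def]
  have X: "plateau_soliton l \<in> X_space"
    by (rule X_space_energy(1)[OF p _ dens i(1)]) (use k0 in simp)
  moreover have "(INF x. norm (plateau_soliton l x)) \<ge> c / sqrt 2"
    by (rule cINF_greatest) (auto simp: norm_plateau[OF c] modulus_ge)
  moreover have "c / sqrt 2 > 0" using c by simp
  ultimately show "plateau_soliton l \<in> NX_space" unfolding NX_space_def by force
  show "energy (- k) (plateau_soliton l) = sol_energy k c + l * (et 0)\<^sup>2"
    unfolding i(2)[symmetric] by (rule X_space_energy(2)[OF p _ dens i(1)]) (use k0 in simp)
  have "1 / 2 * (((\<i> * plateau_deriv l x) \<bullet> plateau_soliton l x) * (1 - 1 / (norm (plateau_soliton l x))\<^sup>2))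
     = c / 4 * ((et (y x))\<^sup>2 / (1 - et (y x)))" for x
  proof -
    define v e where "v = 1 - et (y x)" and "e = et (y x)"
    have v: "v > 0" using pos by (simp add: v_def)
    have "1 / 2 * (- (v * (c / 2 * (e / v))) * (1 - 1 / v)) = c / 4 * (e * (1 - v) / v)"
      using v by (simp add: field_simps)
    also have "1 - v = e" by (simp add: v_def e_def)
    finally show ?thesis unfolding iw nu phase'_def unfolding v_def[symmetric] unfolding e_def[symmetric] by (simp add: power2_eq_square)
  qed
  then show "momentum (plateau_soliton l) = sol_momentum k c + l / c * (et 0)\<^sup>2"
    unfolding momentum_eq[OF p] momentum_density_plateau(2)[OF c l, folded y_def, symmetric]
    by (simp flip: integral_mult_right_zero)
qed

lemma dark_soliton_props:
  assumes c: "c > 0"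
  shows "dark_soliton c (- k) \<in> NX_space" "energy (- k) (dark_soliton c (- k)) = sol_energy k c"
    "momentum (dark_soliton c (- k)) = sol_momentum k c"
  using plateau_soliton_props[OF c, of 0] by (simp_all add: dark_soliton_eq[OF c])

lemma black_soliton_eq:
  assumes c: "c = 0"
  shows "dark_soliton c (- k) x = complex_of_real (W x / sqrt 2)"
proof -
  have "1 - et x = (W x)\<^sup>2 / 2" using one_minus_et[of x] c by simp
  then have "sqrt (1 - et x) = \<bar>W x\<bar> / sqrt 2" by (simp only: real_sqrt_divide real_sqrt_abs)
  moreover have "\<bar>W x\<bar> = (if 0 \<le> x then 1 else - 1) * W x"
    using W_strict_mono[of 0 x] W_strict_mono[of x 0] W_0 by (cases "x = 0") auto
  ultimately show ?thesis using eta_eq_et[of x] by (auto simp: dark_soliton_def c)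
qed

text \<open>The polar representation breaks down at the zero of the black soliton, where the modulus
  has a corner; the energy is computed instead from the smooth real-valued form
  \<open>W x / sqrt 2\<close>.\<close>

lemma black_soliton_props:
  assumes c: "c = 0"
  shows "dark_soliton 0 (- k) \<in> X_space" "energy (- k) (dark_soliton 0 (- k)) = sol_energy k 0"
    "dark_soliton 0 (- k) 0 = 0"
proof -
  have eq: "dark_soliton 0 (- k) = (\<lambda>x. complex_of_real (W x / sqrt 2))"
    using black_soliton_eq[OF c] c by auto
  have "DERIV (\<lambda>x. W x / sqrt 2) x :> W' x / sqrt 2" for x by (rule DERIV_cdivide[OF DERIV_W])
  then have p: "primitive (dark_soliton 0 (- k)) (\<lambda>x. complex_of_real (W' x / sqrt 2))"
    unfolding eq
    by (intro primitive_vector_derivative has_vector_derivative_of_real continuous_intros)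
       (auto simp: has_real_derivative_iff_has_vector_derivative[symmetric])
  have dens: "1 / 2 * (norm (complex_of_real (W' x / sqrt 2)))\<^sup>2 + 1 / 4 * (1 - (norm (dark_soliton 0 (- k) x))\<^sup>2)\<^sup>2
     - - k / 4 * (2 * (dark_soliton 0 (- k) x \<bullet> complex_of_real (W' x / sqrt 2)))\<^sup>2 = (et (x - clamp_to 0 x))\<^sup>2 / 2" for x
  proof -
    have 1: "(norm (complex_of_real (W' x / sqrt 2)))\<^sup>2 = (W' x)\<^sup>2 / 2" by (simp add: power_divide norm_divide)
    have 2: "1 - (norm (dark_soliton 0 (- k) x))\<^sup>2 = et x"
      unfolding eq using one_minus_et[of x] c by (simp add: power_divide norm_divide)
    have 3: "2 * (dark_soliton 0 (- k) x \<bullet> complex_of_real (W' x / sqrt 2)) = W x * W' x"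
      unfolding eq by (simp add: inner_complex_def)
    have s: "(S (W x))\<^sup>2 = 1 + k * (W x)\<^sup>2" using S_sq'[of "W x"] by (simp add: c)
    have "(W' x)\<^sup>2 * (S (W x))\<^sup>2 = (et x)\<^sup>2" unfolding W'_eq using S_pos[of "W x"] by (simp add: power_divide)
    then have "(W' x)\<^sup>2 + k * (W x * W' x)\<^sup>2 = (et x)\<^sup>2"
      unfolding s by (simp add: algebra_simps power_mult_distrib)
    then show ?thesis unfolding 1 2 3 by (simp add: clamp_to_def field_simps)
  qed
  note i = energy_density_plateau[of 0, simplified]
  show "dark_soliton 0 (- k) \<in> X_space"
    by (rule X_space_energy(1)[OF p _ dens]) (use k0 energy_density_plateau(1)[of 0] in auto)
  have "energy (- k) (dark_soliton 0 (- k)) = (LINT x|lborel. (et (x - clamp_to 0 x))\<^sup>2 / 2)"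
    by (rule X_space_energy(2)[OF p _ dens]) (use k0 energy_density_plateau(1)[of 0] in auto)
  also have "\<dots> = sol_energy k 0" by (subst energy_density_plateau(2)) (auto simp: c)
  finally show "energy (- k) (dark_soliton 0 (- k)) = sol_energy k 0" .
  show "dark_soliton 0 (- k) 0 = 0" unfolding eq by (simp add: W_0)
qed

end

subsection \<open>Lower bounds for the energy\<close>

lemma primitive_at_top:
  fixes v :: "real \<Rightarrow> real"
  assumes p: "primitive v g" and i: "integrable lborel g"
  shows "(v \<longlongrightarrow> v a + (LINT x:{a..}|lborel. g x)) at_top"
proof (rule Lim_transform_eventually)
  have "set_integrable lborel {a..} g"
    unfolding set_integrable_def by (rule integrable_mult_indicator[OF _ i]) simp
  then have "((\<lambda>y. LINT x:{a..y}|lborel. g x) \<longlongrightarrow> (LINT x:{a..}|lborel. g x)) at_top"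
    by (intro tendsto_set_lebesgue_integral_at_top) auto
  then show "((\<lambda>y. v a + (LINT x:{a..y}|lborel. g x)) \<longlongrightarrow> v a + (LINT x:{a..}|lborel. g x)) at_top"
    by (intro tendsto_add tendsto_const)
  show "\<forall>\<^sub>F y in at_top. v a + (LINT x:{a..y}|lborel. g x) = v y"
    using eventually_ge_at_top[of a] by eventually_elim (simp add: primitiveD(2)[OF p, symmetric])
qed

lemma primitive_at_bot:
  fixes v :: "real \<Rightarrow> real"
  assumes p: "primitive v g" and i: "integrable lborel g"
  shows "(v \<longlongrightarrow> v a - (LINT x:{..a}|lborel. g x)) at_bot"
proof (rule Lim_transform_eventually)
  have "set_integrable lborel {..a} g"
    unfolding set_integrable_def by (rule integrable_mult_indicator[OF _ i]) simp
  then have "((\<lambda>y. LINT x:{y..a}|lborel. g x) \<longlongrightarrow> (LINT x:{..a}|lborel. g x)) at_bot"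
    by (intro tendsto_set_lebesgue_integral_at_bot) auto
  then show "((\<lambda>y. v a - (LINT x:{y..a}|lborel. g x)) \<longlongrightarrow> v a - (LINT x:{..a}|lborel. g x)) at_bot"
    by (intro tendsto_diff tendsto_const)
  show "\<forall>\<^sub>F y in at_bot. v a - (LINT x:{y..a}|lborel. g x) = v y"
    using eventually_le_at_bot[of a] by eventually_elim (simp add: primitiveD(2)[OF p, symmetric])
qed

text \<open>The sign counts the rise from \<open>L\<close> to \<open>v x0\<close> and the fall back
  to \<open>L\<close> both as positive. It will be applied to an antiderivative of the Modica
  integrand evaluated along eta, with \<open>x0\<close> the peak.\<close>

lemma primitive_peak_integral:
  fixes v :: "real \<Rightarrow> real"
  assumes p: "primitive v g" and i: "integrable lborel g"
    and l: "(v \<longlongrightarrow> L) at_top" "(v \<longlongrightarrow> L) at_bot"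
  shows "integrable lborel (\<lambda>x. sgn (x0 - x) * g x)" "(LINT x|lborel. sgn (x0 - x) * g x) = 2 * (v x0 - L)"
proof -
  have i1: "integrable lborel (\<lambda>x. indicator {..x0} x *\<^sub>R g x)" "integrable lborel (\<lambda>x. indicator {x0..} x *\<^sub>R g x)"
    by (rule integrable_mult_indicator[OF _ i], simp)+
  have r: "(LINT x:{x0..}|lborel. g x) = L - v x0"
    using tendsto_unique[OF _ primitive_at_top[OF p i, of x0] l(1)] by simp
  have lf: "(LINT x:{..x0}|lborel. g x) = v x0 - L"
    using tendsto_unique[OF _ primitive_at_bot[OF p i, of x0] l(2)] by simp
  have ae: "AE x in lborel. sgn (x0 - x) * g x = indicator {..x0} x *\<^sub>R g x - indicator {x0..} x *\<^sub>R g x"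
    using AE_lborel_singleton[of x0] by eventually_elim (auto simp: sgn_if indicator_def)
  have [measurable]: "g \<in> borel_measurable borel" using i by simp
  show "integrable lborel (\<lambda>x. sgn (x0 - x) * g x)"
    by (rule integrable_cong_AE[THEN iffD2, OF _ _ ae Bochner_Integration.integrable_diff[OF i1]]) auto
  have "(LINT x|lborel. sgn (x0 - x) * g x) = (LINT x|lborel. indicator {..x0} x *\<^sub>R g x - indicator {x0..} x *\<^sub>R g x)"
    by (rule integral_cong_AE[OF _ _ ae]) auto
  also have "\<dots> = (v x0 - L) - (L - v x0)"
    unfolding Bochner_Integration.integral_diff[OF i1] using r lf by (simp add: set_lebesgue_integral_def)
  finally show "(LINT x|lborel. sgn (x0 - x) * g x) = 2 * (v x0 - L)" by simp
qed

lemma limit_0_if_integrable_at_top: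
  fixes f :: "real \<Rightarrow> real"
  assumes i: "integrable lborel f" and nn: "\<And>x. f x \<ge> 0" and l: "(f \<longlongrightarrow> L) at_top"
  shows "L = 0"
proof (rule ccontr)
  assume "L \<noteq> 0"
  moreover have "L \<ge> 0" by (rule tendsto_lowerbound[OF l]) (auto simp: nn)
  ultimately have L: "L > 0" by simp
  then have "\<forall>\<^sub>F x in at_top. f x > L / 2" by (intro order_tendstoD(1)[OF l]) auto
  then obtain N where N: "\<And>x. x \<ge> N \<Longrightarrow> f x > L / 2" unfolding eventually_at_top_linorder by blast
  have "real n * (L / 2) \<le> (LINT x|lborel. f x)" for n :: nat
  proof -
    have "(LINT x|lborel. indicator {N..N + real n} x *\<^sub>R (L / 2)) \<le> (LINT x|lborel. f x)"
    proof (rule integral_mono)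
      show "integrable lborel (\<lambda>x. indicator {N..N + real n} x *\<^sub>R (L / 2))"
        using borel_integrable_atLeastAtMost'[of N "N + real n" "\<lambda>_. L/2"] by (simp add: set_integrable_def)
      show "indicator {N..N + real n} x *\<^sub>R (L / 2) \<le> f x" for x
        using N[of x] nn[of x] by (auto simp: indicator_def)
    qed (rule i)
    then show ?thesis by simp
  qed
  moreover obtain n :: nat where "real n > (LINT x|lborel. f x) / (L / 2)" using reals_Archimedean2 by blast
  then have "real n * (L / 2) > (LINT x|lborel. f x)" using L by (simp add: field_simps)
  ultimately show False by (metis not_le)
qed

text \<open>Pythagoras for the components of \<open>w\<close> along \<open>u\<close> and along
  \<open>\<i> * u\<close>, that is, the radial and the angular part of the derivative.\<close>

lemma complex_norm_split:
  fixes u w :: complex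
  shows "(norm u)\<^sup>2 * (norm w)\<^sup>2 = (u \<bullet> w)\<^sup>2 + ((\<i> * w) \<bullet> u)\<^sup>2"
  unfolding cmod_power2 inner_complex_def by (simp add: algebra_simps power2_eq_square)

section \<open>Decay and integrability for functions of finite energy\<close>

locale finite_energy =
  fixes u :: "real \<Rightarrow> complex"
  assumes uX: "u \<in> X_space"
begin

definition w :: "real \<Rightarrow> complex" where "w = weak_deriv u"
definition h :: "real \<Rightarrow> real" where "h x = 1 - (norm (u x))\<^sup>2"
definition h' :: "real \<Rightarrow> real" where "h' x = - (2 * (u x \<bullet> w x))"
text \<open>For u = r exp(i theta) this is - r^2 theta'; the sign is the one of the momentum
  density.\<close>

definition J :: "real \<Rightarrow> real" where "J x = (\<i> * w x) \<bullet> u x"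

lemma prim_u: "primitive u w" and int_w: "integrable lborel (\<lambda>x. (norm (w x))\<^sup>2)"
  and int_h: "integrable lborel (\<lambda>x. (h x)\<^sup>2)"
  using X_spaceD[OF uX] by (auto simp: w_def h_def)

lemma prim_h: "primitive h h'"
proof -
  let ?g = "\<lambda>x. 2 * (u x \<bullet> w x)"
  note p = norm_sq_primitive[OF prim_u]
  note l = primitiveD(1)[OF p]
  have "locally_integrable h'"
    using locally_integrable_bounded_linear[OF bounded_linear_minus[OF bounded_linear_ident] l]
    by (simp add: h'_def[abs_def])
  moreover have "(LINT x:{a..b}|lborel. h' x) = - (LINT x:{a..b}|lborel. ?g x)" for a b
    unfolding h'_def by (rule set_integral_uminus[OF locally_integrableD[OF l]])
  moreover have "h b - h a = - (LINT x:{a..b}|lborel. ?g x)" if "a \<le> b" for a b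
    unfolding primitiveD(2)[OF p that, symmetric] h_def by simp
  ultimately show ?thesis unfolding primitive_def by simp
qed

lemma cont_u: "continuous_on A u" and cont_h: "continuous_on A h"
  using primitive_continuous[OF prim_u] primitive_continuous[OF prim_h] continuous_on_subset by blast+

lemma meas [measurable]: "u \<in> borel_measurable borel" "w \<in> borel_measurable borel"
  "h \<in> borel_measurable borel" "h' \<in> borel_measurable borel" "J \<in> borel_measurable borel"
proof -
  show [measurable]: "w \<in> borel_measurable borel" "h' \<in> borel_measurable borel"
    using locally_integrable_measurable primitiveD(1) prim_u prim_h by fastforce+
  show [measurable]: "u \<in> borel_measurable borel" "h \<in> borel_measurable borel"
    by (rule borel_measurable_continuous_onI[OF cont_u] borel_measurable_continuous_onI[OF cont_h])+
  show "J \<in> borel_measurable borel" unfolding J_def[abs_def] by measurable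
qed

lemma norm_sq_u: "(norm (u x))\<^sup>2 = 1 - h x" by (simp add: h_def)

lemma kinetic_split: "(1 - h x) * (norm (w x))\<^sup>2 = (h' x)\<^sup>2 / 4 + (J x)\<^sup>2"
  using complex_norm_split[of "u x" "w x"] unfolding norm_sq_u by (simp add: h'_def J_def power_mult_distrib)

lemma h'_sq_le: "(h' x)\<^sup>2 \<le> 4 * (1 - h x) * (norm (w x))\<^sup>2"
  using kinetic_split[of x] zero_le_power2[of "J x"] unfolding mult.assoc by linarith

lemma abs_h'_le: "\<bar>h' x\<bar> \<le> 2 * norm (u x) * norm (w x)"
  unfolding h'_def using Cauchy_Schwarz_ineq2[of "u x" "w x"] by (simp add: abs_mult)

text \<open>The derivative of \<open>h\<close> carries a factor \<open>norm (u x)\<close> that is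
  not yet known to be bounded. The logarithm damps it: the derivative of ln(1 + h^2) / 2 is
  dominated by h^2 + |u'|^2, hence integrable. So this logarithm has limits at both ends, and with
  it h^2, whose limits are 0 because h^2 is integrable.\<close>

lemma h_limits: "(h \<longlongrightarrow> 0) at_top" "(h \<longlongrightarrow> 0) at_bot"
proof -
  define \<Phi> where "\<Phi> s = ln (1 + s\<^sup>2) / 2" for s :: real
  define \<phi> where "\<phi> s = s / (1 + s\<^sup>2)" for s :: real
  have p1: "1 + s\<^sup>2 > 0" for s :: real by (intro add_pos_nonneg) auto
  have d: "DERIV \<Phi> s :> \<phi> s" for s
    unfolding \<Phi>_def[abs_def] \<phi>_def using p1[of s] by (auto intro!: derivative_eq_intros simp: field_simps)
  have "continuous_on UNIV \<phi>" unfolding \<phi>_def[abs_def] using p1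
    by (intro continuous_intros) (auto simp: less_imp_neq[symmetric])
  note p = primitive_chain[OF prim_h d this]
  have i: "integrable lborel (\<lambda>x. \<phi> (h x) * h' x)"
  proof (rule Bochner_Integration.integrable_bound)
    show "integrable lborel (\<lambda>x. 2 * ((h x)\<^sup>2 + (norm (w x))\<^sup>2))" using int_h int_w by simp
    show "(\<lambda>x. \<phi> (h x) * h' x) \<in> borel_measurable lborel" unfolding \<phi>_def by measurable
    show "AE x in lborel. norm (\<phi> (h x) * h' x) \<le> norm (2 * ((h x)\<^sup>2 + (norm (w x))\<^sup>2))"
    proof (rule AE_I2)
      fix x
      have "norm (u x) \<le> 2 * (1 + (h x)\<^sup>2)"
      proof (rule power2_le_imp_le)
        have "(norm (u x))\<^sup>2 = 1 - h x" by (rule norm_sq_u)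
        also have "\<dots> \<le> 2 * (1 + (h x)\<^sup>2)" 
        proof -
          have "0 \<le> (h x)\<^sup>2 + 1 + 2 * h x" using zero_le_power2[of "h x + 1"] unfolding power2_sum by simp
          then show ?thesis using zero_le_power2[of "h x"] by argo
        qed
        also have "\<dots> \<le> (2 * (1 + (h x)\<^sup>2))\<^sup>2" unfolding power2_eq_square[of "2 * (1 + (h x)\<^sup>2)"]
          by (rule mult_left_le_imp_le[of 1, simplified] order_trans[OF _ mult_right_mono[of 1]]) auto
        finally show "(norm (u x))\<^sup>2 \<le> (2 * (1 + (h x)\<^sup>2))\<^sup>2" .
      qed auto
      then have "\<bar>h' x\<bar> \<le> 2 * (2 * (1 + (h x)\<^sup>2)) * norm (w x)"
        using order_trans[OF abs_h'_le[of x]] by (simp add: mult_right_mono)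
      then have "\<bar>h x\<bar> / (1 + (h x)\<^sup>2) * \<bar>h' x\<bar> \<le> \<bar>h x\<bar> / (1 + (h x)\<^sup>2) * (2 * (2 * (1 + (h x)\<^sup>2)) * norm (w x))"
        using p1[of "h x"] by (intro mult_left_mono) auto
      also have "p / q * (2 * (2 * q) * r) = 2 * (2 * p * r)" if "q > 0" for p q r :: real
        using that by simp
      note this[OF p1]
      also have "2 * \<bar>h x\<bar> * norm (w x) \<le> (h x)\<^sup>2 + (norm (w x))\<^sup>2"
        using zero_le_power2[of "\<bar>h x\<bar> - norm (w x)"] unfolding power2_diff by simp
      finally show "norm (\<phi> (h x) * h' x) \<le> norm (2 * ((h x)\<^sup>2 + (norm (w x))\<^sup>2))"
        using p1[of "h x"] by (simp add: \<phi>_def abs_mult abs_divide)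
    qed
  qed
  have sq: "(h x)\<^sup>2 = exp (2 * \<Phi> (h x)) - 1" for x using p1[of "h x"] by (simp add: \<Phi>_def)
  obtain L where L: "((\<lambda>x. \<Phi> (h x)) \<longlongrightarrow> L) at_top" using primitive_at_top[OF p i] by blast
  obtain L' where L': "((\<lambda>x. \<Phi> (h x)) \<longlongrightarrow> L') at_bot" using primitive_at_bot[OF p i] by blast
  have t: "((\<lambda>x. (h x)\<^sup>2) \<longlongrightarrow> exp (2 * L) - 1) at_top" unfolding sq by (intro tendsto_intros L)
  have t': "((\<lambda>x. (h x)\<^sup>2) \<longlongrightarrow> exp (2 * L') - 1) at_bot" unfolding sq by (intro tendsto_intros L')
  have "exp (2 * L) - 1 = 0" by (rule limit_0_if_integrable_at_top[OF int_h _ t]) simp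
  then have "((\<lambda>x. sqrt ((h x)\<^sup>2)) \<longlongrightarrow> sqrt 0) at_top" using t by (intro tendsto_real_sqrt) simp
  then show "(h \<longlongrightarrow> 0) at_top" by (simp add: tendsto_rabs_zero_iff)
  have "integrable lborel (\<lambda>x. (h (0 + (-1) * x))\<^sup>2)"
    by (rule lborel_integrable_real_affine[OF int_h]) simp
  then have i': "integrable lborel (\<lambda>x. (h (- x))\<^sup>2)" by simp
  have "((\<lambda>x. (h (- x))\<^sup>2) \<longlongrightarrow> exp (2 * L') - 1) at_top" using t' by (simp add: filterlim_at_bot_mirror)
  then have "exp (2 * L') - 1 = 0" by (intro limit_0_if_integrable_at_top[OF i']) auto
  then have "((\<lambda>x. sqrt ((h x)\<^sup>2)) \<longlongrightarrow> sqrt 0) at_bot" using t' by (intro tendsto_real_sqrt) simp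
  then show "(h \<longlongrightarrow> 0) at_bot" by (simp add: tendsto_rabs_zero_iff)
qed

lemma h_small_outside:
  assumes "e > 0"
  obtains N where "N > 0" "\<And>x. \<bar>x\<bar> \<ge> N \<Longrightarrow> \<bar>h x\<bar> < e"
proof -
  have "\<forall>\<^sub>F x in at_top. \<bar>h x\<bar> < e" "\<forall>\<^sub>F x in at_bot. \<bar>h x\<bar> < e"
    using h_limits[THEN tendstoD, OF assms] by (simp_all add: dist_real_def)
  then obtain N1 N2 where "\<And>x. x \<ge> N1 \<Longrightarrow> \<bar>h x\<bar> < e" "\<And>x. x \<le> N2 \<Longrightarrow> \<bar>h x\<bar> < e"
    unfolding eventually_at_top_linorder eventually_at_bot_linorder by blast
  note N = this
  have "\<bar>h x\<bar> < e" if "\<bar>x\<bar> \<ge> max 1 (max N1 (- N2))" for x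
    using N(1)[of x] N(2)[of x] that by (cases "x \<ge> 0") auto
  then show ?thesis by (intro that[of "max 1 (max N1 (- N2))"]) auto
qed

lemma h_bounded: obtains B where "B > 0" "\<And>x. \<bar>h x\<bar> \<le> B"
proof -
  obtain N where N: "N > 0" "\<And>x. \<bar>x\<bar> \<ge> N \<Longrightarrow> \<bar>h x\<bar> < 1" using h_small_outside[of 1] by auto
  have "bounded (h ` {-N..N})" by (intro compact_imp_bounded compact_continuous_image cont_h) auto
  then obtain B where B: "\<And>x. x \<in> {-N..N} \<Longrightarrow> \<bar>h x\<bar> \<le> B" unfolding bounded_iff by (metis imageI real_norm_def)
  have "\<bar>h x\<bar> \<le> max 1 B" for x
    using B[of x] N(2)[of x] by (cases "\<bar>x\<bar> \<ge> N") (auto simp: abs_if le_max_iff_disj split: if_splits)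
  then show ?thesis by (intro that[of "max 1 B"]) auto
qed

lemma int_h': "integrable lborel (\<lambda>x. (h' x)\<^sup>2)"
proof -
  obtain B where B: "B > 0" "\<And>x. \<bar>h x\<bar> \<le> B" using h_bounded by blast
  show ?thesis
  proof (rule Bochner_Integration.integrable_bound)
    show "integrable lborel (\<lambda>x. 4 * (1 + B) * (norm (w x))\<^sup>2)" using int_w by simp
    show "AE x in lborel. norm ((h' x)\<^sup>2) \<le> norm (4 * (1 + B) * (norm (w x))\<^sup>2)"
    proof (rule AE_I2)
      fix x
      have "(h' x)\<^sup>2 \<le> 4 * (1 - h x) * (norm (w x))\<^sup>2" by (rule h'_sq_le)
      also have "\<dots> \<le> 4 * (1 + B) * (norm (w x))\<^sup>2"
        using B(2)[of x] by (intro mult_right_mono mult_left_mono) (auto simp: abs_le_iff)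
      finally show "norm ((h' x)\<^sup>2) \<le> norm (4 * (1 + B) * (norm (w x))\<^sup>2)" using B by simp
    qed
  qed measurable
qed

definition dens :: "real \<Rightarrow> real \<Rightarrow> real" where
  "dens k x = 1 / 2 * (norm (w x))\<^sup>2 + 1 / 4 * (h x)\<^sup>2 + k / 4 * (h' x)\<^sup>2"

lemma int_dens: "integrable lborel (dens k)"
  unfolding dens_def[abs_def] using int_w int_h int_h' by simp

lemma energy_dens: "energy (- k) u = (LINT x|lborel. dens k x)"
  unfolding energy_eq[OF prim_u] dens_def[abs_def] using int_w int_h int_h'
  by (simp add: h_def[symmetric] h'_def)

lemma dens_nonneg: "k \<ge> 0 \<Longrightarrow> dens k x \<ge> 0"
  by (simp add: dens_def)

definition mdens :: "real \<Rightarrow> real" where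
  "mdens x = 1 / 2 * (J x * (1 - 1 / (1 - h x)))"

lemma momentum_mdens: "momentum u = (LINT x|lborel. mdens x)"
  unfolding momentum_eq[OF prim_u] mdens_def J_def norm_sq_u by simp

lemma int_mdens:
  assumes "u \<in> NX_space"
  shows "integrable lborel mdens"
proof -
  define d where "d = (INF x. norm (u x))"
  have d: "d > 0" using assms by (simp add: NX_space_def d_def)
  have du: "d \<le> norm (u x)" for x unfolding d_def by (rule cINF_lower[OF bdd_belowI2[of _ 0]]) auto
  show ?thesis
  proof (rule Bochner_Integration.integrable_bound)
    show "integrable lborel (\<lambda>x. ((h x)\<^sup>2 + (norm (w x))\<^sup>2) / d)" using int_h int_w by simp
    show "mdens \<in> borel_measurable lborel" unfolding mdens_def[abs_def] by measurable
    show "AE x in lborel. norm (mdens x) \<le> norm (((h x)\<^sup>2 + (norm (w x))\<^sup>2) / d)"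
    proof (rule AE_I2)
      fix x
      define r where "r = norm (u x)"
      have r: "r > 0" "d \<le> r" "1 - h x = r\<^sup>2" using du[of x] d norm_sq_u[of x] by (auto simp: r_def)
      have j: "\<bar>J x\<bar> \<le> r * norm (w x)" unfolding J_def r_def using Cauchy_Schwarz_ineq2[of "\<i> * w x" "u x"]
        by (simp add: norm_mult mult.commute)
      have "h x = 1 - r\<^sup>2" using r(3) by simp
      have "1 - 1 / r\<^sup>2 = - (1 - r\<^sup>2) / r\<^sup>2" using r(1) by (simp add: field_simps)
      then have "1 - 1 / (1 - h x) = - h x / r\<^sup>2" unfolding r(3) unfolding \<open>h x = 1 - r\<^sup>2\<close> .
      then have "\<bar>mdens x\<bar> = \<bar>J x\<bar> * \<bar>h x\<bar> / (2 * r\<^sup>2)" using r by (simp add: mdens_def abs_mult abs_divide)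
      also have "\<dots> \<le> (r * norm (w x)) * \<bar>h x\<bar> / (2 * r\<^sup>2)" using j by (intro divide_right_mono mult_right_mono) auto
      also have "\<dots> = (\<bar>h x\<bar> * norm (w x) / 2) / r" using r by (simp add: power2_eq_square)
      also have "\<dots> \<le> (\<bar>h x\<bar> * norm (w x) / 2) / d" using r d by (intro divide_left_mono) auto
      also have "\<dots> \<le> ((h x)\<^sup>2 + (norm (w x))\<^sup>2) / d"
      proof (rule divide_right_mono)
        have "2 * \<bar>h x\<bar> * norm (w x) \<le> (h x)\<^sup>2 + (norm (w x))\<^sup>2"
          using zero_le_power2[of "\<bar>h x\<bar> - norm (w x)"] unfolding power2_diff by simp
        moreover have "0 \<le> \<bar>h x\<bar> * norm (w x)" by simp
        ultimately show "\<bar>h x\<bar> * norm (w x) / 2 \<le> (h x)\<^sup>2 + (norm (w x))\<^sup>2" by linarith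
      qed (use d in auto)
      finally show "norm (mdens x) \<le> norm (((h x)\<^sup>2 + (norm (w x))\<^sup>2) / d)" using d by simp
    qed
  qed
qed

lemma h_max_attained:
  assumes "h y > 0"
  obtains x0 where "h x0 > 0" "\<And>x. h x \<le> h x0"
proof -
  obtain N where N: "N > 0" "\<And>x. \<bar>x\<bar> \<ge> N \<Longrightarrow> \<bar>h x\<bar> < h y" using h_small_outside[OF assms] by blast
  have "\<not> \<bar>y\<bar> \<ge> N" using N(2)[of y] assms by auto
  then have y: "y \<in> {-N..N}" by (auto simp: abs_less_iff not_le)
  obtain x0 where x0: "x0 \<in> {-N..N}" "\<And>x. x \<in> {-N..N} \<Longrightarrow> h x \<le> h x0"
    using continuous_attains_sup[of "{-N..N}" h] y cont_h by (metis compact_Icc empty_iff)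
  have "h x \<le> h x0" for x
    using x0(2)[of x] x0(2)[OF y] N(2)[of x] by (cases "\<bar>x\<bar> \<ge> N") (auto simp: abs_if split: if_splits)
  then show ?thesis using that[of x0] x0(2)[OF y] assms by auto
qed

end

section \<open>The Modica inequality and the action\<close>

lemma ex_antiderivative:
  fixes f :: "real \<Rightarrow> real"
  assumes "continuous_on UNIV f"
  obtains F where "\<And>x. DERIV F x :> f x"
proof -
  have "DERIV (\<lambda>u. LBINT y=ereal 0..ereal u. f y) x :> f x" for x
  proof -
    define A B where "A = min 0 x - 1" and "B = max 0 x + 1"
    have "((\<lambda>u. LBINT y=0..u. f y) has_vector_derivative f x) (at x within {A..B})"
      unfolding zero_ereal_def
      by (rule interval_integral_FTC2) (auto simp: A_def B_def intro: continuous_on_subset[OF assms])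
    moreover have "at x within {A..B} = at x" by (rule at_within_Icc_at) (auto simp: A_def B_def)
    ultimately show ?thesis by (simp add: has_real_derivative_iff_has_vector_derivative zero_ereal_def)
  qed
  then show ?thesis by (rule that)
qed

text \<open>The weights of the Modica-type inequality
  \<open>A \<eta>'\<^sup>2 + B \<eta>\<^sup>2 \<ge> 2 \<bar>\<eta>\<bar> \<bar>\<eta>'\<bar> sqrt (A B)\<close>, truncated at the maximal amplitude \<open>1 - c\<^sup>2 / 2\<close>, where \<open>B\<close> vanishes.\<close>

definition trunc :: "real \<Rightarrow> real \<Rightarrow> real" where
  "trunc c s = max (1 - s) (c\<^sup>2 / 2)"

definition wA :: "real \<Rightarrow> real \<Rightarrow> real \<Rightarrow> real" where
  "wA k c s = 1 / trunc c s + 2 * k"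

definition wB :: "real \<Rightarrow> real \<Rightarrow> real" where
  "wB c s = 2 - c\<^sup>2 / trunc c s"

definition modica :: "real \<Rightarrow> real \<Rightarrow> real \<Rightarrow> real" where
  "modica k c s = s * sqrt (wA k c s) * sqrt (wB c s) / 4"

lemma trunc_pos: "c > 0 \<Longrightarrow> trunc c s > 0"
  by (simp add: trunc_def less_max_iff_disj)

lemma wA_pos: "c > 0 \<Longrightarrow> k \<ge> 0 \<Longrightarrow> wA k c s > 0"
  unfolding wA_def using trunc_pos by (intro add_pos_nonneg) auto

lemma wB_range:
  assumes "c > 0"
  shows "0 \<le> wB c s" "wB c s \<le> 2"
proof -
  have "c\<^sup>2 / 2 \<le> trunc c s" by (simp add: trunc_def)
  then show "0 \<le> wB c s" using trunc_pos[OF assms, of s] by (simp add: wB_def field_simps)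
  show "wB c s \<le> 2" using trunc_pos[OF assms, of s] by (simp add: wB_def)
qed

lemma continuous_on_modica:
  assumes "c > 0"
  shows "continuous_on A (modica k c)"
proof -
  have "continuous_on A (trunc c)" unfolding trunc_def[abs_def] by (intro continuous_intros)
  then show ?thesis unfolding modica_def[abs_def] wA_def wB_def
    using trunc_pos[OF assms] by (intro continuous_intros) (auto simp: less_imp_neq[symmetric])
qed

lemma modica_truncated: "c > 0 \<Longrightarrow> s \<ge> 1 - c\<^sup>2 / 2 \<Longrightarrow> modica k c s = 0"
  by (simp add: modica_def wB_def trunc_def max_def)

text \<open>The sign \<open>\<sigma>\<close> will be \<open>sgn (x0 - x)\<close>: the optimal slope
  of eta is positive before the peak and negative after it.\<close>

lemma modica_square:
  assumes "c > 0" "k \<ge> 0" "\<sigma>\<^sup>2 = 1"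
  shows "1 / 8 * (wA k c s * v\<^sup>2 + wB c s * s\<^sup>2) - \<sigma> * (modica k c s * v)
    = 1 / 8 * (sqrt (wA k c s) * v - \<sigma> * sqrt (wB c s) * s)\<^sup>2"
proof -
  define A B where "A = sqrt (wA k c s)" and "B = sqrt (wB c s)"
  have A: "wA k c s = A\<^sup>2" using wA_pos[OF assms(1,2), of s] by (simp add: A_def)
  have B: "wB c s = B\<^sup>2" using wB_range[OF assms(1), of s] by (simp add: B_def)
  have "1 / 8 * (A\<^sup>2 * v\<^sup>2 + \<sigma>\<^sup>2 * (B\<^sup>2 * s\<^sup>2)) - \<sigma> * (s * A * B / 4 * v) = 1 / 8 * (A * v - \<sigma> * B * s)\<^sup>2"
    by (simp add: power2_eq_square algebra_simps)
  then show ?thesis unfolding modica_def A_def[symmetric] B_def[symmetric] unfolding A B assms(3) mult_1_left .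
qed

text \<open>Substituting s = (b^2 - w^2) / 2 turns the Modica integrand into minus the action
  density in \<open>w\<close>. Integration from w = 0 (the peak) to w = b (infinity) gives half of
  the action, so the soliton realizes equality in the Modica inequality.\<close>

lemma (in soliton_profile) modica_antiderivative:
  assumes c: "c > 0" and \<Phi>: "\<And>s. DERIV \<Phi> s :> modica k c s"
  shows "2 * (\<Phi> (1 - c\<^sup>2 / 2) - \<Phi> 0) = sol_action k c"
proof -
  define T where "T w = en_prim k c w - c * mom_prim k c w" for w
  define s where "s w = (b\<^sup>2 - w\<^sup>2) / 2" for w
  have ds: "DERIV s w :> - w" for w unfolding s_def[abs_def] by (auto intro!: derivative_eq_intros)
  have dT: "DERIV T w :> s w * w\<^sup>2 / (2 * (c\<^sup>2 + w\<^sup>2)) * S w" for w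
  proof -
    have z: "c\<^sup>2 + w\<^sup>2 > 0" using c by (intro add_pos_nonneg) auto
    have "DERIV T w :> (2 - c\<^sup>2 - w\<^sup>2) * rt k (1 + k * c\<^sup>2) w / 4 - c * (c * (2 - c\<^sup>2 - w\<^sup>2) / (4 * (c\<^sup>2 + w\<^sup>2)) * rt k (1 + k * c\<^sup>2) w)"
      unfolding T_def[abs_def] by (intro DERIV_diff DERIV_cmult DERIV_en_prim DERIV_mom_prim k0 c)
    moreover have "(2 - c\<^sup>2 - w\<^sup>2) * q / 4 - c * (c * (2 - c\<^sup>2 - w\<^sup>2) / (4 * (c\<^sup>2 + w\<^sup>2)) * q) = s w * w\<^sup>2 / (2 * (c\<^sup>2 + w\<^sup>2)) * q" for q
      unfolding s_def b_sq using z by (simp add: field_simps power2_eq_square)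
    ultimately show ?thesis unfolding a_def[symmetric] by (simp only:)
  qed
  have m: "modica k c (s w) * (- w) = - (s w * w\<^sup>2 / (2 * (c\<^sup>2 + w\<^sup>2)) * S w)" if "w > 0" for w
  proof -
    define z where "z = c\<^sup>2 + w\<^sup>2"
    have z: "z > 0" unfolding z_def using c by (intro add_pos_nonneg) auto
    have "1 - s w = z / 2" unfolding s_def b_sq z_def by (simp add: field_simps)
    then have t: "trunc c (s w) = z / 2" unfolding trunc_def by (simp add: z_def)
    have "wA k c (s w) = 2 * (S w)\<^sup>2 / z" unfolding wA_def t S_sq' z_def[symmetric] using z by (simp add: field_simps)
    moreover have "wB c (s w) = 2 * w\<^sup>2 / z" unfolding wB_def t
    proof -
      have "c\<^sup>2 = z - w\<^sup>2" by (simp add: z_def)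
      then show "2 - c\<^sup>2 / (z / 2) = 2 * w\<^sup>2 / z" using z by (simp add: field_simps)
    qed
    ultimately have "sqrt (wA k c (s w)) * sqrt (wB c (s w)) = sqrt ((2 * S w * w / z)\<^sup>2)"
      unfolding real_sqrt_mult[symmetric] by (simp add: power2_eq_square)
    also have "\<dots> = 2 * S w * w / z" using z that S_pos[of w] by simp
    finally have "modica k c (s w) = s w * (2 * S w * w / z) / 4" unfolding modica_def by (simp add: mult.assoc)
    then show ?thesis unfolding z_def[symmetric] using z by (simp add: power2_eq_square)
  qed
  have "(\<lambda>w. \<Phi> (s w) + T w) b = (\<lambda>w. \<Phi> (s w) + T w) 0"
  proof (rule DERIV_isconst_end[OF b_pos])
    have "DERIV (\<lambda>w. \<Phi> (s w) + T w) w :> modica k c (s w) * (- w) + s w * w\<^sup>2 / (2 * (c\<^sup>2 + w\<^sup>2)) * S w" for w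
      by (intro DERIV_add DERIV_chain2[OF \<Phi> ds] dT)
    then have d: "DERIV (\<lambda>w. \<Phi> (s w) + T w) w :> modica k c (s w) * (- w) + s w * w\<^sup>2 / (2 * (c\<^sup>2 + w\<^sup>2)) * S w" for w .
    show "continuous_on {0..b} (\<lambda>w. \<Phi> (s w) + T w)"
      using d by (meson DERIV_isCont continuous_at_imp_continuous_on)
    show "DERIV (\<lambda>w. \<Phi> (s w) + T w) w :> 0" if "0 < w" "w < b" for w
      using d[of w] m[OF that(1)] by simp
  qed
  moreover have "T 0 = 0" using en_prim_minus[OF k0, of c 0] mom_prim_minus[OF k0, of c 0] by (simp add: T_def)
  moreover have "2 * T b = sol_action k c"
    by (simp add: T_def sol_action_def sol_energy_def sol_momentum_def b_def algebra_simps)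
  moreover have "s b = 0" "s 0 = 1 - c\<^sup>2 / 2" unfolding s_def b_sq by (simp_all add: field_simps)
  ultimately show ?thesis by simp
qed

context finite_energy
begin

text \<open>The peak may exceed the amplitude 1 - c^2/2: the integrand is truncated there, so its
  antiderivative is constant beyond this amplitude and the total is always the action at speed
  \<open>c\<close>. This freedom serves functions with a zero, where \<open>h x0 = 1\<close> and
  every \<open>c\<close> is admissible.\<close>

lemma modica_peak:
  assumes c: "c > 0" "c < sqrt 2" and k: "k \<ge> 0" and x0: "h x0 \<ge> 1 - c\<^sup>2 / 2"
    and i: "integrable lborel (\<lambda>x. modica k c (h x) * h' x)"
  shows "integrable lborel (\<lambda>x. sgn (x0 - x) * (modica k c (h x) * h' x))"
    "(LINT x|lborel. sgn (x0 - x) * (modica k c (h x) * h' x)) = sol_action k c"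
proof -
  interpret soliton_profile k c by unfold_locales (use c k in auto)
  obtain \<Phi> where \<Phi>: "\<And>s. DERIV \<Phi> s :> modica k c s"
    using ex_antiderivative[OF continuous_on_modica[OF c(1)]] by blast
  have "isCont \<Phi> 0" by (rule DERIV_isCont[OF \<Phi>])
  then have l: "((\<lambda>x. \<Phi> (h x)) \<longlongrightarrow> \<Phi> 0) at_top" "((\<lambda>x. \<Phi> (h x)) \<longlongrightarrow> \<Phi> 0) at_bot"
    using isCont_tendsto_compose[OF _ h_limits(1)] isCont_tendsto_compose[OF _ h_limits(2)] by blast+
  note * = primitive_peak_integral[OF primitive_chain[OF prim_h \<Phi> continuous_on_modica[OF c(1)]] i l, of x0]
  show "integrable lborel (\<lambda>x. sgn (x0 - x) * (modica k c (h x) * h' x))" by (rule *(1))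
  have "\<Phi> (h x0) = \<Phi> (1 - c\<^sup>2 / 2)"
  proof (cases "h x0 = 1 - c\<^sup>2 / 2")
    case False
    then have "1 - c\<^sup>2 / 2 < h x0" using x0 by simp
    then show ?thesis
    proof (rule DERIV_isconst_end)
      show "continuous_on {1 - c\<^sup>2 / 2..h x0} \<Phi>" using \<Phi> by (meson DERIV_isCont continuous_at_imp_continuous_on)
      show "DERIV \<Phi> s :> 0" if "1 - c\<^sup>2 / 2 < s" for s
        using \<Phi>[of s] modica_truncated[OF c(1), of s k] that by simp
    qed
  qed simp
  then show "(LINT x|lborel. sgn (x0 - x) * (modica k c (h x) * h' x)) = sol_action k c"
    using *(2) modica_antiderivative[OF c(1) \<Phi>] by simp
qed

text \<open>The angular part of the kinetic energy is dropped and the potential weight 2 is lowered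
  to \<open>wB\<close>, so the bound involves no momentum and holds also where \<open>u\<close>
  vanishes: there the amplitude is above the truncation and the left side is 0.\<close>

lemma dens_ge_modica:
  assumes c: "c > 0" and k: "k \<ge> 0" and \<sigma>: "\<sigma>\<^sup>2 = 1"
  shows "\<sigma> * (modica k c (h x) * h' x) \<le> dens k x"
proof (cases "h x \<ge> 1 - c\<^sup>2 / 2")
  case True
  then show ?thesis using modica_truncated[OF c] dens_nonneg[OF k] by simp
next
  case False
  then have lt: "1 - h x > c\<^sup>2 / 2" by argo
  then have t: "trunc c (h x) = 1 - h x" by (simp add: trunc_def)
  then have t: "trunc c (h x) = 1 - h x" "1 - h x > 0" using trunc_pos[OF c, of "h x"] by auto
  have "(h' x)\<^sup>2 / (8 * (1 - h x)) \<le> 1 / 2 * (norm (w x))\<^sup>2"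
    using h'_sq_le[of x] t(2) by (simp add: field_simps)
  moreover have "wB c (h x) * (h x)\<^sup>2 \<le> 2 * (h x)\<^sup>2" by (intro mult_right_mono wB_range c) auto
  moreover have "wA k c (h x) * (h' x)\<^sup>2 = (h' x)\<^sup>2 / (1 - h x) + 2 * k * (h' x)\<^sup>2"
    unfolding wA_def t by (simp add: algebra_simps)
  moreover have "(h' x)\<^sup>2 / (8 * (1 - h x)) = 1 / 8 * ((h' x)\<^sup>2 / (1 - h x))" by simp
  ultimately have "1 / 8 * (wA k c (h x) * (h' x)\<^sup>2 + wB c (h x) * (h x)\<^sup>2) \<le> dens k x"
    unfolding dens_def by argo
  moreover have "0 \<le> 1 / 8 * (wA k c (h x) * (h' x)\<^sup>2 + wB c (h x) * (h x)\<^sup>2) - \<sigma> * (modica k c (h x) * h' x)"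
    unfolding modica_square[OF c k \<sigma>] by simp
  ultimately show ?thesis by argo
qed

lemma int_modica:
  assumes c: "c > 0" and k: "k \<ge> 0"
  shows "integrable lborel (\<lambda>x. modica k c (h x) * h' x)"
proof (rule Bochner_Integration.integrable_bound)
  show "integrable lborel (dens k)" by (rule int_dens)
  have [measurable]: "modica k c \<in> borel_measurable borel" by (rule borel_measurable_continuous_onI[OF continuous_on_modica[OF c]])
  show "(\<lambda>x. modica k c (h x) * h' x) \<in> borel_measurable lborel" by measurable
  show "AE x in lborel. norm (modica k c (h x) * h' x) \<le> norm (dens k x)"
  proof (rule AE_I2)
    fix x
    show "norm (modica k c (h x) * h' x) \<le> norm (dens k x)"
      using dens_ge_modica[OF c k, of 1 x] dens_ge_modica[OF c k, of "-1" x] dens_nonneg[OF k, of x]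
      by (simp add: abs_le_iff)
  qed
qed

lemma energy_ge_action:
  assumes c: "c > 0" "c < sqrt 2" and k: "k \<ge> 0" and x0: "h x0 \<ge> 1 - c\<^sup>2 / 2"
  shows "energy (- k) u \<ge> sol_action k c"
proof -
  note m = modica_peak[OF c k x0 int_modica[OF c(1) k]]
  have "(LINT x|lborel. sgn (x0 - x) * (modica k c (h x) * h' x)) \<le> (LINT x|lborel. dens k x)"
  proof (rule integral_mono[OF m(1) int_dens])
    fix x
    show "sgn (x0 - x) * (modica k c (h x) * h' x) \<le> dens k x"
      using dens_ge_modica[OF c(1) k, of "sgn (x0 - x)" x] dens_nonneg[OF k, of x]
      by (cases "x = x0") (auto simp: sgn_if)
  qed
  then show ?thesis using m(2) energy_dens by simp
qed

lemma vanishing_energy_ge: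
  assumes k: "k \<ge> 0" and x0: "u x0 = 0"
  shows "energy (- k) u \<ge> sol_energy k 0"
proof -
  have h: "h x0 = 1" using x0 by (simp add: h_def)
  have "(sol_action k \<longlongrightarrow> sol_action k 0) (at 0 within {0..sqrt 2})"
    using continuous_on_sol_action[OF k] by (auto simp: continuous_on_def)
  then have t: "(sol_action k \<longlongrightarrow> sol_action k 0) (at_right 0)"
    using at_within_Icc_at_right[of 0 "sqrt 2"] by simp
  have "\<forall>\<^sub>F c in at_right 0. sol_action k c \<le> energy (- k) u"
    by (rule eventually_at_rightI[of 0 "sqrt 2"]) (use energy_ge_action[OF _ _ k, of _ x0] h in auto)
  \<comment> \<open>The bound by the action is available only for positive speeds; continuity of the
    action carries it to speed 0.\<close>
  then have "sol_action k 0 \<le> energy (- k) u" by (intro tendsto_upperbound[OF t]) auto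
  then show ?thesis by (simp add: sol_action_0)
qed

text \<open>Completing the square in \<open>J\<close>: the mixed term is - c times the momentum
  density, and the surplus c^2 h^2 / (8 (1 - h)) is exactly what lowers the weight of h^2 from 2 to
  \<open>wB\<close>. The bound on \<open>h\<close> switches the truncation off.\<close>

lemma dens_momentum_identity:
  assumes c: "c > 0" and h: "h x \<le> 1 - c\<^sup>2 / 2"
  shows "dens k x - c * mdens x = (J x + c * h x / 2)\<^sup>2 / (2 * (1 - h x))
    + 1 / 8 * (wA k c (h x) * (h' x)\<^sup>2 + wB c (h x) * (h x)\<^sup>2)"
proof -
  define t where "t = 1 - h x"
  have tc: "trunc c (h x) = t" using h by (simp add: trunc_def t_def)
  have t: "t > 0" using trunc_pos[OF c, of "h x"] tc by simp
  have N: "(norm (w x))\<^sup>2 = ((h' x)\<^sup>2 / 4 + (J x)\<^sup>2) / t" using kinetic_split[of x] t by (simp add: t_def[symmetric] field_simps)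
  have "h x = 1 - t" by (simp add: t_def)
  moreover have "1 - 1 / t = - (1 - t) / t" using t by (simp add: field_simps)
  ultimately have E: "1 - 1 / t = - h x / t" by simp
  show ?thesis
    unfolding dens_def mdens_def t_def[symmetric] wA_def wB_def tc N E using t
    by (simp add: field_simps power2_eq_square)
qed

end

section \<open>Lower bounds involving the momentum\<close>

locale finite_energy_nonvanishing = finite_energy +
  assumes uNX: "u \<in> NX_space"
begin

lemma u_nonzero: "norm (u x) > 0"
proof -
  have "0 < (INF x. norm (u x))" using uNX by (simp add: NX_space_def)
  also have "\<dots> \<le> norm (u x)" by (rule cINF_lower[OF bdd_belowI2[of _ 0]]) auto
  finally show ?thesis .
qed

lemma h_less_1: "h x < 1"
  using u_nonzero[of x] by (simp add: h_def)

text \<open>At the sound speed sqrt 2 the truncation amplitude is 0, so eta <= 0 is within range;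
  both terms of the density identity are nonnegative, and no peak contribution is required.\<close>

lemma energy_ge_flat:
  assumes k: "k \<ge> 0" and h: "\<And>x. h x \<le> 0"
  shows "energy (- k) u \<ge> sqrt 2 * momentum u"
proof -
  have c: "sqrt 2 > (0::real)" by simp
  have "(LINT x|lborel. sqrt 2 * mdens x) \<le> (LINT x|lborel. dens k x)"
  proof (rule integral_mono[OF _ int_dens])
    show "integrable lborel (\<lambda>x. sqrt 2 * mdens x)" using int_mdens[OF uNX] by simp
    fix x
    have "dens k x - sqrt 2 * mdens x = (J x + sqrt 2 * h x / 2)\<^sup>2 / (2 * (1 - h x))
      + 1 / 8 * (wA k (sqrt 2) (h x) * (h' x)\<^sup>2 + wB (sqrt 2) (h x) * (h x)\<^sup>2)"
      by (rule dens_momentum_identity[OF c]) (use h[of x] in simp)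
    also have "\<dots> \<ge> 0"
      using wA_pos[OF c k, of "h x"] wB_range(1)[OF c, of "h x"] h_less_1[of x]
      by (intro add_nonneg_nonneg mult_nonneg_nonneg divide_nonneg_nonneg) auto
    finally show "sqrt 2 * mdens x \<le> dens k x" by simp
  qed
  then show ?thesis unfolding energy_dens momentum_mdens by simp
qed

text \<open>With \<open>c\<close> fixed by the height of the peak, the truncation is never active.
  Energy minus \<open>c\<close> times momentum minus the action is then the integral of two squares,
  and equality makes both vanish almost everywhere.\<close>

lemma energy_ge_peak:
  assumes c: "c > 0" "c < sqrt 2" and k: "k \<ge> 0" and x0: "h x0 = 1 - c\<^sup>2 / 2" and max: "\<And>x. h x \<le> h x0"
  shows "energy (- k) u \<ge> c * momentum u + sol_action k c"
    "energy (- k) u = c * momentum u + sol_action k c \<Longrightarrow>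
       AE x in lborel. J x = - (c * h x / 2) \<and>
         sqrt (wA k c (h x)) * h' x = sgn (x0 - x) * sqrt (wB c (h x)) * h x"
proof -
  have m: "integrable lborel (\<lambda>x. sgn (x0 - x) * (modica k c (h x) * h' x))"
    "(LINT x|lborel. sgn (x0 - x) * (modica k c (h x) * h' x)) = sol_action k c"
    using modica_peak[OF c k _ int_modica[OF c(1) k], of x0] x0 by auto
  define D where "D x = (dens k x - c * mdens x) - sgn (x0 - x) * (modica k c (h x) * h' x)" for x
  have im: "integrable lborel (\<lambda>x. c * mdens x)" using int_mdens[OF uNX] by simp
  have iD: "integrable lborel D"
    unfolding D_def[abs_def] by (intro Bochner_Integration.integrable_diff int_dens im m(1))
  have D: "(LINT x|lborel. D x) = energy (- k) u - c * momentum u - sol_action k c"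
    unfolding D_def energy_dens momentum_mdens m(2)[symmetric] using int_dens[of k] im m(1) by simp
  \<comment> \<open>At \<open>x0\<close> the sign is 0 and the square cannot be completed; a single
    point does not affect the integral.\<close>
  have Dx: "D x = (J x + c * h x / 2)\<^sup>2 / (2 * (1 - h x))
     + 1 / 8 * (sqrt (wA k c (h x)) * h' x - sgn (x0 - x) * sqrt (wB c (h x)) * h x)\<^sup>2" if "x \<noteq> x0" for x
  proof -
    have \<sigma>: "(sgn (x0 - x))\<^sup>2 = 1" using that by (auto simp: sgn_if)
    show ?thesis unfolding D_def modica_square[OF c(1) k \<sigma>, symmetric]
      using dens_momentum_identity[OF c(1), of x k] max[of x] x0 by simp
  qed
  have nn: "0 \<le> (J x + c * h x / 2)\<^sup>2 / (2 * (1 - h x))" for x using h_less_1[of x] by simp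
  have ae: "AE x in lborel. 0 \<le> D x"
    using AE_lborel_singleton[of x0] by eventually_elim (use Dx nn in auto)
  show "energy (- k) u \<ge> c * momentum u + sol_action k c"
    using integral_nonneg_AE[OF ae] D by simp
  assume "energy (- k) u = c * momentum u + sol_action k c"
  then have "(LINT x|lborel. D x) = 0" using D by simp
  then have "AE x in lborel. D x = 0" using integral_nonneg_eq_0_iff_AE[OF iD ae] by simp
  with AE_lborel_singleton[of x0] show "AE x in lborel. J x = - (c * h x / 2) \<and>
         sqrt (wA k c (h x)) * h' x = sgn (x0 - x) * sqrt (wB c (h x)) * h x"
  proof eventually_elim
    case (elim x)
    then have "(J x + c * h x / 2)\<^sup>2 / (2 * (1 - h x))
     + 1 / 8 * (sqrt (wA k c (h x)) * h' x - sgn (x0 - x) * sqrt (wB c (h x)) * h x)\<^sup>2 = 0" using Dx by simp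
    moreover have "0 \<le> 1 / 8 * (sqrt (wA k c (h x)) * h' x - sgn (x0 - x) * sqrt (wB c (h x)) * h x)\<^sup>2" by simp
    ultimately have "(J x + c * h x / 2)\<^sup>2 / (2 * (1 - h x)) = 0"
      "1 / 8 * (sqrt (wA k c (h x)) * h' x - sgn (x0 - x) * sqrt (wB c (h x)) * h x)\<^sup>2 = 0"
      using add_nonneg_eq_0_iff[OF nn[of x]] by blast+
    then show ?case using h_less_1[of x] by auto
  qed
qed

end

subsection \<open>The equality case\<close>

context soliton_profile
begin

definition rate :: "real \<Rightarrow> real" where "rate v = (b\<^sup>2 - v\<^sup>2) / (2 * S v)"

text \<open>A nonincreasing right-hand side gives forward uniqueness for v' = \<open>rate v\<close>:
  the distance of two solutions cannot grow.\<close>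

lemma rate_antimono:
  assumes "0 \<le> v" "v \<le> v'"
  shows "rate v' \<le> rate v"
proof (rule DERIV_nonpos_imp_nonincreasing[OF assms(2)])
  fix x assume x: "v \<le> x" "x \<le> v'"
  let ?s = "S x"
  have s: "?s > 0" by (rule S_pos)
  have "DERIV rate x :> (- (2 * x) * (2 * ?s) - (b\<^sup>2 - x\<^sup>2) * (2 * (k * x / ?s))) / (2 * ?s * (2 * ?s))"
    unfolding rate_def[abs_def] using s
    by (intro DERIV_divide DERIV_cmult DERIV_rt[OF a_pos k0]) (auto intro!: derivative_eq_intros)
  moreover have "(- (2 * x) * (2 * ?s) - (b\<^sup>2 - x\<^sup>2) * (2 * (k * x / ?s))) / (2 * ?s * (2 * ?s))
     = - (x * (2 * ?s\<^sup>2 + k * (b\<^sup>2 - x\<^sup>2))) / (2 * ?s ^ 3)"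
    using s by (simp add: field_simps power2_eq_square power3_eq_cube)
  moreover have "- (x * (2 * ?s\<^sup>2 + k * (b\<^sup>2 - x\<^sup>2))) / (2 * ?s ^ 3) \<le> 0"
  proof -
    have "2 * ?s\<^sup>2 + k * (b\<^sup>2 - x\<^sup>2) = 2 * a + k * x\<^sup>2 + k * b\<^sup>2" unfolding S_sq by (simp add: algebra_simps)
    also have "\<dots> \<ge> 0" using a_pos k0 by (intro add_nonneg_nonneg mult_nonneg_nonneg) auto
    finally show ?thesis using x assms s by simp
  qed
  ultimately show "\<exists>y. DERIV rate x :> y \<and> y \<le> 0" by metis
qed

text \<open>The equation for \<open>h\<close> has a square root that vanishes at the maximum, so a
  solution may linger there and uniqueness fails. After the last point \<open>x1\<close> at the
  maximal height, v = sqrt(b^2 - 2 h) is differentiable and satisfies v' = \<open>rate v\<close>,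
  like the translate of \<open>W\<close>; their squared distance starts at 0 and is
  nonincreasing.\<close>

lemma half_line_unique:
  fixes h :: "real \<Rightarrow> real"
  assumes c: "continuous_on UNIV h" and max: "\<And>x. h x \<le> b\<^sup>2 / 2" and x0: "h x0 = b\<^sup>2 / 2"
    and lim: "(h \<longlongrightarrow> 0) at_top"
    and d: "\<And>x. x > x0 \<Longrightarrow> DERIV h x :> - (sqrt (b\<^sup>2 - 2 * h x) * h x / S (sqrt (b\<^sup>2 - 2 * h x)))"
  obtains x1 where "x1 \<ge> x0" "h x1 = b\<^sup>2 / 2" "\<And>x. x \<ge> x1 \<Longrightarrow> h x = et (x - x1)"
proof -
  have b2: "b\<^sup>2 / 2 > 0" using b_pos by simp
  define T where "T = {x. x \<ge> x0 \<and> h x = b\<^sup>2 / 2}"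
  have "\<forall>\<^sub>F x in at_top. h x < b\<^sup>2 / 2" by (rule order_tendstoD(2)[OF lim b2])
  then obtain N where N: "\<And>x. x \<ge> N \<Longrightarrow> h x < b\<^sup>2 / 2" unfolding eventually_at_top_linorder by blast
  have bdd: "bdd_above T" 
  proof (rule bdd_aboveI)
    show "x \<le> N" if "x \<in> T" for x using that N[of x] by (cases "x \<le> N") (auto simp: T_def)
  qed
  have ne: "T \<noteq> {}" using x0 by (auto simp: T_def)
  have "closed {x. h x = b\<^sup>2 / 2}" using c by (intro closed_Collect_eq) auto
  then have "closed T" unfolding T_def using closed_atLeast[of x0] by (simp add: closed_Collect_conj atLeast_def)
  define x1 where "x1 = Sup T"
  have "x1 \<in> T" unfolding x1_def by (rule closed_contains_Sup[OF ne bdd \<open>closed T\<close>])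
  then have x1: "x1 \<ge> x0" "h x1 = b\<^sup>2 / 2" by (auto simp: T_def)
  have lt: "h x < b\<^sup>2 / 2" if "x > x1" for x
  proof (rule ccontr)
    assume "\<not> ?thesis"
    then have "x \<in> T" using max[of x] that x1 by (simp add: T_def)
    then have "x \<le> x1" unfolding x1_def by (rule cSup_upper[OF _ bdd])
    then show False using that by simp
  qed
  define v where "v x = sqrt (b\<^sup>2 - 2 * h x)" for x
  have v0: "v x \<ge> 0" for x using max[of x] by (simp add: v_def)
  have v2: "(v x)\<^sup>2 = b\<^sup>2 - 2 * h x" for x using max[of x] by (simp add: v_def)
  have cv: "continuous_on A v" for A unfolding v_def by (intro continuous_intros continuous_on_subset[OF c]) auto
  have dv: "DERIV v x :> rate (v x)" if x: "x > x1" for x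
  proof -
    have vp: "v x > 0" using lt[OF x] by (simp add: v_def)
    have d0: "DERIV (\<lambda>x. b\<^sup>2 - 2 * h x) x :> - (2 * - (v x * h x / S (v x)))"
      using DERIV_diff[OF DERIV_const DERIV_cmult[OF d[of x], of 2], of "b\<^sup>2"] x x1 by (simp add: v_def)
    have p0: "b\<^sup>2 - 2 * h x > 0" using lt[OF x] by simp
    have dv: "DERIV v x :> (inverse (v x) / 2) * - (2 * - (v x * h x / S (v x)))"
      using DERIV_chain2[OF DERIV_real_sqrt[OF p0] d0] unfolding v_def .
    have e: "(inverse (v x) / 2) * - (2 * - (v x * h x / S (v x))) = h x / S (v x)"
      using vp S_pos[of "v x"] by (simp add: field_simps)
    have r: "rate (v x) = h x / S (v x)" by (simp add: rate_def v2)
    show ?thesis unfolding r using dv unfolding e .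
  qed
  have dW: "DERIV (\<lambda>x. W (x - x1)) x :> rate (W (x - x1))" for x
    using DERIV_W[of "x - x1"] DERIV_shift[of W "W' (x - x1)" x "- x1"] by (simp add: rate_def W'_def)
  have "v x = W (x - x1)" if "x \<ge> x1" for x
  proof (cases "x = x1")
    case True then show ?thesis using x1 W_0 by (simp add: v_def)
  next
    case False
    then have x: "x1 < x" using that by simp
    define D where "D x = (v x - W (x - x1))\<^sup>2" for x
    have dD: "DERIV D y :> 2 * ((v y - W (y - x1)) * (rate (v y) - rate (W (y - x1))))" if "y > x1" for y
      unfolding D_def[abs_def] using DERIV_power[OF DERIV_diff[OF dv[OF that] dW[of y]], of 2] by (simp add: mult_ac)
    have "\<exists>l z. x1 < z \<and> z < x \<and> DERIV D z :> l \<and> D x - D x1 = (x - x1) * l"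
    proof (rule MVT[OF x])
      show "continuous_on {x1..x} D" unfolding D_def[abs_def] by (intro continuous_intros cv)
      show "D differentiable (at y)" if "x1 < y" for y
        using dD[OF that] real_differentiable_def by blast
    qed
    then obtain l z where z: "x1 < z" "DERIV D z :> l" "D x - D x1 = (x - x1) * l" by blast
    have l: "l = 2 * ((v z - W (z - x1)) * (rate (v z) - rate (W (z - x1))))"
      using DERIV_unique[OF z(2) dD[OF z(1)]] .
    have Wz: "W (z - x1) \<ge> 0" using W_strict_mono[of 0 "z - x1"] W_0 z(1) by simp
    have "(v z - W (z - x1)) * (rate (v z) - rate (W (z - x1))) \<le> 0"
    proof (cases "v z \<ge> W (z - x1)")
      case True
      then show ?thesis using rate_antimono[OF Wz True] by (intro mult_nonneg_nonpos) auto
    next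
      case False
      then show ?thesis using rate_antimono[OF v0, of z "W (z - x1)"] by (intro mult_nonpos_nonneg) auto
    qed
    then have "l \<le> 0" unfolding l by simp
    then have "(x - x1) * l \<le> 0" using x by (intro mult_nonneg_nonpos) auto
    moreover have "D x1 = 0" using x1 W_0 by (simp add: D_def v_def)
    ultimately have "D x \<le> 0" using z(3) by simp
    then show ?thesis by (simp add: D_def)
  qed
  then have "h x = et (x - x1)" if "x \<ge> x1" for x
    using v2[of x] that by (simp add: et_def)
  then show ?thesis using that x1 by blast
qed

lemma et_minus: "et (- x) = et x" by (simp add: et_def W_minus)

text \<open>In terms of v = sqrt(b^2 - 2 h) the roots of the two weights are \<open>S v\<close> and
  \<open>v\<close> times a common factor, so equality in the Modica inequality is the profile
  equation for \<open>h\<close>.\<close>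

lemma wAB_profile:
  assumes c: "c > 0" and h: "h \<le> b\<^sup>2 / 2"
    and e: "sqrt (wA k c h) * h' = \<sigma> * sqrt (wB c h) * h"
  shows "h' = \<sigma> * (sqrt (b\<^sup>2 - 2 * h) * h / S (sqrt (b\<^sup>2 - 2 * h)))"
proof -
  define v z where "v = sqrt (b\<^sup>2 - 2 * h)" and "z = c\<^sup>2 + v\<^sup>2"
  have v: "v \<ge> 0" "v\<^sup>2 = b\<^sup>2 - 2 * h" using h by (auto simp: v_def)
  have z: "z > 0" unfolding z_def using c by (intro add_pos_nonneg) auto
  have "1 - h = z / 2" unfolding z_def v(2) b_sq by (simp add: field_simps)
  then have t: "trunc c h = z / 2" unfolding trunc_def by (simp add: z_def)
  have A: "wA k c h = 2 * (S v)\<^sup>2 / z" unfolding wA_def t S_sq' z_def[symmetric] using z by (simp add: field_simps)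
  have "c\<^sup>2 = z - v\<^sup>2" by (simp add: z_def)
  then have B: "wB c h = 2 * v\<^sup>2 / z" unfolding wB_def t using z by (simp add: field_simps)
  have q: "sqrt 2 / sqrt z > 0" using z by simp
  have "sqrt (wA k c h) = sqrt 2 / sqrt z * S v" "sqrt (wB c h) = sqrt 2 / sqrt z * v"
    unfolding A B using S_pos[of v] v(1) by (simp_all add: real_sqrt_mult real_sqrt_divide)
  then have "sqrt 2 / sqrt z * (S v * h') = sqrt 2 / sqrt z * (\<sigma> * v * h)" using e by (simp add: mult_ac)
  then have "S v * h' = \<sigma> * v * h" using q z by simp
  then show ?thesis unfolding v_def[symmetric] using S_pos[of v] by (simp add: field_simps)
qed

end

lemma ode_quotient_constant:
  fixes u v \<gamma> :: "real \<Rightarrow> complex"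
  assumes u: "\<And>x. (u has_vector_derivative u x * \<gamma> x) (at x)"
    and v: "\<And>x. (v has_vector_derivative v x * \<gamma> x) (at x)" and nz: "\<And>x. v x \<noteq> 0"
  obtains C where "\<And>x. u x = C * v x"
proof -
  have iv: "((\<lambda>x. inverse (v x)) has_vector_derivative - (\<gamma> x * inverse (v x))) (at x)" for x
    using field_vector_diff_chain_at[OF v[of x] DERIV_inverse[OF nz[of x]]] nz[of x] by (simp add: o_def power2_eq_square field_simps)
  have "((\<lambda>x. u x * inverse (v x)) has_vector_derivative 0) (at x)" for x
    using has_vector_derivative_mult[OF u iv] by (simp add: algebra_simps)
  then have p: "primitive (\<lambda>x. u x * inverse (v x)) (\<lambda>x. 0)"
    by (rule primitive_vector_derivative) simp
  define C where "C = u 0 * inverse (v 0)"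
  have C: "u x * inverse (v x) = C" for x
    using primitiveD(2)[OF p, of 0 x] primitiveD(2)[OF p, of x 0] unfolding C_def
    by (cases "x \<ge> 0") (simp_all add: set_lebesgue_integral_def)
  show ?thesis
  proof (rule that)
    fix x
    have "u x = u x * inverse (v x) * v x" using nz[of x] by (simp add: mult.assoc)
    then show "u x = C * v x" unfolding C .
  qed
qed

context finite_energy_nonvanishing
begin

text \<open>What \<open>h\<close> does between \<open>x2\<close> and \<open>x1\<close> is never
  determined directly. The two outer parts alone carry the momentum \<open>sol_momentum k c\<close>;
  as the density \<open>mu\<close> is nonnegative, nothing is left for the middle, where
  \<open>h\<close> would have to vanish, contradicting its positive value at \<open>x1\<close>
  unless the middle is a point.\<close>

lemma equality_profile:
  assumes c: "c > 0" "c < sqrt 2" and k: "k \<ge> 0" and x0: "h x0 = 1 - c\<^sup>2 / 2" and max: "\<And>x. h x \<le> h x0"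
    and ae: "AE x in lborel. J x = - (c * h x / 2) \<and> sqrt (wA k c (h x)) * h' x = sgn (x0 - x) * sqrt (wB c (h x)) * h x"
    and mom: "momentum u = sol_momentum k c"
  shows "h x = soliton_profile.et k c (x - x0)"
proof -
  interpret soliton_profile k c by unfold_locales (use c k in auto)
  have M: "1 - c\<^sup>2 / 2 = b\<^sup>2 / 2" unfolding b_sq by (simp add: field_simps)
  have hM: "h x \<le> b\<^sup>2 / 2" for x using max[of x] x0 M by simp
  define H where "H x = sqrt (b\<^sup>2 - 2 * h x) * h x / S (sqrt (b\<^sup>2 - 2 * h x))" for x
  have cH: "continuous_on A H" for A unfolding H_def
    using S_pos by (intro continuous_intros cont_h) (auto simp: less_imp_neq[symmetric])
  have aeH: "AE x in lborel. h' x = sgn (x0 - x) * H x"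
    using ae by eventually_elim (use wAB_profile[OF c(1) hM] in \<open>auto simp: H_def\<close>)
  have dr: "DERIV h x :> - H x" if "x > x0" for x
    unfolding has_real_derivative_iff_has_vector_derivative
  proof (rule primitive_continuous_imp_derivative[OF prim_h, of x0 "x + 1"])
    show "AE y in lborel. y \<in> {x0<..<x + 1} \<longrightarrow> h' y = - H y"
      using aeH by eventually_elim (auto simp: sgn_if)
  qed (use that in \<open>auto intro!: continuous_intros cH\<close>)
  have dl: "DERIV h x :> H x" if "x < x0" for x
    unfolding has_real_derivative_iff_has_vector_derivative
  proof (rule primitive_continuous_imp_derivative[OF prim_h, of "x - 1" x0])
    show "AE y in lborel. y \<in> {x - 1<..<x0} \<longrightarrow> h' y = H y"
      using aeH by eventually_elim (auto simp: sgn_if)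
  qed (use that in \<open>auto intro!: cH\<close>)
  obtain x1 where x1: "x1 \<ge> x0" "h x1 = b\<^sup>2 / 2" "\<And>x. x \<ge> x1 \<Longrightarrow> h x = et (x - x1)"
    using half_line_unique[OF cont_h hM, of x0] x0 M h_limits(1) dr unfolding H_def by metis
  \<comment> \<open>The left half-line is the right half-line of the reflected function.\<close>
  obtain x2' where x2': "x2' \<ge> - x0" "h (- x2') = b\<^sup>2 / 2" "\<And>x. x \<ge> x2' \<Longrightarrow> h (- x) = et (x - x2')"
  proof (rule half_line_unique[of "\<lambda>x. h (- x)" "- x0"])
    show "continuous_on UNIV (\<lambda>x. h (- x))" by (intro continuous_on_compose2[OF cont_h[of UNIV]] continuous_intros) auto
    show "((\<lambda>x. h (- x)) \<longlongrightarrow> 0) at_top" using h_limits(2) by (simp add: filterlim_at_bot_mirror)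
    show "DERIV (\<lambda>x. h (- x)) x :> - (sqrt (b\<^sup>2 - 2 * h (- x)) * h (- x) / S (sqrt (b\<^sup>2 - 2 * h (- x))))" if "x > - x0" for x
      using DERIV_chain2[OF dl[of "- x"] DERIV_minus[OF DERIV_ident]] that by (simp add: H_def)
  qed (use hM x0 M in auto)
  define x2 where "x2 = - x2'"
  have x2: "x2 \<le> x0" "h x2 = b\<^sup>2 / 2" "\<And>x. x \<le> x2 \<Longrightarrow> h x = et (x - x2)"
  proof -
    show "x2 \<le> x0" "h x2 = b\<^sup>2 / 2" using x2' by (auto simp: x2_def)
    show "h x = et (x - x2)" if "x \<le> x2" for x
      using x2'(3)[of "- x"] that et_minus[of "x - x2"] by (simp add: x2_def)
  qed
  text \<open>A flat piece between \<open>x2\<close> and \<open>x1\<close> would carry additional momentum.\<close>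
  define l m where "l = (x1 - x2) / 2" and "m = (x1 + x2) / 2"
  have l0: "l \<ge> 0" using x1 x2 by (simp add: l_def)
  define g where "g x = c / 4 * ((et (x - clamp_to l x))\<^sup>2 / (1 - et (x - clamp_to l x)))" for x
  note ig = momentum_density_plateau[OF c(1) l0, folded g_def]
  have igm: "integrable lborel (\<lambda>x. g (- m + 1 * x))" by (rule lborel_integrable_real_affine[OF ig(1)]) simp
  have Igm: "(LINT x|lborel. g (- m + 1 * x)) = sol_momentum k c + l / c * (et 0)\<^sup>2"
    using lborel_integral_real_affine[of 1 g "- m"] ig(2) by simp
  define mu where "mu x = c / 4 * ((h x)\<^sup>2 / (1 - h x))" for x
  have mu0: "mu x \<ge> 0" for x using c h_less_1[of x] by (simp add: mu_def)
  have aem: "AE x in lborel. mdens x = mu x"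
    using ae
  proof eventually_elim
    case (elim x)
    have t: "1 - h x > 0" using h_less_1[of x] by simp
    have "- (c * q / 2) * (1 - 1 / (1 - q)) / 2 = c / 4 * (q\<^sup>2 / (1 - q))" if "1 - q \<noteq> 0" for q
      using that by (simp add: field_simps power2_eq_square)
    then show ?case using elim t by (simp add: mdens_def mu_def)
  qed
  have [measurable]: "mu \<in> borel_measurable borel" unfolding mu_def[abs_def] by measurable
  have imu: "integrable lborel mu"
    by (rule integrable_cong_AE[THEN iffD1, OF _ _ aem int_mdens[OF uNX]]) (auto simp: mdens_def[abs_def])
  have Imu: "(LINT x|lborel. mu x) = sol_momentum k c"
    unfolding mom[symmetric] momentum_mdens
    by (rule integral_cong_AE) (use aem in \<open>auto simp: mdens_def[abs_def] elim: eventually_mono\<close>)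
  define ind where "ind x = (indicator {x2..x1} x :: real)" for x
  have g0: "g x = (et 0)\<^sup>2 / (2 * c)" if "\<bar>x\<bar> \<le> l" for x
  proof -
    have y: "x - clamp_to l x = 0" using that by (auto simp: clamp_to_def abs_le_iff)
    have e: "1 - et 0 = c\<^sup>2 / 2" using one_minus_et[of 0] W_0 by simp
    show ?thesis unfolding g_def y e using c(1) by (simp add: power2_eq_square)
  qed
  \<comment> \<open>The comparison density \<open>g\<close> belongs to a soliton with a plateau on
    [x2, x1], and its integral is known. Outside this interval it agrees with \<open>mu\<close>,
    inside it is the constant (et 0)^2 / (2 c); removing that constant isolates the contribution of
    \<open>mu\<close> on the interval.\<close>
  have key: "mu x - g (- m + 1 * x) + (et 0)\<^sup>2 / (2 * c) * ind x = ind x * mu x" for x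
  proof -
    consider "x2 \<le> x" "x \<le> x1" | "x > x1" | "x < x2" by linarith
    then show ?thesis
    proof cases
      case 1
      then have "\<bar>- m + 1 * x\<bar> \<le> l" unfolding l_def m_def by (auto simp: abs_le_iff field_simps)
      then show ?thesis using g0 1 by (simp add: ind_def)
    next
      case 2
      then have "(- m + 1 * x) - clamp_to l (- m + 1 * x) = x - x1" using x1 x2
        by (auto simp: l_def m_def clamp_to_def min_def max_def field_simps)
      note y = this
      have "h x = et (x - x1)" using x1(3)[of x] 2 by simp
      then have "g (- m + 1 * x) = mu x" unfolding g_def y mu_def by simp
      then show ?thesis using 2 by (simp add: ind_def)
    next
      case 3
      then have "(- m + 1 * x) - clamp_to l (- m + 1 * x) = x - x2" using x1 x2
        by (auto simp: l_def m_def clamp_to_def min_def max_def field_simps)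
      note y = this
      have "h x = et (x - x2)" using x2(3)[of x] 3 by simp
      then have "g (- m + 1 * x) = mu x" unfolding g_def y mu_def by simp
      then show ?thesis using 3 by (simp add: ind_def)
    qed
  qed
  have iind: "integrable lborel ind" unfolding ind_def[abs_def]
    using borel_integrable_atLeastAtMost'[of x2 x1 "\<lambda>_. 1::real"] by (simp add: set_integrable_def)
  have Iind: "(LINT x|lborel. ind x) = x1 - x2" unfolding ind_def using x1(1) x2(1) by simp
  have "(LINT x|lborel. ind x * mu x) = (LINT x|lborel. mu x) - (LINT x|lborel. g (- m + 1 * x)) + (et 0)\<^sup>2 / (2 * c) * (LINT x|lborel. ind x)"
    unfolding key[symmetric]
    by (simp only: Bochner_Integration.integral_add Bochner_Integration.integral_diff integral_mult_right_zero
        Bochner_Integration.integrable_diff integrable_mult_right imu igm iind)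
  also have "\<dots> = sol_momentum k c - (sol_momentum k c + l / c * (et 0)\<^sup>2) + (et 0)\<^sup>2 / (2 * c) * (x1 - x2)"
    by (simp only: Igm Imu Iind)
  also have "\<dots> = 0" using c by (simp add: l_def field_simps)
  finally have I0: "(LINT x|lborel. ind x * mu x) = 0" .
  have iim: "integrable lborel (\<lambda>x. ind x * mu x)"
    unfolding key[symmetric]
    by (intro Bochner_Integration.integrable_add Bochner_Integration.integrable_diff integrable_mult_right imu igm iind)
  have "AE x in lborel. ind x * mu x = 0"
    using integral_nonneg_eq_0_iff_AE[OF iim] I0 mu0 by (simp add: ind_def)
  \<comment> \<open>The continuous bump replaces the indicator, so that vanishing almost everywhere
    becomes vanishing everywhere.\<close>
  then have "AE x in lborel. h x * max 0 ((x - x2) * (x1 - x)) = 0"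
  proof eventually_elim
    case (elim x)
    show ?case
    proof (cases "x \<in> {x2..x1}")
      case True
      then have "mu x = 0" using elim by (simp add: ind_def)
      then show ?thesis using c h_less_1[of x] by (simp add: mu_def)
    next
      case False
      then have "(x - x2) * (x1 - x) \<le> 0" using x1(1) x2(1)
        by (cases "x < x2") (auto intro: mult_nonpos_nonneg mult_nonneg_nonpos)
      then show ?thesis by simp
    qed
  qed
  then have z: "h x * max 0 ((x - x2) * (x1 - x)) = 0" for x
    by (rule AE_lborel_continuous_eq_0) (intro continuous_intros cont_h)
  have "x1 = x2"
  proof (rule ccontr)
    assume "x1 \<noteq> x2"
    then have lt: "x2 < x1" using x1(1) x2(1) by simp
    have "h x = 0" if "x \<in> {x2<..<x1}" for x
    proof -
      have "(x - x2) * (x1 - x) > 0" using that by (intro mult_pos_pos) auto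
      then show ?thesis using z[of x] that by simp
    qed
    then have "h x1 = 0"
      using continuous_constant_on_closure[of "{x2<..<x1}" h 0 x1] cont_h lt by (auto simp: closure_greaterThanLessThan)
    then show False using x1(2) b_pos by simp
  qed
  then have "x1 = x0" "x2 = x0" using x1(1) x2(1) by auto
  then show ?thesis using x1(3)[of x] x2(3)[of x] by (cases "x \<ge> x0") auto
qed

text \<open>The profile determines |u|^2 and the equality case determines the current
  \<open>J\<close>, hence u' conj(u) / |u|^2. So \<open>u\<close> and the translated soliton solve
  the same linear equation u' = u gamma; their quotient is constant, and of modulus 1 by comparison
  at the peak.\<close>

lemma equality_soliton:
  assumes c: "c > 0" "c < sqrt 2" and k: "k \<ge> 0" and x0: "h x0 = 1 - c\<^sup>2 / 2" and max: "\<And>x. h x \<le> h x0"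
    and eq: "energy (- k) u = c * momentum u + sol_action k c"
    and mom: "momentum u = sol_momentum k c"
  shows "equal_up_to_invariances u (dark_soliton c (- k))"
proof -
  interpret soliton_profile k c by unfold_locales (use c k in auto)
  note ae = energy_ge_peak(2)[OF c k x0 max eq]
  have h: "h x = et (x - x0)" for x by (rule equality_profile[OF c k x0 max ae mom])
  have pos: "1 - et x > 0" for x by (rule one_minus_et_pos[OF c(1)])
  define \<gamma> where "\<gamma> x = Complex (W x * W' x / 2) (c * et x / 2) / complex_of_real (1 - et x)" for x
  have nzc: "complex_of_real (1 - et x) \<noteq> 0" for x
    unfolding of_real_eq_0_iff using pos[of x] by simp
  have cg: "continuous_on UNIV (\<lambda>x. \<gamma> (x - x0))"
    unfolding \<gamma>_def Complex_eq by (intro continuous_intros ballI nzc) auto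
  have dh: "primitive h (\<lambda>x. - W (x - x0) * W' (x - x0))"
  proof (rule primitive_vector_derivative)
    show "(h has_vector_derivative - W (x - x0) * W' (x - x0)) (at x)" for x
      unfolding h[abs_def] has_real_derivative_iff_has_vector_derivative[symmetric]
      using DERIV_et[of "x - x0"] DERIV_shift[of et "- W (x - x0) * W' (x - x0)" x "- x0"] by simp
  qed (intro continuous_intros)
  have aew: "AE x in lborel. w x = u x * \<gamma> (x - x0)"
    using ae primitive_unique[OF prim_h dh]
  proof eventually_elim
    case (elim x)
    define t where "t = 1 - et (x - x0)"
    have t: "t > 0" using pos by (simp add: t_def)
    have nu: "u x * cnj (u x) = complex_of_real t"
      using norm_sq_u[of x] h[of x] by (simp add: complex_norm_square[symmetric] t_def)
    have uw: "u x \<bullet> w x = W (x - x0) * W' (x - x0) / 2" using elim(2) by (simp add: h'_def)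
    have "w x * cnj (u x) = Complex (u x \<bullet> w x) (- J x)"
      by (simp add: complex_eq_iff inner_complex_def J_def algebra_simps)
    also have "\<dots> = Complex (W (x - x0) * W' (x - x0) / 2) (c * et (x - x0) / 2)"
      using uw elim(1) h by simp
    finally have "w x * (cnj (u x) * u x) = u x * Complex (W (x - x0) * W' (x - x0) / 2) (c * et (x - x0) / 2)"
      by (simp add: mult_ac)
    then have "w x * complex_of_real t = u x * Complex (W (x - x0) * W' (x - x0) / 2) (c * et (x - x0) / 2)"
      using nu by (simp add: mult.commute)
    then show ?case unfolding \<gamma>_def t_def[symmetric] using t by (simp add: field_simps)
  qed
  have du: "(u has_vector_derivative u x * \<gamma> (x - x0)) (at x)" for x
    by (rule primitive_continuous_imp_derivative[OF prim_u, of "x - 1" "x + 1"])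
       (use aew in \<open>auto elim: eventually_mono intro!: continuous_on_mult cont_u continuous_on_subset[OF cg]\<close>)
  define v where "v x = plateau_soliton 0 (x - x0)" for x
  have vg: "plateau_deriv 0 x = plateau_soliton 0 x * \<gamma> x" for x
  proof -
    define r where "r = sqrt (1 - et x)"
    have r: "r > 0" "r\<^sup>2 = 1 - et x" using pos[of x] by (auto simp: r_def)
    have "Complex (W x * W' x / (2 * r)) (r * (c / 2 * (et x / r\<^sup>2))) = complex_of_real r * (Complex (W x * W' x / 2) (c * et x / 2) / complex_of_real (r\<^sup>2))"
      using r(1) by (simp add: complex_eq_iff Re_divide_of_real Im_divide_of_real power2_eq_square)
    note e = this
    have cl: "clamp_to 0 x = 0" by (simp add: clamp_to_def)
    show ?thesis
      unfolding plateau_deriv_def plateau_soliton_def \<gamma>_def modulus'_def phase'_def cl diff_zero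
      unfolding r_def[symmetric] unfolding r(2)[symmetric] unfolding e by (simp only: mult_ac)
  qed
  have dv: "(v has_vector_derivative v x * \<gamma> (x - x0)) (at x)" for x
  proof -
    have "((\<lambda>x. x - x0) has_vector_derivative 1) (at x)" by (auto intro!: derivative_eq_intros)
    from vector_diff_chain_at[OF this plateau_has_derivative[OF c(1) order.refl]]
    show ?thesis unfolding v_def vg by (simp add: o_def)
  qed
  have nz: "v x \<noteq> 0" for x
  proof -
    have "norm (v x) > 0" unfolding v_def norm_plateau[OF c(1)] using pos by simp
    then show ?thesis by auto
  qed
  obtain C where C: "\<And>x. u x = C * v x" using ode_quotient_constant[OF du dv nz] by blast
  have "norm (u x0) = norm (v x0)"
  proof -
    have "(norm (u x0))\<^sup>2 = (norm (v x0))\<^sup>2"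
      unfolding norm_sq_u h v_def norm_plateau[OF c(1)] using pos[of 0] by (simp add: clamp_to_def)
    then show ?thesis by simp
  qed
  then have "norm C = 1" using C[of x0] nz[of x0] by (simp add: norm_mult)
  then have "cis (Arg C) = C" by (subst cis_Arg) (auto simp: sgn_div_norm)
  then have "C = exp (\<i> * complex_of_real (Arg C))" by (simp only: cis_conv_exp)
  then have "u x = exp (\<i> * complex_of_real (Arg C)) * plateau_soliton 0 (x - x0)" for x
    using C[of x] unfolding v_def by simp
  then show ?thesis unfolding equal_up_to_invariances_def dark_soliton_eq[OF c(1)] by blast
qed

end

subsection \<open>The minimization problem\<close>

lemma sol_action_MVT:
  assumes k: "k \<ge> 0" and c: "0 \<le> c1" "c1 < c2" "c2 \<le> sqrt 2"
  obtains \<xi> where "c1 < \<xi>" "\<xi> < c2" "sol_action k c1 - sol_action k c2 = (c2 - c1) * sol_momentum k \<xi>"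
proof -
  have "\<exists>l z. c1 < z \<and> z < c2 \<and> DERIV (sol_action k) z :> l \<and> sol_action k c2 - sol_action k c1 = (c2 - c1) * l"
  proof (rule MVT[OF c(2)])
    show "continuous_on {c1..c2} (sol_action k)"
      by (rule continuous_on_subset[OF continuous_on_sol_action[OF k]]) (use c in auto)
    show "sol_action k differentiable (at x)" if "c1 < x" "x < c2" for x
      using DERIV_sol_action[OF k, of x] that c real_differentiable_def by fastforce
  qed
  then obtain l z where z: "c1 < z" "z < c2" "DERIV (sol_action k) z :> l"
    "sol_action k c2 - sol_action k c1 = (c2 - c1) * l" by blast
  have "l = - sol_momentum k z"
    using DERIV_unique[OF z(3) DERIV_sol_action[OF k]] z c by simp
  then have "sol_action k c1 - sol_action k c2 = (c2 - c1) * sol_momentum k z" using z(4) by (simp add: algebra_simps)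
  then show ?thesis using that z by blast
qed

text \<open>The action is a Legendre transform: the minimal energy at momentum \<open>q\<close> turns out to be the
  minimum of \<open>c * q + sol_action k c\<close> over the speeds. The momenta for which this stays below the
  energy \<open>sol_action k 0\<close> of the black soliton are the subcritical ones.\<close>

definition subcritical :: "real \<Rightarrow> real \<Rightarrow> bool" where
  "subcritical k q \<longleftrightarrow> (\<exists>c. 0 < c \<and> c \<le> sqrt 2 \<and> c * q + sol_action k c < sol_action k 0)"

lemma subcritical_mono: "subcritical k q \<Longrightarrow> q' \<le> q \<Longrightarrow> subcritical k q'"
  unfolding subcritical_def by (meson add_right_mono le_less_trans less_imp_le mult_left_mono)

text \<open>Speed 0 is excluded by the strict inequality. At sqrt 2 the momentum of the solitons
  tends to 0 < q, so lowering the speed slightly lowers the value. At an interior minimum the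
  derivative q - P(c) vanishes.\<close>

lemma legendre_minimum_interior:
  assumes k: "k \<ge> 0" and q: "q > 0" and c: "0 \<le> c" "c \<le> sqrt 2"
    and min: "\<And>c'. 0 \<le> c' \<Longrightarrow> c' \<le> sqrt 2 \<Longrightarrow> c * q + sol_action k c \<le> c' * q + sol_action k c'"
    and lt: "c * q + sol_action k c < sol_action k 0"
  shows "0 < c" "c < sqrt 2" "sol_momentum k c = q"
proof -
  show c0: "0 < c" using lt c by (cases "c = 0") auto
  show c2: "c < sqrt 2"
  proof (rule ccontr)
    assume "\<not> c < sqrt 2"
    then have c: "c = sqrt 2" using c by simp
    have "continuous (at (sqrt 2) within {0<..sqrt 2}) (sol_momentum k)"
      using continuous_on_sol_momentum[OF k] by (simp add: continuous_on_eq_continuous_within)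
    then obtain d where d: "d > 0" "\<And>x. x \<in> {0<..sqrt 2} \<Longrightarrow> dist x (sqrt 2) < d \<Longrightarrow> dist (sol_momentum k x) (sol_momentum k (sqrt 2)) < q"
      using q unfolding continuous_within_eps_delta by metis
    \<comment> \<open>Close enough to sqrt 2 for all momenta beyond it to stay below
      \<open>q\<close>; the bound sqrt 2 / 2 keeps it positive.\<close>
    define c1 where "c1 = max (sqrt 2 / 2) (sqrt 2 - d / 2)"
    have c1: "0 < c1" "c1 < sqrt 2" "sqrt 2 - c1 < d" using d(1) by (auto simp: c1_def max_def)
    obtain \<xi> where \<xi>: "c1 < \<xi>" "\<xi> < sqrt 2" "sol_action k c1 - sol_action k (sqrt 2) = (sqrt 2 - c1) * sol_momentum k \<xi>"
      using sol_action_MVT[OF k _ c1(2), of thesis] c1 by auto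
    have "sol_momentum k \<xi> < q" using d(2)[of \<xi>] \<xi> c1 by (auto simp: dist_real_def sol_sqrt2)
    then have "(sqrt 2 - c1) * sol_momentum k \<xi> < (sqrt 2 - c1) * q" using c1 by (intro mult_strict_left_mono) auto
    then have "c1 * q + sol_action k c1 < sqrt 2 * q + sol_action k (sqrt 2)" using \<xi>(3) by (simp add: left_diff_distrib)
    then show False using min[of c1] c1 unfolding c by simp
  qed
  have "DERIV (\<lambda>c. c * q + sol_action k c) c :> 1 * q + - sol_momentum k c"
    by (intro DERIV_add DERIV_cmult_right DERIV_ident DERIV_sol_action k c0 c2)
  moreover have "0 < min c (sqrt 2 - c)" using c0 c2 by simp
  moreover have "\<forall>y. \<bar>c - y\<bar> < Orderings.min c (sqrt 2 - c) \<longrightarrow> c * q + sol_action k c \<le> y * q + sol_action k y"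
    using min by (auto simp: abs_less_iff)
  ultimately have "1 * q + - sol_momentum k c = 0" using DERIV_local_min by blast
  then show "sol_momentum k c = q" by simp
qed

lemma legendre_minimizer:
  assumes k: "k \<ge> 0" and q: "q > 0" and s: "subcritical k q"
  obtains c where "0 < c" "c < sqrt 2" "sol_momentum k c = q" "c * q + sol_action k c < sol_action k 0"
    "\<And>c'. 0 \<le> c' \<Longrightarrow> c' \<le> sqrt 2 \<Longrightarrow> c * q + sol_action k c \<le> c' * q + sol_action k c'"
proof -
  have "continuous_on {0..sqrt 2} (\<lambda>c. c * q + sol_action k c)"
    by (intro continuous_intros continuous_on_sol_action k)
  then obtain c where c: "c \<in> {0..sqrt 2}" "\<And>c'. c' \<in> {0..sqrt 2} \<Longrightarrow> c * q + sol_action k c \<le> c' * q + sol_action k c'"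
    using continuous_attains_inf[of "{0..sqrt 2}" "\<lambda>c. c * q + sol_action k c"] by auto
  obtain c1 where c1: "0 < c1" "c1 \<le> sqrt 2" "c1 * q + sol_action k c1 < sol_action k 0" using s unfolding subcritical_def by blast
  have lt: "c * q + sol_action k c < sol_action k 0" using c(2)[of c1] c1 by auto
  have c': "0 \<le> c" "c \<le> sqrt 2" using c(1) by auto
  note i = legendre_minimum_interior[OF k q c' _ lt]
  show ?thesis by (rule that[of c]) (use i c lt in auto)
qed

section \<open>Critical speed and the inverse of the momentum\<close>

lemma energy_dark_soliton:
  assumes "k \<ge> 0" "0 \<le> c" "c < sqrt 2"
  shows "energy (- k) (dark_soliton c (- k)) = sol_energy k c"
proof -
  interpret soliton_profile k c by unfold_locales (use assms in auto)
  show ?thesis using dark_soliton_props(2) black_soliton_props(2) assms by (cases "c = 0") auto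
qed

lemma momentum_dark_soliton:
  assumes "k \<ge> 0" "0 < c" "c < sqrt 2"
  shows "momentum (dark_soliton c (- k)) = sol_momentum k c" "dark_soliton c (- k) \<in> NX_space"
proof -
  interpret soliton_profile k c by unfold_locales (use assms in auto)
  show "momentum (dark_soliton c (- k)) = sol_momentum k c" "dark_soliton c (- k) \<in> NX_space"
    using dark_soliton_props assms by auto
qed

text \<open>Let m be the turning point of the momentum. On (0, m] the energy exceeds that of the
  black soliton, because F(0) - F(x) = x P(xi) < x P(x); beyond m it strictly decreases. Hence the
  black energy level is met exactly once in [m, sqrt 2). This last crossing is the critical speed,
  and the momentum is strictly decreasing after it.\<close>

lemma critical_speed_less:
  assumes k: "k \<ge> 0" and c: "0 < c" "c < sqrt 2" and lt: "sol_energy k c < sol_energy k 0"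
  shows "0 \<le> critical_speed (- k)" "critical_speed (- k) < c"
    "\<And>c1 c2. critical_speed (- k) < c1 \<Longrightarrow> c1 < c2 \<Longrightarrow> c2 < sqrt 2 \<Longrightarrow> sol_momentum k c2 < sol_momentum k c1"
proof -
  obtain m where m: "0 \<le> m" "m \<le> sqrt 2"
    and inc: "\<And>c1 c2. 0 < c1 \<Longrightarrow> c1 < c2 \<Longrightarrow> c2 \<le> m \<Longrightarrow> c2 < sqrt 2 \<Longrightarrow> sol_momentum k c1 < sol_momentum k c2"
    and dec: "\<And>c1 c2. 0 < c1 \<Longrightarrow> m \<le> c1 \<Longrightarrow> c1 < c2 \<Longrightarrow> c2 < sqrt 2 \<Longrightarrow> sol_momentum k c2 < sol_momentum k c1"
    using sol_momentum_unimodal[OF k] by blast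
  have E: "sol_energy k c = sol_action k c + c * sol_momentum k c" for c by (simp add: sol_action_def)
  have A: "sol_energy k 0 < sol_energy k x" if x: "0 < x" "x \<le> m" "x < sqrt 2" for x
  proof -
    obtain \<xi> where \<xi>: "0 < \<xi>" "\<xi> < x" "sol_action k 0 - sol_action k x = (x - 0) * sol_momentum k \<xi>"
      using sol_action_MVT[OF k order.refl x(1)] x by auto
    have "x * sol_momentum k \<xi> < x * sol_momentum k x" using inc[of \<xi> x] \<xi> x by (intro mult_strict_left_mono) auto
    then show ?thesis using \<xi>(3) unfolding E by simp
  qed
  have B: "sol_energy k c2 < sol_energy k c1" if x: "m \<le> c1" "c1 < c2" "c2 < sqrt 2" for c1 c2
  proof -
    have c10: "0 \<le> c1" using m x by simp
    obtain \<xi> where \<xi>: "c1 < \<xi>" "\<xi> < c2" "sol_action k c1 - sol_action k c2 = (c2 - c1) * sol_momentum k \<xi>"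
      using sol_action_MVT[OF k c10 x(2)] x by auto
    have "sol_momentum k c2 < sol_momentum k \<xi>" using dec[of \<xi> c2] \<xi> x c10 by auto
    then have 1: "(c2 - c1) * sol_momentum k c2 < (c2 - c1) * sol_momentum k \<xi>" using x by (intro mult_strict_left_mono) auto
    have 2: "c1 * sol_momentum k c2 \<le> c1 * sol_momentum k c1"
      using dec[of c1 c2] x c10 by (cases "c1 = 0") (auto intro!: mult_left_mono)
    show ?thesis unfolding E using 1 2 \<xi>(3) unfolding left_diff_distrib by argo
  qed
  have mc: "m < c" using A[of c] c lt by (cases "c \<le> m") auto
  \<comment> \<open>If m = 0 the crossing is speed 0 itself; otherwise the intermediate value
    theorem applies between m and \<open>c\<close>.\<close>
  have "\<exists>s. m \<le> s \<and> s < c \<and> sol_energy k s = sol_energy k 0"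
  proof (cases "m = 0")
    case True then show ?thesis using c by auto
  next
    case False
    then have Em: "sol_energy k 0 < sol_energy k m" using A[of m] m mc c by auto
    have "continuous_on {m..c} (sol_energy k)"
      by (rule continuous_on_subset[OF continuous_on_sol_energy[OF k]]) (use m c in auto)
    then obtain s where "m \<le> s" "s \<le> c" "sol_energy k s = sol_energy k 0"
      using IVT2'[of "sol_energy k" c "sol_energy k 0" m] lt Em mc by auto
    then show ?thesis using lt by (intro exI[of _ s]) (cases "s = c"; auto)
  qed
  then obtain s where s: "m \<le> s" "s < c" "sol_energy k s = sol_energy k 0" by blast
  have s0: "0 \<le> s" using s m by simp
  have "critical_speed (- k) = s"
    unfolding critical_speed_def
  proof (rule Greatest_equality)
    show "0 \<le> s \<and> s < sqrt 2 \<and> energy (- k) (dark_soliton s (- k)) = energy (- k) (dark_soliton 0 (- k))"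
      using s s0 c energy_dark_soliton[OF k, of s] energy_dark_soliton[OF k, of 0] by auto
    fix y assume y: "0 \<le> y \<and> y < sqrt 2 \<and> energy (- k) (dark_soliton y (- k)) = energy (- k) (dark_soliton 0 (- k))"
    then have "sol_energy k y = sol_energy k 0" using energy_dark_soliton[OF k, of y] energy_dark_soliton[OF k, of 0] by auto
    then show "y \<le> s" using B[of s y] s y by (cases "y \<le> s") auto
  qed
  then show "0 \<le> critical_speed (- k)" "critical_speed (- k) < c"
    "\<And>c1 c2. critical_speed (- k) < c1 \<Longrightarrow> c1 < c2 \<Longrightarrow> c2 < sqrt 2 \<Longrightarrow> sol_momentum k c2 < sol_momentum k c1"
    using s s0 dec by auto
qed

text \<open>Since P(c) = q, the quantity c q + F(c) is the energy of the soliton. Being below the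
  black energy puts the speed beyond the critical one, where the momentum is injective.\<close>

lemma speed_eq:
  assumes k: "k \<ge> 0" and c: "0 < c" "c < sqrt 2" and q: "sol_momentum k c = q"
    and lt: "c * q + sol_action k c < sol_action k 0"
  shows "speed (- k) q = c"
    "\<And>c'. 0 < c' \<Longrightarrow> c' < sqrt 2 \<Longrightarrow> sol_momentum k c' = q \<Longrightarrow> c' * q + sol_action k c' < sol_action k 0 \<Longrightarrow> c' = c"
proof -
  have E: "sol_energy k x < sol_energy k 0" if "sol_momentum k x = q" "x * q + sol_action k x < sol_action k 0" for x
    using that by (simp add: sol_action_def)
  note cs = critical_speed_less[OF k c E[OF q lt]]
  have uniq: "c' = c" if "critical_speed (- k) < c'" "c' < sqrt 2" "sol_momentum k c' = q" for c'
    using cs(3)[of c c'] cs(3)[of c' c] that q cs(2) c by (cases c c' rule: linorder_cases) auto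
  show "c' = c" if c': "0 < c'" "c' < sqrt 2" "sol_momentum k c' = q" "c' * q + sol_action k c' < sol_action k 0" for c'
    using uniq[of c'] critical_speed_less(2)[OF k c'(1,2) E[OF c'(3,4)]] c' by auto
  show "speed (- k) q = c"
    unfolding speed_def
  proof (rule the_equality)
    show "critical_speed (- k) < c \<and> c < sqrt 2 \<and> momentum (dark_soliton c (- k)) = q"
      using cs c q momentum_dark_soliton[OF k c] by auto
    fix c' assume "critical_speed (- k) < c' \<and> c' < sqrt 2 \<and> momentum (dark_soliton c' (- k)) = q"
    then show "c' = c" using uniq[of c'] momentum_dark_soliton(1)[OF k, of c'] cs(1) by auto
  qed
qed

section \<open>Minimal energy at fixed momentum\<close>

lemma NX_finite_energy: "u \<in> NX_space \<Longrightarrow> finite_energy_nonvanishing u"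
  by unfold_locales (auto simp: NX_space_def)

lemma energy_ge_legendre:
  assumes k: "k \<ge> 0" and u: "u \<in> NX_space"
  obtains c where "0 < c" "c \<le> sqrt 2" "energy (- k) u \<ge> c * momentum u + sol_action k c"
    "c < sqrt 2 \<Longrightarrow> energy (- k) u = c * momentum u + sol_action k c \<Longrightarrow> momentum u = sol_momentum k c \<Longrightarrow>
      equal_up_to_invariances u (dark_soliton c (- k))"
proof -
  interpret finite_energy_nonvanishing u by (rule NX_finite_energy[OF u])
  show ?thesis
  proof (cases "\<forall>x. h x \<le> 0")
    case True
    show ?thesis
      by (rule that[of "sqrt 2"]) (use energy_ge_flat[OF k] True in \<open>auto simp: sol_sqrt2\<close>)
  next
    case False
    then obtain x0 where x0: "h x0 > 0" "\<And>x. h x \<le> h x0" using h_max_attained by (metis not_le)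
    \<comment> \<open>The speed whose soliton has the same minimal modulus as
      \<open>u\<close>.\<close>
    define c where "c = sqrt (2 * (1 - h x0))"
    have c: "0 < c" "c < sqrt 2" using h_less_1[of x0] x0 by (auto simp: c_def)
    have hx: "h x0 = 1 - c\<^sup>2 / 2" using h_less_1[of x0] by (simp add: c_def field_simps)
    show ?thesis
      by (rule that[of c]) (use c energy_ge_peak(1)[OF c k hx x0(2)] equality_soliton[OF c k hx x0(2)] in auto)
  qed
qed

lemma energy_nonneg:
  assumes "k \<ge> 0"
  shows "energy (- k) u \<ge> 0"
  unfolding energy_def using assms by (auto intro!: add_nonneg_nonneg mult_nonneg_nonneg integral_nonneg_AE)

lemma bdd_below_energy: "k \<ge> 0 \<Longrightarrow> bdd_below (energy (- k) ` A)"
  using energy_nonneg by (intro bdd_belowI2[of _ 0]) auto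

lemma min_energy_subcritical:
  assumes k: "k \<ge> 0" and q: "q > 0" and s: "subcritical k q"
  shows "min_energy (- k) q = energy (- k) (dark_soliton (speed (- k) q) (- k))"
    "is_minimizer (- k) q (dark_soliton (speed (- k) q) (- k))"
    "min_energy (- k) q < sol_action k 0"
    "is_minimizer (- k) q u \<Longrightarrow> equal_up_to_invariances u (dark_soliton (speed (- k) q) (- k))"
proof -
  obtain c where c: "0 < c" "c < sqrt 2" "sol_momentum k c = q" "c * q + sol_action k c < sol_action k 0"
    "\<And>c'. 0 \<le> c' \<Longrightarrow> c' \<le> sqrt 2 \<Longrightarrow> c * q + sol_action k c \<le> c' * q + sol_action k c'"
    using legendre_minimizer[OF k q s] by blast
  note sp = speed_eq[OF k c(1-4)]
  note d = momentum_dark_soliton[OF k c(1,2)] energy_dark_soliton[OF k _ c(2)]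
  have e: "energy (- k) (dark_soliton c (- k)) = c * q + sol_action k c"
    using d(3) c by (simp add: sol_action_def)
  have ge: "c * q + sol_action k c \<le> energy (- k) u" if "u \<in> NX_space" "momentum u = q" for u
    using energy_ge_legendre[OF k that(1)] c(5) that(2) by (metis less_imp_le order_trans)
  have m: "min_energy (- k) q = c * q + sol_action k c"
    unfolding min_energy_def
  proof (rule antisym)
    show "(INF u\<in>{u \<in> NX_space. momentum u = q}. energy (- k) u) \<le> c * q + sol_action k c"
      using cINF_lower[OF bdd_below_energy[OF k], of "dark_soliton c (- k)" "{u \<in> NX_space. momentum u = q}"] d c(3) e by auto
    show "c * q + sol_action k c \<le> (INF u\<in>{u \<in> NX_space. momentum u = q}. energy (- k) u)"
      by (rule cINF_greatest) (use ge d c(3) in auto)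
  qed
  show "min_energy (- k) q = energy (- k) (dark_soliton (speed (- k) q) (- k))" unfolding sp(1) m e ..
  show "is_minimizer (- k) q (dark_soliton (speed (- k) q) (- k))" unfolding sp(1) is_minimizer_def m e using d c(3) by simp
  show "min_energy (- k) q < sol_action k 0" unfolding m by (rule c(4))
  assume "is_minimizer (- k) q u"
  then have u: "u \<in> NX_space" "momentum u = q" "energy (- k) u = c * q + sol_action k c" unfolding is_minimizer_def m by auto
  obtain c' where c': "0 < c'" "c' \<le> sqrt 2" "energy (- k) u \<ge> c' * momentum u + sol_action k c'"
    "c' < sqrt 2 \<Longrightarrow> energy (- k) u = c' * momentum u + sol_action k c' \<Longrightarrow> momentum u = sol_momentum k c' \<Longrightarrow>
      equal_up_to_invariances u (dark_soliton c' (- k))"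
    using energy_ge_legendre[OF k u(1)] by blast
  \<comment> \<open>The speed \<open>c'\<close> attached to the minimizer also minimizes c q + F(c).
    It is therefore interior with momentum \<open>q\<close>, and uniqueness of such a speed
    identifies it with \<open>c\<close>; the equality case of the lower bound then applies.\<close>
  have eq: "c' * q + sol_action k c' = c * q + sol_action k c" using c'(3) c(5)[of c'] c'(1,2) u by simp
  have lt: "c' * q + sol_action k c' < sol_action k 0" unfolding eq by (rule c(4))
  note i = legendre_minimum_interior[OF k q less_imp_le[OF c'(1)] c'(2) _ lt, unfolded eq, OF c(5)]
  have "c' = c" by (rule sp(2)[OF i lt])
  then show "equal_up_to_invariances u (dark_soliton (speed (- k) q) (- k))"
    using c'(4) u i eq unfolding sp(1) by simp
qed

lemma ex_plateau:
  assumes k: "k \<ge> 0" and c: "0 < c" "c < sqrt 2" and q: "sol_momentum k c \<le> q"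
  obtains u where "u \<in> NX_space" "momentum u = q" "energy (- k) u = c * q + sol_action k c"
proof -
  interpret soliton_profile k c by unfold_locales (use k c in auto)
  \<comment> \<open>The plateau length that supplies exactly the missing momentum
    \<open>q - sol_momentum k c\<close>.\<close>
  define l where "l = c * (q - sol_momentum k c) / (et 0)\<^sup>2"
  have l: "l \<ge> 0" using q c by (simp add: l_def)
  have le: "l * (et 0)\<^sup>2 = c * (q - sol_momentum k c)" using et_pos[of 0] by (simp add: l_def)
  have "l / c * (et 0)\<^sup>2 = q - sol_momentum k c" using le c by (simp add: field_simps)
  then have "momentum (plateau_soliton l) = q" using plateau_soliton_props(3)[OF c(1) l] by simp
  moreover have "energy (- k) (plateau_soliton l) = c * q + sol_action k c"
    using plateau_soliton_props(2)[OF c(1) l] le by (simp add: sol_action_def algebra_simps)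
  ultimately show ?thesis using that plateau_soliton_props(1)[OF c(1) l] by blast
qed

text \<open>For competitors a slow soliton must have momentum at most \<open>q\<close>, so that a
  plateau can fill the gap. Failure of subcriticality provides this: F(0) - F(c) <= c q, and the
  mean value theorem yields a speed below \<open>c\<close> with P <= q. The energies of these
  competitors tend to F(0).\<close>

lemma min_energy_not_subcritical:
  assumes k: "k \<ge> 0" and s: "\<not> subcritical k q"
  shows "min_energy (- k) q = sol_action k 0"
proof -
  let ?A = "{u \<in> NX_space. momentum u = q}"
  have ge: "sol_action k 0 \<le> energy (- k) u" if u: "u \<in> ?A" for u
  proof -
    obtain c where "0 < c" "c \<le> sqrt 2" "energy (- k) u \<ge> c * momentum u + sol_action k c"
      using energy_ge_legendre[OF k, of u] u by blast
    then show ?thesis using s u unfolding subcritical_def by force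
  qed
  have ex: "\<exists>u\<in>?A. energy (- k) u < sol_action k 0 + e" if e: "e > 0" for e
  proof -
    have "continuous_on {0..sqrt 2} (\<lambda>c. c * q + sol_action k c)"
      by (intro continuous_intros continuous_on_sol_action k)
    then have "continuous (at 0 within {0..sqrt 2}) (\<lambda>c. c * q + sol_action k c)"
      by (simp add: continuous_on_eq_continuous_within)
    then obtain d where d: "d > 0" "\<And>x. x \<in> {0..sqrt 2} \<Longrightarrow> dist x 0 < d \<Longrightarrow>
        dist (x * q + sol_action k x) (0 * q + sol_action k 0) < e"
      using e unfolding continuous_within_eps_delta by metis
    \<comment> \<open>The bound 1 keeps \<open>c\<close> below sqrt 2, and d / 2 keeps all smaller
      speeds within the continuity radius.\<close>
    define c where "c = min 1 (d / 2)"
    have c: "0 < c" "c \<le> 1" "c < d" using d(1) by (auto simp: c_def min_def)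
    have c2: "c < sqrt 2" using c(2) by (rule le_less_trans) simp
    obtain \<xi> where \<xi>: "0 < \<xi>" "\<xi> < c" "sol_action k 0 - sol_action k c = (c - 0) * sol_momentum k \<xi>"
      using sol_action_MVT[OF k order.refl c(1)] c2 by auto
    have "sol_action k 0 \<le> c * q + sol_action k c" using s c c2 unfolding subcritical_def by (meson less_imp_le not_less)
    then have "c * sol_momentum k \<xi> \<le> c * q" using \<xi>(3) by simp
    then have "sol_momentum k \<xi> \<le> q" using c by simp
    then obtain u where u: "u \<in> NX_space" "momentum u = q" "energy (- k) u = \<xi> * q + sol_action k \<xi>"
      using ex_plateau[OF k \<xi>(1)] \<xi>(2) c2 by (metis less_trans)
    have "\<bar>\<xi> * q + sol_action k \<xi> - sol_action k 0\<bar> < e"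
      using d(2)[of \<xi>] \<xi> c c2 by (auto simp: dist_real_def)
    then show ?thesis using u by (intro bexI[of _ u]) auto
  qed
  have ne: "?A \<noteq> {}" using ex[of 1] by auto
  show ?thesis unfolding min_energy_def
  proof (rule antisym)
    show "sol_action k 0 \<le> (INF u\<in>?A. energy (- k) u)" using ge by (intro cINF_greatest[OF ne]) auto
    show "(INF u\<in>?A. energy (- k) u) \<le> sol_action k 0"
    proof (rule field_le_epsilon)
      fix e :: real assume "e > 0"
      then obtain u where u: "u \<in> ?A" "energy (- k) u < sol_action k 0 + e" using ex by blast
      show "(INF u\<in>?A. energy (- k) u) \<le> sol_action k 0 + e"
        using cINF_lower[OF bdd_below_energy[OF k] u(1)] u(2) by simp
    qed
  qed
qed

section \<open>The critical momentum\<close>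

lemma not_vanishing_imp_NX:
  assumes v: "v \<in> X_space" and nz: "\<And>x. v x \<noteq> 0"
  shows "(INF x. norm (v x)) > 0"
proof -
  interpret finite_energy v by unfold_locales (rule v)
  obtain N where N: "N > 0" "\<And>x. \<bar>x\<bar> \<ge> N \<Longrightarrow> \<bar>h x\<bar> < 1 / 2" using h_small_outside[of "1/2"] by auto
  obtain y where y: "y \<in> {-N..N}" "\<And>x. x \<in> {-N..N} \<Longrightarrow> norm (v y) \<le> norm (v x)"
    using continuous_attains_inf[of "{-N..N}" "\<lambda>x. norm (v x)"] N(1) continuous_on_norm[OF cont_u[of "{-N..N}"]] by auto
  define d where "d = min (norm (v y)) (1 / 2)"
  have "d \<le> norm (v x)" for x
  proof (cases "x \<in> {-N..N}")
    case True then show ?thesis using y(2)[of x] by (simp add: d_def)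
  next
    case False
    then have "\<bar>x\<bar> \<ge> N" by auto
    then have "\<bar>h x\<bar> < 1 / 2" by (rule N(2))
    moreover have "(1 / 2)\<^sup>2 = (1 / 4 :: real)" by (simp add: power_divide)
    ultimately have "(norm (v x))\<^sup>2 \<ge> (1 / 2)\<^sup>2" unfolding norm_sq_u by argo
    then have "norm (v x) \<ge> 1 / 2" by (rule power2_le_imp_le) simp
    then show ?thesis by (simp add: d_def)
  qed
  then have "d \<le> (INF x. norm (v x))" by (intro cINF_greatest) auto
  moreover have "d > 0" using nz[of y] by (simp add: d_def)
  ultimately show ?thesis by simp
qed

text \<open>Below the black energy no function of \<open>X_space\<close> can vanish, which settles
  subcritical momenta. For the others the minimal energy equals the black energy, and the black
  soliton itself violates the defining condition.\<close>

lemma critical_momentum_subcritical: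
  assumes k: "k \<ge> 0"
  shows "critical_momentum (- k) = Sup {q. q > 0 \<and> subcritical k q}"
proof -
  have "(\<forall>v\<in>X_space. energy (- k) v \<le> min_energy (- k) q \<longrightarrow> (INF x. norm (v x)) > 0) \<longleftrightarrow> subcritical k q" if q: "q > 0" for q
  proof
    assume s: "subcritical k q"
    show "\<forall>v\<in>X_space. energy (- k) v \<le> min_energy (- k) q \<longrightarrow> (INF x. norm (v x)) > 0"
    proof (intro ballI impI)
      fix v assume v: "v \<in> X_space" "energy (- k) v \<le> min_energy (- k) q"
      interpret finite_energy v by unfold_locales (rule v)
      have "v x \<noteq> 0" for x
        using vanishing_energy_ge[OF k, of x] v(2) min_energy_subcritical(3)[OF k q s] by (auto simp: sol_action_0)
      then show "(INF x. norm (v x)) > 0" by (rule not_vanishing_imp_NX[OF v(1)])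
    qed
  next
    assume a: "\<forall>v\<in>X_space. energy (- k) v \<le> min_energy (- k) q \<longrightarrow> (INF x. norm (v x)) > 0"
    interpret soliton_profile k 0 by unfold_locales (use k in auto)
    show "subcritical k q"
    proof (rule ccontr)
      assume "\<not> subcritical k q"
      then have "(INF x. norm (dark_soliton 0 (- k) x)) > 0"
        using a black_soliton_props min_energy_not_subcritical[OF k] by (auto simp: sol_action_0)
      moreover have "(INF x. norm (dark_soliton 0 (- k) x)) \<le> norm (dark_soliton 0 (- k) 0)"
        by (rule cINF_lower[OF bdd_belowI2[of _ 0]]) auto
      ultimately show False using black_soliton_props(3) by simp
    qed
  qed
  then show ?thesis
    unfolding critical_momentum_def by (intro arg_cong[where f = Sup] Collect_cong) blast
qed

text \<open>Without these two facts the supremum in the critical momentum would carry no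
  information.\<close>

lemma subcritical_set:
  assumes k: "k \<ge> 0"
  shows "{q. q > 0 \<and> subcritical k q} \<noteq> {}" "bdd_above {q. q > 0 \<and> subcritical k q}"
proof -
  have s1: "1 \<le> sqrt (2::real)" by simp
  obtain \<xi> where \<xi>: "0 < \<xi>" "\<xi> < 1" "sol_action k 0 - sol_action k 1 = (1 - 0) * sol_momentum k \<xi>"
    using sol_action_MVT[OF k order.refl zero_less_one s1] by blast
  define p where "p = sol_momentum k \<xi>"
  have p: "p > 0" unfolding p_def using sol_momentum_pos[OF k \<xi>(1)] \<xi>(2) s1 by simp
  \<comment> \<open>Witness speed 1: F(0) = F(1) + p, which is more than F(1) + p / 2.\<close>
  have "subcritical k (p / 2)" unfolding subcritical_def
    by (rule exI[of _ 1]) (use p \<xi>(3) in \<open>simp add: p_def[symmetric]\<close>)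
  then show "{q. q > 0 \<and> subcritical k q} \<noteq> {}" using p half_gt_zero by blast
  obtain B where B: "B > 0" "\<And>c. 0 \<le> c \<Longrightarrow> c \<le> sqrt 2 \<Longrightarrow> \<bar>sol_momentum k c\<bar> \<le> B"
    using sol_momentum_bounded[OF k] by blast
  show "bdd_above {q. q > 0 \<and> subcritical k q}"
  proof (rule bdd_aboveI)
    fix q assume "q \<in> {q. q > 0 \<and> subcritical k q}"
    then obtain c where c: "0 < c" "c \<le> sqrt 2" "c * q + sol_action k c < sol_action k 0" unfolding subcritical_def by blast
    obtain \<xi> where \<xi>: "0 < \<xi>" "\<xi> < c" "sol_action k 0 - sol_action k c = (c - 0) * sol_momentum k \<xi>"
      using sol_action_MVT[OF k order.refl c(1,2)] by blast
    have "c * q < c * sol_momentum k \<xi>" using \<xi>(3) c(3) by simp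
    then have "q < sol_momentum k \<xi>" using c(1) by simp
    also have "\<dots> \<le> B" using B(2)[of \<xi>] \<xi> c by auto
    finally show "q \<le> B" by simp
  qed
qed

theorem theorem1p10:
  fixes \<kappa> :: real
  assumes "\<kappa> \<le> 0"
  shows "(\<forall>q :: real. 0 < q \<and> q < critical_momentum \<kappa> \<longrightarrow>
            is_minimizer \<kappa> q (dark_soliton (speed \<kappa> q) \<kappa>) \<and>
            min_energy \<kappa> q = energy \<kappa> (dark_soliton (speed \<kappa> q) \<kappa>) \<and>
            (\<forall>u. is_minimizer \<kappa> q u \<longrightarrow>
                 equal_up_to_invariances u (dark_soliton (speed \<kappa> q) \<kappa>))) \<and>
         (\<forall>q :: real. q > critical_momentum \<kappa> \<longrightarrow>
            min_energy \<kappa> q = energy \<kappa> (dark_soliton 0 \<kappa>) \<and>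
            \<not> (\<exists>u. is_minimizer \<kappa> q u))"
proof -
  define k where "k = - \<kappa>"
  have k: "k \<ge> 0" and \<kappa>: "\<kappa> = - k" using assms by (auto simp: k_def)
  let ?Q = "{q. q > 0 \<and> subcritical k q}"
  note Q = subcritical_set[OF k]
  have black: "energy (- k) (dark_soliton 0 (- k)) = sol_action k 0"
    using energy_dark_soliton[OF k order.refl] by (simp add: sol_action_0)
  show ?thesis
    unfolding \<kappa> critical_momentum_subcritical[OF k]
  proof (intro conjI allI impI)
    fix q assume q: "0 < q \<and> q < Sup ?Q"
    then obtain q' where "q' \<in> ?Q" "q < q'" using less_cSup_iff[OF Q, of q] by blast
    then have s: "subcritical k q" using subcritical_mono[of k q' q] by auto
    have q0: "q > 0" using q by simp
    note m = min_energy_subcritical[OF k q0 s]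
    show "is_minimizer (- k) q (dark_soliton (speed (- k) q) (- k))" by (rule m(2))
    show "min_energy (- k) q = energy (- k) (dark_soliton (speed (- k) q) (- k))" by (rule m(1))
    fix u assume "is_minimizer (- k) q u"
    then show "equal_up_to_invariances u (dark_soliton (speed (- k) q) (- k))" by (rule m(4))
  next
    fix q assume q: "Sup ?Q < q"
    obtain q1 where "q1 \<in> ?Q" using Q(1) by blast
    \<comment> \<open>The set contains only positive momenta, so positivity is required before
      momenta above the supremum can be called not subcritical.\<close>
    then have pos: "0 < Sup ?Q" using cSup_upper[OF _ Q(2), of q1] by auto
    have ns: "\<not> subcritical k p" if "Sup ?Q < p" for p
      using cSup_upper[OF _ Q(2), of p] that pos by auto
    have m: "min_energy (- k) q = sol_action k 0" by (rule min_energy_not_subcritical[OF k ns[OF q]])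
    then show "min_energy (- k) q = energy (- k) (dark_soliton 0 (- k))" by (simp only: black)
    show "\<not> (\<exists>u. is_minimizer (- k) q u)"
    proof
      assume "\<exists>u. is_minimizer (- k) q u"
      then obtain u where u: "u \<in> NX_space" "momentum u = q" "energy (- k) u = sol_action k 0"
        unfolding is_minimizer_def m by auto
      obtain c where c: "0 < c" "c \<le> sqrt 2" "energy (- k) u \<ge> c * momentum u + sol_action k c"
        using energy_ge_legendre[OF k u(1)] by blast
      \<comment> \<open>A minimizer gives c q + F(c) <= F(0) with c > 0. Lowering the momentum to
        \<open>p\<close> makes the inequality strict, so \<open>p\<close> would be subcritical
        although it lies above the supremum.\<close>
      obtain p where p: "Sup ?Q < p" "p < q" using dense[OF q] by blast
      have "c * p < c * q" using c p by simp
      then have "c * p + sol_action k c < sol_action k 0" using c(3) u by simp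
      then show False using ns[OF p(1)] c unfolding subcritical_def by blast
    qed
  qed
qed

end
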